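(* Let $\Bbbk$ be a field, $X$ a finite set, and $\Sigma=(X,W,f)$ a terminating rewriting system on $\Bbbk\langle X\rangle$; put $R=\{w-f(w): w\in W\}$. Suppose that $(T(V),d)$ is a word-homogeneous acyclic extension of finite type of the Shafarevich complex $\mathrm{Sha}(W,\Bbbk\langle X\rangle)$. Then the rewriting system $\Sigma$ is convergent if and only if there exists an acyclic extension of the Shafarevich complex $\mathrm{Sha}(R,\Bbbk\langle X\rangle)$ of the form $(T(V),d+d')$ in which the perturbation $d'$ is $\Sigma$-filtered.
   Context: **Rewriting.** $\langle X\rangle$ is the free monoid on $X$ (its elements are called monomials) and $\Bbbk\langle X\rangle$, its linear span, is the free unital associative algebra. For $g\in\Bbbk\langle X\rangle$, $\mathrm{supp}(g)$ is the set of monomials occurring in $g$ with non-zero coefficient. A rewriting system is a triple $\Sigma=(X,W,f)$ with $W\subset\langle X\rangle$ and $f\colon W\to\Bbbk\langle X\rangle$ a function. Put $R=\{w-f(w):w\in W\}$, $A_\Sigma=\Bbbk\langle X\rangle/(R)$ and $A_{\Sigma_0}=\Bbbk\langle X\rangle/(W)$. For $w\in W$, $a,b\in\langle X\rangle$, the basic reduction associated to $(a,w,b)$ is the linear endomorphism $\rho$ of $\Bbbk\langle X\rangle$ with $\rho(awb)=af(w)b$ and $\rho(m)=m$ for all other monomials $m$. An element $g$ is irreducible if $\rho(g)=g$ for every basic reduction $\rho$. A normal form of $g$ is an irreducible element $\bar g$ with the same coset as $g$ in $A_\Sigma$. $\Sigma$ is terminating if for every $g$ and every infinite sequence $\rho_1,\rho_2,\ldots$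 of basic reductions the sequence $\rho_1(g),\rho_2\rho_1(g),\rho_3\rho_2\rho_1(g),\ldots$ is eventually constant. Let $<_\Sigma$ be the smallest transitive relation on $\langle X\rangle$ such that $w'<_\Sigma w$ for all $w\in W$, $w'\in\mathrm{supp}(f(w))$, and such that $m<_\Sigma m'$ implies $amb<_\Sigma am'b$ for all $a,b\in\langle X\rangle$. Termination is identified with the property that $<_\Sigma$ is well-founded (every non-empty set of monomials has a $<_\Sigma$-minimal element; in particular $<_\Sigma$ is irreflexive), and this property is part of the standing assumption. A terminating $\Sigma$ is convergent if each $g\in\Bbbk\langle X\rangle$ has exactly one normal form. **Models.** Differential graded (dg) algebras are homologically graded with differential of degree $-1$ that is a graded derivation (Koszul sign rule). A quasi-free algebra is a dg algebra whose underlying graded algebra is a tensor algebra $T(V)$ on a graded vector space $V$; it is triangulated if there is a decomposition into graded subspaces $V=\bigoplus_{j\ge1}V^{(j)}$ such that for all $j\ge0$ the differential of each $v\in V^{(j+1)}$ lies in the subalgebra generated by $\bigoplus_{1\le k\le j}V^{(k)}$. A model of a dg algebra $A$ is a triangulated quasi-free algebra with a surjective quasi-isomorphism of dg algebras onto $A$; ordinary algebras are viewed as dg algebras concentrated in degree $0$ with zero differential. For a subset $S\subset\Bbbk\langle X\rangle$, the Shafarevich complex $\mathrm{Sha}(S,\Bbbk\langle X\rangle)$ is the dg algebra $(T(V),d)$ with $V=V_0\oplus V_1$, $V_0=\Bbbk X$, $V_1$ having basis $\{e_s\}_{s\in S}$, and $d$ the derivation with $d(x)=0$ for $x\in X$ and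 $d(e_s)=s$. An acyclic extension of $\mathrm{Sha}(S,\Bbbk\langle X\rangle)$ is a model $(T(V),d)$ of $\Bbbk\langle X\rangle/(S)$ that is concentrated in non-negative homological degrees and in homological degrees zero and one is isomorphic to $\mathrm{Sha}(S,\Bbbk\langle X\rangle)$; so $V_0\cong\Bbbk X$, $V_1$ has basis $\{e_s\}_{s\in S}$, and $d(e_s)=s$. For $S=W$ the basis elements of $V_1$ are denoted $e_w$, $w\in W$. That $(T(V),d+d')$ is an acyclic extension of $\mathrm{Sha}(R,\Bbbk\langle X\rangle)$ means in particular that $d'$ is a degree $-1$ derivation with $d'|_{V_0}=0$ and $d'(e_w)=-f(w)$ for all $w\in W$, the element $e_w$ now playing the role of the basis element indexed by $w-f(w)\in R$. It is of finite type if $\dim V_n<\infty$ for all $n\ge0$. A dg algebra $(B,d)$ is word-homogeneous if $B=\bigoplus_{u\in\langle X\rangle}B_u$ as a direct sum of subcomplexes with $B_{u_1}B_{u_2}\subseteq B_{u_1u_2}$; elements of $B_u$ are word-homogeneous of grade $u$. The algebra $A_{\Sigma_0}$ is word-homogeneous in the obvious way. For a word-homogeneous acyclic extension $(T(V),d)$ of $\mathrm{Sha}(W,\Bbbk\langle X\rangle)$, the grading on $T(V)$ is induced from a grading by $\langle X\rangle$ on $V$, with each $x\in X$ of grade $x$ and each $e_w$ of grade $w$, and the map to $A_{\Sigma_0}$ preserves grades. A linear endomorphism of a word-homogeneous algebra is $\Sigma$-filtered if it sends every element of grade $u$ to a linear combination of elements of grades strictly less than $u$ with respect to $<_\Sigma$.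 *)

theory Defs
  imports "HOL-Library.Poly_Mapping" "HOL-Algebra.QuotRing" "HOL-Algebra.Subrings"
    "HOL-Algebra.Module"
begin

section \<open>Free algebras\<close>

text \<open>With lists under concatenation as an additive monoid, the convolution product of
  \<^theory>\<open>HOL-Library.Poly_Mapping\<close> makes \<open>'v list \<Rightarrow>\<^sub>0 'k\<close> the free unital associative
  algebra on the type \<open>'v\<close>.\<close>

instantiation list :: (type) monoid_add
begin
definition zero_list :: "'a list" where "zero_list = []"
definition plus_list :: "'a list \<Rightarrow> 'a list \<Rightarrow> 'a list" where "plus_list u v = u @ v"
instance by standard (simp_all add: zero_list_def plus_list_def)
end

type_synonym ('v, 'k) falg = "'v list \<Rightarrow>\<^sub>0 'k"

definition monomial :: "'v list \<Rightarrow> ('v, 'k::field) falg" where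
  "monomial u = Poly_Mapping.single u 1"

definition scale :: "'k::field \<Rightarrow> ('v, 'k) falg \<Rightarrow> ('v, 'k) falg" where
  "scale c = Poly_Mapping.map ((*) c)"

definition lin_ext :: "('u list \<Rightarrow> ('v, 'k::field) falg) \<Rightarrow> ('u, 'k) falg \<Rightarrow> ('v, 'k) falg" where
  "lin_ext h p = (\<Sum>m\<in>Poly_Mapping.keys p. scale (Poly_Mapping.lookup p m) (h m))"

definition free_algebra :: "'v set \<Rightarrow> ('k::field, ('v, 'k) falg) module" where
  "free_algebra X = \<lparr>carrier = {p. Poly_Mapping.keys p \<subseteq> lists X}, mult = (*), one = 1,
     zero = 0, add = (+), smult = scale\<rparr>"


section \<open>Linear algebra over the type class field\<close>

definition scalar_ring :: "'k::field ring" where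
  "scalar_ring = \<lparr>carrier = UNIV, mult = (*), one = 1, zero = 0, add = (+)\<rparr>"

definition lin_subspace :: "('k::field, 'a, 'm) module_scheme \<Rightarrow> 'a set \<Rightarrow> bool" where
  "lin_subspace A H \<longleftrightarrow> submodule H (scalar_ring :: 'k ring) A"

definition direct_sum ::
  "('k::field, 'a, 'm) module_scheme \<Rightarrow> 'i set \<Rightarrow> ('i \<Rightarrow> 'a set) \<Rightarrow> 'a set \<Rightarrow> bool" where
  "direct_sum A I U N \<longleftrightarrow> lin_subspace A N \<and> (\<forall>i\<in>I. lin_subspace A (U i) \<and> U i \<subseteq> N) \<and>
     (\<forall>x\<in>N. \<exists>!c. (\<forall>i\<in>I. c i \<in> U i) \<and> (\<forall>i. i \<notin> I \<longrightarrow> c i = \<zero>\<^bsub>A\<^esub>) \<and>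
        finite {i. c i \<noteq> \<zero>\<^bsub>A\<^esub>} \<and> x = finsum A c {i. c i \<noteq> \<zero>\<^bsub>A\<^esub>})"

definition linear_between ::
  "('k, 'a, 'm) module_scheme \<Rightarrow> ('k, 'b, 'n) module_scheme \<Rightarrow> ('a \<Rightarrow> 'b) \<Rightarrow> bool" where
  "linear_between A B D \<longleftrightarrow> D ` carrier A \<subseteq> carrier B \<and>
     (\<forall>x\<in>carrier A. \<forall>y\<in>carrier A. D (x \<oplus>\<^bsub>A\<^esub> y) = D x \<oplus>\<^bsub>B\<^esub> D y) \<and>
     (\<forall>c. \<forall>x\<in>carrier A. D (c \<odot>\<^bsub>A\<^esub> x) = c \<odot>\<^bsub>B\<^esub> D x)"

definition unital_subalgebra :: "('k::field, 'a, 'm) module_scheme \<Rightarrow> 'a set \<Rightarrow> bool" where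
  "unital_subalgebra A H \<longleftrightarrow> subring H A \<and> lin_subspace A H"


section \<open>Rewriting systems\<close>

definition rewriting_system ::
  "'x set \<Rightarrow> 'x list set \<Rightarrow> ('x list \<Rightarrow> ('x, 'k::field) falg) \<Rightarrow> bool" where
  "rewriting_system X W f \<longleftrightarrow> W \<subseteq> lists X \<and> (\<forall>w\<in>W. f w \<in> carrier (free_algebra X))"

definition relations :: "'x list set \<Rightarrow> ('x list \<Rightarrow> ('x, 'k::field) falg) \<Rightarrow> ('x, 'k) falg set" where
  "relations W f = (\<lambda>w. monomial w - f w) ` W"

definition rel_ideal :: "'x set \<Rightarrow> ('x, 'k::field) falg set \<Rightarrow> ('x, 'k) falg set" where
  "rel_ideal X S = genideal (free_algebra X) S"

definition basic_reduction ::
  "('x list \<Rightarrow> ('x, 'k::field) falg) \<Rightarrow> 'x list \<Rightarrow> 'x list \<Rightarrow> 'x list \<Rightarrow> ('x, 'k) falg \<Rightarrow> ('x, 'k) falg"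
where
  "basic_reduction f a w b =
     lin_ext (\<lambda>m. if m = a @ w @ b then monomial a * f w * monomial b else monomial m)"

definition basic_reductions ::
  "'x set \<Rightarrow> 'x list set \<Rightarrow> ('x list \<Rightarrow> ('x, 'k::field) falg) \<Rightarrow> (('x, 'k) falg \<Rightarrow> ('x, 'k) falg) set"
where
  "basic_reductions X W f =
     {basic_reduction f a w b | a w b. a \<in> lists X \<and> w \<in> W \<and> b \<in> lists X}"

definition normal_form ::
  "'x set \<Rightarrow> 'x list set \<Rightarrow> ('x list \<Rightarrow> ('x, 'k::field) falg) \<Rightarrow> ('x, 'k) falg \<Rightarrow> ('x, 'k) falg \<Rightarrow> bool"
where
  "normal_form X W f g h \<longleftrightarrow>
     h \<in> carrier (free_algebra X) \<and> (\<forall>\<rho>\<in>basic_reductions X W f. \<rho> h = h) \<and>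
     rel_ideal X (relations W f) +>\<^bsub>free_algebra X\<^esub> h =
     rel_ideal X (relations W f) +>\<^bsub>free_algebra X\<^esub> g"

text \<open>\<open>terminating\<close> is stabilisation of all sequences of basic reductions; well-foundedness of
  \<open>less_rs\<close>, often identified with it, is a separate condition.\<close>

primrec reduce_along :: "(nat \<Rightarrow> 'a \<Rightarrow> 'a) \<Rightarrow> 'a \<Rightarrow> nat \<Rightarrow> 'a" where
  "reduce_along \<rho> g 0 = g"
| "reduce_along \<rho> g (Suc n) = \<rho> n (reduce_along \<rho> g n)"

definition terminating ::
  "'x set \<Rightarrow> 'x list set \<Rightarrow> ('x list \<Rightarrow> ('x, 'k::field) falg) \<Rightarrow> bool" where
  "terminating X W f \<longleftrightarrow>
     (\<forall>g\<in>carrier (free_algebra X). \<forall>\<rho>. (\<forall>n. \<rho> n \<in> basic_reductions X W f) \<longrightarrow>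
        (\<exists>N. \<forall>n\<ge>N. reduce_along \<rho> g n = reduce_along \<rho> g N))"

inductive less_rs ::
  "'x set \<Rightarrow> 'x list set \<Rightarrow> ('x list \<Rightarrow> ('x, 'k::field) falg) \<Rightarrow> 'x list \<Rightarrow> 'x list \<Rightarrow> bool"
  for X W f where
  base: "w \<in> W \<Longrightarrow> w' \<in> Poly_Mapping.keys (f w) \<Longrightarrow> less_rs X W f w' w"
| in_context: "less_rs X W f m m' \<Longrightarrow> a \<in> lists X \<Longrightarrow> b \<in> lists X \<Longrightarrow>
    less_rs X W f (a @ m @ b) (a @ m' @ b)"
| trans: "less_rs X W f m m' \<Longrightarrow> less_rs X W f m' m'' \<Longrightarrow> less_rs X W f m m''"

definition convergent_rs ::
  "'x set \<Rightarrow> 'x list set \<Rightarrow> ('x list \<Rightarrow> ('x, 'k::field) falg) \<Rightarrow> bool" where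
  "convergent_rs X W f \<longleftrightarrow> terminating X W f \<and>
     (\<forall>g\<in>carrier (free_algebra X). \<exists>!h. normal_form X W f g h)"


section \<open>Differential graded algebras\<close>

record ('k, 'a) dga = "('k, 'a) module" +
  hcomp :: "int \<Rightarrow> 'a set"
  bd :: "'a \<Rightarrow> 'a"

locale dg_algebra = module "scalar_ring :: 'k::field ring" A + ring A
  for A :: "('k::field, 'a) dga" (structure) +
  assumes smult_mult_left: "\<lbrakk>x \<in> carrier A; y \<in> carrier A\<rbrakk> \<Longrightarrow> (c \<odot> x) \<otimes> y = c \<odot> (x \<otimes> y)"
    and smult_mult_right: "\<lbrakk>x \<in> carrier A; y \<in> carrier A\<rbrakk> \<Longrightarrow> x \<otimes> (c \<odot> y) = c \<odot> (x \<otimes> y)"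
    and grading: "direct_sum A UNIV (hcomp A) (carrier A)"
    and one_hcomp: "\<one> \<in> hcomp A 0"
    and mult_hcomp: "\<lbrakk>x \<in> hcomp A m; y \<in> hcomp A n\<rbrakk> \<Longrightarrow> x \<otimes> y \<in> hcomp A (m + n)"
    and bd_linear: "linear_between A A (bd A)"
    and bd_hcomp: "x \<in> hcomp A n \<Longrightarrow> bd A x \<in> hcomp A (n - 1)"
    and bd_bd: "x \<in> carrier A \<Longrightarrow> bd A (bd A x) = \<zero>"
    and leibniz: "\<lbrakk>x \<in> hcomp A n; y \<in> carrier A\<rbrakk> \<Longrightarrow>
      bd A (x \<otimes> y) = bd A x \<otimes> y \<oplus> ((- 1 :: 'k) powi n) \<odot> (x \<otimes> bd A y)"

definition dga_hom :: "('k, 'a) dga \<Rightarrow> ('k, 'b) dga \<Rightarrow> ('a \<Rightarrow> 'b) \<Rightarrow> bool" where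
  "dga_hom A B \<phi> \<longleftrightarrow> \<phi> \<in> ring_hom A B \<and> linear_between A B \<phi> \<and>
     (\<forall>n. \<phi> ` hcomp A n \<subseteq> hcomp B n) \<and> (\<forall>x\<in>carrier A. \<phi> (bd A x) = bd B (\<phi> x))"

definition cycles :: "('k, 'a) dga \<Rightarrow> int \<Rightarrow> 'a set" where
  "cycles A n = {x \<in> hcomp A n. bd A x = \<zero>\<^bsub>A\<^esub>}"

definition boundaries :: "('k, 'a) dga \<Rightarrow> int \<Rightarrow> 'a set" where
  "boundaries A n = bd A ` hcomp A (n + 1)"

definition homology :: "('k, 'a) dga \<Rightarrow> int \<Rightarrow> 'a set set" where
  "homology A n = (\<lambda>z. boundaries A n +>\<^bsub>A\<^esub> z) ` cycles A n"

text \<open>The map induced on homology sends a class \<open>C\<close> to the class containing \<open>\<phi> ` C\<close>.\<close>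

definition quasi_iso :: "('k, 'a) dga \<Rightarrow> ('k, 'b) dga \<Rightarrow> ('a \<Rightarrow> 'b) \<Rightarrow> bool" where
  "quasi_iso A B \<phi> \<longleftrightarrow> dga_hom A B \<phi> \<and>
     (\<forall>n. bij_betw (\<lambda>C. boundaries B n <+>\<^bsub>B\<^esub> \<phi> ` C) (homology A n) (homology B n))"

text \<open>The quotient of an algebra by a two-sided ideal; the ring structure is that of
  \<^const>\<open>FactRing\<close>, and the quotient sits in degree \<open>0\<close> with zero differential.\<close>

definition quotient_dga :: "('k, 'a, 'm) module_scheme \<Rightarrow> 'a set \<Rightarrow> ('k, 'a set) dga" where
  "quotient_dga A J = \<lparr>carrier = carrier (A Quot J), mult = mult (A Quot J), one = one (A Quot J),
     zero = zero (A Quot J), add = add (A Quot J),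
     smult = (\<lambda>c C. \<Union>x\<in>C. J +>\<^bsub>A\<^esub> (c \<odot>\<^bsub>A\<^esub> x)),
     hcomp = (\<lambda>n. if n = 0 then carrier (A Quot J) else {zero (A Quot J)}),
     bd = (\<lambda>_. zero (A Quot J))\<rparr>"

definition presented_dga :: "'x set \<Rightarrow> ('x, 'k::field) falg set \<Rightarrow> ('k, ('x, 'k) falg set) dga" where
  "presented_dga X S = quotient_dga (free_algebra X) (rel_ideal X S)"


section \<open>Quasi-free algebras and models\<close>

text \<open>Subalgebras are unital, so in a triangulation the generators in \<open>V 1\<close> have scalar
  differentials.  The graded vector space \<open>V\<close> is given by a homogeneous basis \<open>G\<close>, with \<open>hdeg\<close> the
  homological degree of its members; \<open>T(V)\<close> is then the free algebra on \<open>G\<close>.\<close>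

definition tensor_dga ::
  "'g set \<Rightarrow> ('g \<Rightarrow> int) \<Rightarrow> (('g, 'k::field) falg \<Rightarrow> ('g, 'k) falg) \<Rightarrow> ('k, ('g, 'k) falg) dga" where
  "tensor_dga G hdeg d = \<lparr>carrier = carrier (free_algebra G), mult = (*), one = 1,
     zero = 0, add = (+), smult = scale,
     hcomp = (\<lambda>n. {p \<in> carrier (free_algebra G).
                    \<forall>m\<in>Poly_Mapping.keys p. sum_list (map hdeg m) = n}),
     bd = d\<rparr>"

definition gen_space :: "'g set \<Rightarrow> ('g, 'k::field) falg set" where
  "gen_space G = {p. Poly_Mapping.keys p \<subseteq> (\<lambda>g. [g]) ` G}"

definition graded_subspace :: "('k::field, 'a) dga \<Rightarrow> 'a set \<Rightarrow> bool" where
  "graded_subspace A N \<longleftrightarrow> direct_sum A UNIV (\<lambda>n. N \<inter> hcomp A n) N"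

definition triangulated ::
  "'g set \<Rightarrow> ('g \<Rightarrow> int) \<Rightarrow> (('g, 'k::field) falg \<Rightarrow> ('g, 'k) falg) \<Rightarrow> bool" where
  "triangulated G hdeg d \<longleftrightarrow> (\<exists>V :: nat \<Rightarrow> ('g, 'k) falg set.
     direct_sum (tensor_dga G hdeg d) {1..} V (gen_space G) \<and>
     (\<forall>j\<ge>1. graded_subspace (tensor_dga G hdeg d) (V j)) \<and>
     (\<forall>j. \<forall>v\<in>V (Suc j).
        d v \<in> unital_subalgebra (tensor_dga G hdeg d) hull (\<Union>k\<in>{1..j}. V k)))"

definition is_model ::
  "'g set \<Rightarrow> ('g \<Rightarrow> int) \<Rightarrow> (('g, 'k::field) falg \<Rightarrow> ('g, 'k) falg) \<Rightarrow> ('k, 'b) dga \<Rightarrow>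
   (('g, 'k) falg \<Rightarrow> 'b) \<Rightarrow> bool" where
  "is_model G hdeg d A \<phi> \<longleftrightarrow> dg_algebra (tensor_dga G hdeg d) \<and> triangulated G hdeg d \<and>
     quasi_iso (tensor_dga G hdeg d) A \<phi> \<and> \<phi> ` carrier (tensor_dga G hdeg d) = carrier A"

definition gen_map :: "('u \<Rightarrow> 'v) \<Rightarrow> ('u, 'k::field) falg \<Rightarrow> ('v, 'k) falg" where
  "gen_map h = lin_ext (\<lambda>m. monomial (map h m))"

text \<open>The derivation (with Koszul signs, of odd degree) taking the value \<open>\<delta> g\<close> on each
  generator \<open>g\<close>.\<close>

definition derivation_ext ::
  "('g \<Rightarrow> int) \<Rightarrow> ('g \<Rightarrow> ('g, 'k::field) falg) \<Rightarrow> ('g, 'k) falg \<Rightarrow> ('g, 'k) falg" where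
  "derivation_ext hdeg \<delta> = lin_ext (\<lambda>m. \<Sum>i<length m.
     scale ((- 1) powi sum_list (map hdeg (take i m)))
       (monomial (take i m) * \<delta> (m ! i) * monomial (drop (Suc i) m)))"

text \<open>In the Shafarevich complex, \<open>Inl x\<close> is the generator \<open>x\<close> and \<open>Inr s\<close> is \<open>e\<^sub>s\<close>.\<close>

definition sha ::
  "'x set \<Rightarrow> ('x, 'k::field) falg set \<Rightarrow> ('k, ('x + ('x, 'k) falg, 'k) falg) dga" where
  "sha X S = tensor_dga (Inl ` X \<union> Inr ` S) (case_sum (\<lambda>_. 0) (\<lambda>_. 1))
     (derivation_ext (case_sum (\<lambda>_. 0) (\<lambda>_. 1)) (case_sum (\<lambda>_. 0) (\<lambda>s. gen_map Inl s)))"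

text \<open>The isomorphism with the Shafarevich complex in degrees \<open>0\<close> and \<open>1\<close> is induced by the
  identifications \<open>\<iota>\<close> of \<open>X\<close> with the basis of \<open>V\<^sub>0\<close> and \<open>e\<close> of \<open>S\<close> with the basis of \<open>V\<^sub>1\<close>.\<close>

definition acyclic_extension ::
  "'x set \<Rightarrow> ('x, 'k::field) falg set \<Rightarrow> 'g set \<Rightarrow> ('g \<Rightarrow> int) \<Rightarrow> ('x \<Rightarrow> 'g) \<Rightarrow>
   (('x, 'k) falg \<Rightarrow> 'g) \<Rightarrow> (('g, 'k) falg \<Rightarrow> ('g, 'k) falg) \<Rightarrow>
   (('g, 'k) falg \<Rightarrow> ('x, 'k) falg set) \<Rightarrow> bool" where
  "acyclic_extension X S G hdeg \<iota> e d \<phi> \<longleftrightarrow>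
     is_model G hdeg d (presented_dga X S) \<phi> \<and>
     (\<forall>n<0. hcomp (tensor_dga G hdeg d) n = {\<zero>\<^bsub>tensor_dga G hdeg d\<^esub>}) \<and>
     (\<forall>n\<in>{0, 1}.
        bij_betw (gen_map (case_sum \<iota> e)) (hcomp (sha X S) n) (hcomp (tensor_dga G hdeg d) n) \<and>
        (\<forall>p\<in>hcomp (sha X S) n.
           gen_map (case_sum \<iota> e) (bd (sha X S) p) =
           bd (tensor_dga G hdeg d) (gen_map (case_sum \<iota> e) p)))"

text \<open>The dimension of \<open>V\<^sub>n\<close> is the number of members of the basis \<open>G\<close> of degree \<open>n\<close>.\<close>

definition finite_type :: "'g set \<Rightarrow> ('g \<Rightarrow> int) \<Rightarrow> bool" where
  "finite_type G hdeg \<longleftrightarrow> (\<forall>n\<ge>0. finite {g \<in> G. hdeg g = n})"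


section \<open>Word-homogeneity\<close>

definition word_homogeneous ::
  "'x set \<Rightarrow> ('k::field, 'a) dga \<Rightarrow> ('x list \<Rightarrow> 'a set) \<Rightarrow> bool" where
  "word_homogeneous X B U \<longleftrightarrow> direct_sum B (lists X) U (carrier B) \<and>
     (\<forall>u\<in>lists X. graded_subspace B (U u) \<and> bd B ` U u \<subseteq> U u) \<and>
     (\<forall>u\<in>lists X. \<forall>v\<in>lists X. \<forall>x\<in>U u. \<forall>y\<in>U v. x \<otimes>\<^bsub>B\<^esub> y \<in> U (u @ v))"

text \<open>The grading of \<open>T(V)\<close> induced from a grading of \<open>V\<close> in which \<open>g \<in> G\<close> has grade \<open>wt g\<close>.\<close>

definition tensor_grade :: "'g set \<Rightarrow> ('g \<Rightarrow> 'x list) \<Rightarrow> 'x list \<Rightarrow> ('g, 'k::field) falg set" where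
  "tensor_grade G wt u = {p \<in> carrier (free_algebra G).
     \<forall>m\<in>Poly_Mapping.keys p. concat (map wt m) = u}"

definition quotient_grade ::
  "'x set \<Rightarrow> ('x, 'k::field) falg set \<Rightarrow> 'x list \<Rightarrow> ('x, 'k) falg set set" where
  "quotient_grade X S u =
     range (\<lambda>c. rel_ideal X S +>\<^bsub>free_algebra X\<^esub> Poly_Mapping.single u c)"

definition word_homogeneous_extension ::
  "'x set \<Rightarrow> 'x list set \<Rightarrow> 'g set \<Rightarrow> ('g \<Rightarrow> int) \<Rightarrow> ('g \<Rightarrow> 'x list) \<Rightarrow> ('x \<Rightarrow> 'g) \<Rightarrow>
   (('x, 'k::field) falg \<Rightarrow> 'g) \<Rightarrow> (('g, 'k) falg \<Rightarrow> ('g, 'k) falg) \<Rightarrow>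
   (('g, 'k) falg \<Rightarrow> ('x, 'k) falg set) \<Rightarrow> bool" where
  "word_homogeneous_extension X W G hdeg wt \<iota> e d \<phi> \<longleftrightarrow>
     acyclic_extension X (monomial ` W) G hdeg \<iota> e d \<phi> \<and>
     wt ` G \<subseteq> lists X \<and> (\<forall>x\<in>X. wt (\<iota> x) = [x]) \<and> (\<forall>w\<in>W. wt (e (monomial w)) = w) \<and>
     word_homogeneous X (tensor_dga G hdeg d) (tensor_grade G wt) \<and>
     (\<forall>u\<in>lists X. \<phi> ` tensor_grade G wt u \<subseteq> quotient_grade X (monomial ` W) u)"

definition filtered_endo ::
  "'x set \<Rightarrow> ('x list \<Rightarrow> 'x list \<Rightarrow> bool) \<Rightarrow> ('k::field, 'a) dga \<Rightarrow> ('x list \<Rightarrow> 'a set) \<Rightarrow>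
   ('a \<Rightarrow> 'a) \<Rightarrow> bool" where
  "filtered_endo X lt B U D \<longleftrightarrow> linear_between B B D \<and>
     (\<forall>u\<in>lists X. \<forall>p\<in>U u. D p \<in> lin_subspace B hull (\<Union>v\<in>{v \<in> lists X. lt v u}. U v))"

end

theory Submission
  imports Defs "HOL-Library.Multiset"
begin

text \<open>Every argument cancels one word grade at a time and recurses on the multiset order of the
  finite set of grades.

  Let \<open>(T(V), d + d')\<close> be acyclic with \<open>d'\<close> filtered, and write an irreducible element of the ideal as
  \<open>(d + d') h\<close> with \<open>h\<close> of degree \<open>1\<close>. If \<open>u\<close> is a maximal grade of \<open>h\<close> with component \<open>h\<^sub>u\<close>, then
  \<open>d h\<^sub>u\<close> is the part of this element in grade \<open>u\<close>; it vanishes, because \<open>u\<close> contains a member of \<open>W\<close>.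
  Hence \<open>h\<^sub>u = d y\<close>, and \<open>h - (d + d') y\<close> has smaller grades than \<open>h\<close>. Eventually \<open>h\<close> becomes \<open>0\<close>.

  Conversely, the perturbed differential \<open>D\<close> is built on generators \<open>g\<close> by induction on the degree:
  \<open>D (d g)\<close> is a \<open>D\<close>-cycle supported on grades below that of \<open>g\<close>, and the same elimination (in degree
  \<open>0\<close>: reduction to the normal form \<open>0\<close>) writes it as \<open>D y\<close> with \<open>y\<close> supported on such grades; put
  \<open>D g = d g - y\<close>. Triangulation is automatic, since the generators have non-negative degrees.\<close>

section \<open>Linear algebra in free algebras\<close>

text \<open>The order \<open>less_rs\<close> is only partial: an element may have several maximal
  grades, and cancelling one may bring in many smaller ones. This is why the recursion runs over
  finite sets of grades. A single lemma, \<open>elimination\<close>, serves three situations that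
  differ in the invariant preserved: cycles of the perturbed differential in positive degree,
  elements of the ideal placed in degree 0, and elements of degree 1 with a prescribed irreducible
  boundary. Acyclicity of the given extension, together with its word grading, bounds a homogeneous
  cycle in its own grade, but only in degrees \<ge> 1; in degree 0 the homology is the presented
  algebra, and convergence has to replace exactness. The differentials of the definitions are
  constrained on the carrier only. Each is replaced by the derivation with the same values on
  generators, which is linear on the whole type; a perturbation is then a choice of values on
  generators.\<close>

lemma lookup_scale: "Poly_Mapping.lookup (scale c p) m = c * Poly_Mapping.lookup p m"
  by (simp add: scale_def Poly_Mapping.map.rep_eq when_def)

lemma keys_scale: "Poly_Mapping.keys (scale c p) \<subseteq> Poly_Mapping.keys p"
  by (auto simp: in_keys_iff lookup_scale)

text \<open>The locale \<open>vector_space\<close> works on a whole type; the carriers of the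
  definitions reappear below as subspaces spanned by words.\<close>

interpretation falg: vector_space "scale :: 'k::field \<Rightarrow> ('v, 'k) falg \<Rightarrow> ('v, 'k) falg"
  by standard (auto intro!: poly_mapping_eqI simp: lookup_scale lookup_add algebra_simps)

abbreviation lin :: "(('u, 'k::field) falg \<Rightarrow> ('v, 'k) falg) \<Rightarrow> bool" where
  "lin \<equiv> module_hom scale scale"

lemma linI:
  assumes "\<And>p q. F (p + q) = F p + F q" "\<And>c p. F (scale c p) = scale c (F p)"
  shows "lin F"
  by (simp add: module_hom_iff falg.module_axioms assms)

lemma lin_add: "lin F \<Longrightarrow> F (p + q) = F p + F q"
  and lin_scale: "lin F \<Longrightarrow> F (scale c p) = scale c (F p)"
  and lin_zero: "lin F \<Longrightarrow> F 0 = 0"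
  and lin_diff: "lin F \<Longrightarrow> F (p - q) = F p - F q"
  and lin_sum: "lin F \<Longrightarrow> F (sum h A) = (\<Sum>x\<in>A. F (h x))"
  by (simp_all add: module_hom.add module_hom.scale module_hom.zero module_hom.diff module_hom.sum)

lemma lin_id: "lin (\<lambda>p. p)"
  by (rule linI) auto

lemma lin_comp: "lin F \<Longrightarrow> lin H \<Longrightarrow> lin (\<lambda>p. F (H p))"
  by (rule linI) (simp_all add: lin_add lin_scale)

lemma lin_minus: "lin F \<Longrightarrow> lin H \<Longrightarrow> lin (\<lambda>p. F p - H p)"
  by (rule linI) (simp_all add: lin_add lin_scale falg.scale_right_diff_distrib)

lemma lin_plus: "lin F \<Longrightarrow> lin H \<Longrightarrow> lin (\<lambda>p. F p + H p)"
  by (rule linI) (simp_all add: lin_add lin_scale falg.scale_right_distrib)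

lemma lin_const_scale: "lin F \<Longrightarrow> lin (\<lambda>p. scale c (F p))"
  by (rule linI) (simp_all add: lin_add lin_scale falg.scale_right_distrib falg.scale_left_commute)

text \<open>A scalar is a multiple of the empty word, the unit of the algebra; compatibility with
  products on the left is then associativity.\<close>

lemma scale_eq_mult: "scale c p = Poly_Mapping.single [] c * p"
  by (simp add: scale_def mult_map_scale_conv_mult zero_list_def)

lemma scale_mult_left: "scale c p * q = scale c (p * q)"
  by (simp add: scale_eq_mult mult.assoc)

lemma monomial_mult: "monomial u * monomial v = monomial (u @ v)"
  by (simp add: monomial_def mult_single plus_list_def)

lemma monomial_Nil: "monomial [] = 1"
  by (simp add: monomial_def single_one zero_list_def[symmetric])

lemma lookup_monomial: "Poly_Mapping.lookup (monomial u) v = (if u = v then 1 else 0)"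
  by (simp add: monomial_def lookup_single when_def)

lemma keys_monomial [simp]: "Poly_Mapping.keys (monomial u :: ('v, 'k::field) falg) = {u}"
  by (simp add: monomial_def)

lemma monomial_neq_zero [simp]: "monomial u \<noteq> (0 :: ('v, 'k::field) falg)"
  by (metis keys_monomial keys_zero insert_not_empty)

lemma scale_monomial: "scale c (monomial u) = Poly_Mapping.single u c"
  by (simp add: scale_def monomial_def Poly_Mapping.map_single when_def)

lemma falg_expand: "p = (\<Sum>m\<in>Poly_Mapping.keys p. scale (Poly_Mapping.lookup p m) (monomial m))"
proof (rule poly_mapping_eqI)
  fix n
  have "(\<Sum>m\<in>Poly_Mapping.keys p. if m = n then Poly_Mapping.lookup p m else 0) = Poly_Mapping.lookup p n"
    by (simp add: sum.delta in_keys_iff)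
  then show "Poly_Mapping.lookup p n =
      Poly_Mapping.lookup (\<Sum>m\<in>Poly_Mapping.keys p. scale (Poly_Mapping.lookup p m) (monomial m)) n"
    by (simp add: lookup_sum lookup_scale lookup_monomial if_distrib[of "\<lambda>x. _ * x"] cong: if_cong)
qed

text \<open>Scalars are central although the algebra is not commutative: in the expansion of
  \<open>p\<close> into words, the empty word is neutral on both sides and coefficients
  commute.\<close>

lemma scale_mult_right: "p * scale c q = scale c (p * (q :: ('v, 'k::field) falg))"
proof -
  have "p * Poly_Mapping.single [] c = Poly_Mapping.single [] c * p"
    by (subst (1 2) falg_expand[of p])
       (simp add: sum_distrib_left sum_distrib_right scale_monomial mult_single plus_list_def mult.commute)
  then show ?thesis
    by (simp add: scale_eq_mult mult.assoc[symmetric])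
qed

lemma lin_mult_right: "lin F \<Longrightarrow> lin (\<lambda>p. F p * q)"
  by (rule linI) (simp_all add: lin_add lin_scale distrib_right scale_mult_left)

lemma lin_mult_left: "lin F \<Longrightarrow> lin (\<lambda>p. q * F p)"
  by (rule linI) (simp_all add: lin_add lin_scale distrib_left scale_mult_right)

lemma lin_ext_superset:
  assumes "finite A" "Poly_Mapping.keys p \<subseteq> A"
  shows "lin_ext h p = (\<Sum>m\<in>A. scale (Poly_Mapping.lookup p m) (h m))"
  unfolding lin_ext_def
  using assms by (intro sum.mono_neutral_left) (auto simp: in_keys_iff)

lemma lin_lin_ext:
  fixes h :: "'u list \<Rightarrow> ('v, 'k::field) falg"
  shows "lin (lin_ext h)"
proof (rule linI)
  fix p q :: "('u, 'k) falg"
  let ?A = "Poly_Mapping.keys p \<union> Poly_Mapping.keys q"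
  have "lin_ext h (p + q) = (\<Sum>m\<in>?A. scale (Poly_Mapping.lookup (p + q) m) (h m))"
    using keys_add[of p q] by (intro lin_ext_superset) auto
  also have "\<dots> = lin_ext h p + lin_ext h q"
    by (simp add: lin_ext_superset[of ?A] lookup_add falg.scale_left_distrib sum.distrib)
  finally show "lin_ext h (p + q) = lin_ext h p + lin_ext h q" .
next
  fix c p
  show "lin_ext h (scale c p) = scale c (lin_ext h p)"
    using keys_scale[of c p]
    by (subst lin_ext_superset[of "Poly_Mapping.keys p"])
       (auto simp: lookup_scale lin_ext_def falg.scale_sum_right)
qed

lemma lin_ext_monomial [simp]: "lin_ext h (monomial m) = h m"
  by (simp add: lin_ext_def lookup_monomial)

text \<open>Carriers, degrees, grades and filtration steps are all spanned by words, so one operator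
  on sets of words covers them, and inclusions of subspaces become inclusions of sets.\<close>

definition wspan :: "'v list set \<Rightarrow> ('v, 'k::field) falg set" where
  "wspan M = {p. Poly_Mapping.keys p \<subseteq> M}"

lemma wspan_subspace: "falg.subspace (wspan M :: ('v, 'k::field) falg set)"
proof (rule falg.subspaceI)
  fix p q :: "('v, 'k) falg" and c
  assume "p \<in> wspan M"
  then show "scale c p \<in> wspan M"
    using keys_scale[of c p] by (auto simp: wspan_def)
  assume "q \<in> wspan M"
  with \<open>p \<in> wspan M\<close> show "p + q \<in> wspan M"
    using keys_add[of p q] by (auto simp: wspan_def)
qed (simp add: wspan_def)

lemmas wspan_0 [simp] = falg.subspace_0[OF wspan_subspace]
  and wspan_add = falg.subspace_add[OF wspan_subspace]
  and wspan_diff = falg.subspace_diff[OF wspan_subspace]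
  and wspan_neg = falg.subspace_neg[OF wspan_subspace]
  and wspan_scale = falg.subspace_scale[OF wspan_subspace]
  and wspan_sum = falg.subspace_sum[OF wspan_subspace]

lemma monomial_in_wspan [simp]: "(monomial m :: ('v, 'k::field) falg) \<in> wspan M \<longleftrightarrow> m \<in> M"
  by (simp add: wspan_def)

lemma wspan_mono: "M \<subseteq> N \<Longrightarrow> wspan M \<subseteq> wspan N"
  by (auto simp: wspan_def)

lemma wspan_monoD: "p \<in> wspan M \<Longrightarrow> M \<subseteq> N \<Longrightarrow> p \<in> wspan N"
  using wspan_mono by blast

lemma wspan_Int: "wspan (M \<inter> N) = wspan M \<inter> wspan N"
  by (auto simp: wspan_def)

lemma wspan_empty: "wspan {} = {0}"
  by (auto simp: wspan_def)

lemma wspan_in_subspace: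
  assumes U: "falg.subspace U" "\<And>m. m \<in> M \<Longrightarrow> monomial m \<in> U" and p: "p \<in> wspan M"
  shows "p \<in> U"
proof -
  have "(\<Sum>m\<in>Poly_Mapping.keys p. scale (Poly_Mapping.lookup p m) (monomial m)) \<in> U"
    using U p by (intro falg.subspace_sum falg.subspace_scale) (auto simp: wspan_def)
  then show ?thesis
    using falg_expand[of p] by simp
qed

lemma lin_vimage_subspace:
  assumes "lin F" "falg.subspace U" shows "falg.subspace {p. F p \<in> U}"
  using assms unfolding falg.subspace_def
  by (auto simp: lin_add lin_scale lin_zero)

lemma lin_wspan:
  assumes "lin F" "falg.subspace U" "\<And>m. m \<in> M \<Longrightarrow> F (monomial m) \<in> U" "p \<in> wspan M"
  shows "F p \<in> U"
  using wspan_in_subspace[OF lin_vimage_subspace[OF assms(1,2)], of M p] assms(3,4) by simp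

lemma lin_eqI:
  assumes "lin F" "lin H" "\<And>m. m \<in> M \<Longrightarrow> F (monomial m) = H (monomial m)" "p \<in> wspan M"
  shows "F p = H p"
  using lin_wspan[OF lin_minus[OF assms(1,2)] falg.subspace_single_0, of M p] assms(3,4) by simp

lemma wspan_mult:
  assumes "p \<in> wspan M" "q \<in> wspan N" "\<And>m n. m \<in> M \<Longrightarrow> n \<in> N \<Longrightarrow> m @ n \<in> K"
  shows "p * q \<in> wspan K"
proof -
  have "Poly_Mapping.keys (p * q) \<subseteq> {a @ b | a b. a \<in> Poly_Mapping.keys p \<and> b \<in> Poly_Mapping.keys q}"
    using keys_mult[of p q] by (simp add: plus_list_def)
  with assms show ?thesis
    unfolding wspan_def by blast
qed

lemma lin_gen_map: "lin (gen_map h)"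
  unfolding gen_map_def by (rule lin_lin_ext)

lemma gen_map_monomial [simp]: "gen_map h (monomial m) = monomial (map h m)"
  by (simp add: gen_map_def)

text \<open>Reduces an identity between bilinear expressions to words; multiplicativity of linear
  extensions and the Leibniz rule are obtained this way.\<close>

lemma bilin_eqI:
  assumes "\<And>q. lin (\<lambda>p. F p q)" "\<And>q. lin (\<lambda>p. H p q)" "\<And>p. lin (F p)" "\<And>p. lin (H p)"
    and "\<And>m n. m \<in> M \<Longrightarrow> n \<in> N \<Longrightarrow> F (monomial m) (monomial n) = H (monomial m) (monomial n)"
    and "p \<in> wspan M" "q \<in> wspan N"
  shows "F p q = H p q"
proof (rule lin_eqI[OF assms(1,2) _ assms(6)])
  fix m assume m: "m \<in> M"
  show "F (monomial m) q = H (monomial m) q"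
    by (rule lin_eqI[OF assms(3,4) _ assms(7)]) (rule assms(5)[OF m])
qed

lemma wspan_UNIV [simp]: "wspan UNIV = UNIV"
  by (auto simp: wspan_def)

lemma gen_map_mult: "gen_map h (p * q) = gen_map h p * gen_map h q"
  by (rule bilin_eqI[where M = UNIV and N = UNIV and F = "\<lambda>p q. gen_map h (p * q)"
        and H = "\<lambda>p q. gen_map h p * gen_map h q"])
     (rule lin_comp[OF lin_gen_map] lin_mult_left lin_mult_right lin_gen_map lin_id
      | simp add: monomial_mult)+

lemma gen_map_comp: "gen_map h (gen_map k p) = gen_map (h \<circ> k) p"
  by (rule lin_eqI[where M = UNIV, OF lin_comp[OF lin_gen_map lin_gen_map] lin_gen_map]) auto

lemma gen_map_wspan:
  assumes "p \<in> wspan M" "\<And>m. m \<in> M \<Longrightarrow> map h m \<in> N" shows "gen_map h p \<in> wspan N"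
  by (rule lin_wspan[OF lin_gen_map wspan_subspace _ assms(1)]) (simp add: assms(2))

section \<open>Projections onto spans of words\<close>

definition restr :: "'v list set \<Rightarrow> ('v, 'k::field) falg \<Rightarrow> ('v, 'k) falg" where
  "restr M = Poly_Mapping.mapp (\<lambda>m c. if m \<in> M then c else 0)"

lemma lookup_restr:
  fixes p :: "('v, 'k::field) falg"
  shows "Poly_Mapping.lookup (restr M p) m = (if m \<in> M then Poly_Mapping.lookup p m else 0)"
  by (simp add: restr_def lookup_mapp when_def in_keys_iff)

lemma lin_restr: "lin (restr M :: ('v, 'k::field) falg \<Rightarrow> ('v, 'k) falg)"
  by (rule linI; rule poly_mapping_eqI) (simp_all add: lookup_restr lookup_add lookup_scale)

lemma restr_monomial: "restr M (monomial m) = (if m \<in> M then monomial m else 0)"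
  by (rule poly_mapping_eqI) (simp add: lookup_restr lookup_monomial)

lemma keys_restr: "Poly_Mapping.keys (restr M p) = Poly_Mapping.keys p \<inter> M"
  by (auto simp: in_keys_iff lookup_restr split: if_splits)

lemma restr_id: "p \<in> wspan M \<Longrightarrow> restr M p = p"
  by (rule poly_mapping_eqI) (auto simp: wspan_def lookup_restr in_keys_iff)

lemma restr_zero: "p \<in> wspan N \<Longrightarrow> M \<inter> N = {} \<Longrightarrow> restr M p = 0"
  by (rule poly_mapping_eqI) (auto simp: wspan_def lookup_restr in_keys_iff)

text \<open>The inverse is the linear extension of the inverse on words. Bijectivity is asked on the
  words in \<open>M\<close> only, which is what a comparison in a fixed degree provides.\<close>

lemma wspan_bij_betw:
  assumes "bij_betw (map h) M N"
  shows "bij_betw (gen_map h) (wspan M) (wspan N :: ('v, 'k::field) falg set)"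
proof (rule bij_betw_byWitness[where f' = "lin_ext (\<lambda>n. monomial (inv_into M (map h) n))"])
  note inv = bij_betw_inv_into_left[OF assms] bij_betw_inv_into_right[OF assms]
  show "\<forall>p\<in>wspan M. lin_ext (\<lambda>n. monomial (inv_into M (map h) n)) (gen_map h p) = p"
    by (rule ballI, rule lin_eqI[OF lin_comp[OF lin_lin_ext lin_gen_map] lin_id, of M]) (simp_all add: inv)
  show "\<forall>p\<in>wspan N. gen_map h (lin_ext (\<lambda>n. monomial (inv_into M (map h) n)) p) = p"
    by (rule ballI, rule lin_eqI[OF lin_comp[OF lin_gen_map lin_lin_ext] lin_id, of N]) (simp_all add: inv)
  show "gen_map h ` wspan M \<subseteq> wspan N"
    using gen_map_wspan[of _ M h N] bij_betwE[OF assms] by blast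
  show "lin_ext (\<lambda>n. monomial (inv_into M (map h) n)) ` wspan N \<subseteq> wspan M"
    by (rule image_subsetI, rule lin_wspan[OF lin_lin_ext wspan_subspace, of N])
       (use bij_betwE[OF bij_betw_inv_into[OF assms]] in auto)
qed

section \<open>Comparison with algebraic structures given by carriers\<close>

lemma cring_scalar_ring: "cring (scalar_ring :: 'k::field ring)"
proof (rule cringI)
  show "abelian_group (scalar_ring :: 'k ring)"
  proof (rule abelian_groupI)
    fix x :: 'k
    show "\<exists>y\<in>carrier scalar_ring. y \<oplus>\<^bsub>scalar_ring\<^esub> x = \<zero>\<^bsub>scalar_ring\<^esub>"
      by (rule bexI[of _ "- x"]) (simp_all add: scalar_ring_def)
  qed (simp_all add: scalar_ring_def ac_simps)
  show "comm_monoid (scalar_ring :: 'k ring)"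
    by (rule comm_monoidI) (simp_all add: scalar_ring_def ac_simps)
qed (simp add: scalar_ring_def algebra_simps)

text \<open>\<open>free_algebra\<close> and \<open>tensor_dga\<close> are records of different types
  with the same kind of algebra underneath; facts stated for any such record scheme hold for
  both.\<close>

definition word_algebra :: "'g set \<Rightarrow> ('k::field, ('g, 'k) falg, 'm) module_scheme \<Rightarrow> bool" where
  "word_algebra G R \<longleftrightarrow> carrier R = wspan (lists G) \<and> monoid.mult R = (*) \<and> one R = 1 \<and> zero R = 0 \<and>
     add R = (+) \<and> smult R = scale"

lemma word_algebra_free_algebra: "word_algebra G (free_algebra G)"
  by (simp add: word_algebra_def free_algebra_def wspan_def)

lemma word_algebra_tensor_dga: "word_algebra G (tensor_dga G hdeg d)"
  by (simp add: word_algebra_def tensor_dga_def free_algebra_def wspan_def)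

lemma carrier_free_algebra: "carrier (free_algebra X) = wspan (lists X)"
  by (simp add: free_algebra_def wspan_def)

context
  fixes G :: "'g set" and R :: "('k::field, ('g, 'k) falg, 'm) module_scheme"
  assumes R: "word_algebra G R"
begin

lemma word_algebra_simps:
  "carrier R = wspan (lists G)" "monoid.mult R = (*)" "one R = 1" "zero R = 0" "add R = (+)" "smult R = scale"
  using R by (simp_all add: word_algebra_def)

lemma abelian_group_word_algebra: "abelian_group R"
proof (rule abelian_groupI)
  fix x assume "x \<in> carrier R"
  then show "\<exists>y\<in>carrier R. y \<oplus>\<^bsub>R\<^esub> x = \<zero>\<^bsub>R\<^esub>"
    by (intro bexI[of _ "- x"]) (simp_all add: word_algebra_simps wspan_neg)
qed (simp_all add: word_algebra_simps ac_simps wspan_add)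

lemma ring_word_algebra: "ring R"
proof (rule ringI[OF abelian_group_word_algebra])
  show "monoid R"
  proof (rule monoidI)
    fix x y assume "x \<in> carrier R" "y \<in> carrier R"
    then show "x \<otimes>\<^bsub>R\<^esub> y \<in> carrier R"
      unfolding word_algebra_simps by (rule wspan_mult) auto
  next
    show "\<one>\<^bsub>R\<^esub> \<in> carrier R"
      by (simp add: word_algebra_simps flip: monomial_Nil)
  qed (simp_all add: word_algebra_simps mult.assoc)
qed (simp_all add: word_algebra_simps algebra_simps)

lemma module_word_algebra: "module (scalar_ring :: 'k ring) R"
  by (rule moduleI[OF cring_scalar_ring abelian_group_word_algebra])
     (simp_all add: word_algebra_simps scalar_ring_def wspan_scale falg.scale_left_distrib
       falg.scale_right_distrib)

lemma lin_subspace_iff: "lin_subspace R H \<longleftrightarrow> H \<subseteq> wspan (lists G) \<and> falg.subspace H"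
proof
  assume "lin_subspace R H"
  then interpret submodule H "scalar_ring :: 'k ring" R
    by (simp add: lin_subspace_def)
  show "H \<subseteq> wspan (lists G) \<and> falg.subspace H"
    using subset one_closed m_closed smult_closed
    by (auto simp: falg.subspace_def word_algebra_simps scalar_ring_def)
next
  assume H: "H \<subseteq> wspan (lists G) \<and> falg.subspace H"
  interpret abelian_group R by (rule abelian_group_word_algebra)
  have "subgroup H (add_monoid R)"
  proof (rule add.subgroupI)
    fix a assume "a \<in> H"
    then have "\<ominus>\<^bsub>R\<^esub> a = - a"
      using H by (intro minus_equality) (auto simp: word_algebra_simps wspan_neg)
    then show "\<ominus>\<^bsub>R\<^esub> a \<in> H"
      using H \<open>a \<in> H\<close> by (simp add: falg.subspace_neg)
  qed (use H falg.subspace_0 in \<open>auto simp: word_algebra_simps falg.subspace_add\<close>)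
  with H show "lin_subspace R H"
    by (simp add: lin_subspace_def submodule_def submodule_axioms_def word_algebra_simps
        scalar_ring_def falg.subspace_scale)
qed

lemma lin_subspace_wspan: "M \<subseteq> lists G \<Longrightarrow> lin_subspace R (wspan M)"
  by (simp add: lin_subspace_iff wspan_subspace wspan_mono)

lemma finsum_word_algebra:
  assumes "finite F" "\<And>i. i \<in> F \<Longrightarrow> c i \<in> wspan (lists G)"
  shows "finsum R c F = sum c F"
proof -
  interpret abelian_group R by (rule abelian_group_word_algebra)
  show ?thesis
    using assms by (induction F rule: finite_induct) (auto simp: word_algebra_simps Pi_def)
qed

text \<open>The component of \<open>x\<close> with index \<open>i\<close> is its restriction to the
  words in \<open>M i\<close>; disjointness of the \<open>M i\<close> leaves no other
  choice.\<close>

lemma direct_sum_wspan: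
  assumes N: "N = (\<Union>i\<in>I. M i)" "N \<subseteq> lists G"
    and disj: "\<And>i j m. i \<in> I \<Longrightarrow> j \<in> I \<Longrightarrow> m \<in> M i \<Longrightarrow> m \<in> M j \<Longrightarrow> i = j"
  shows "direct_sum R I (\<lambda>i. wspan (M i)) (wspan N)"
proof -
  let ?ok = "\<lambda>x c. (\<forall>i\<in>I. c i \<in> wspan (M i)) \<and> (\<forall>i. i \<notin> I \<longrightarrow> c i = 0) \<and> finite {i. c i \<noteq> 0} \<and>
    x = finsum R c {i. c i \<noteq> 0}"
  have MG: "wspan (M i) \<subseteq> (wspan (lists G) :: ('g, 'k) falg set)" if "i \<in> I" for i
    using N that by (intro wspan_mono) auto
  have "\<exists>!c. ?ok x c" if x: "x \<in> wspan N" for x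
  proof (rule ex1I)
    let ?c = "\<lambda>i. if i \<in> I then restr (M i) x else 0"
    \<comment> \<open>Every non-zero component contains a word of \<open>x\<close>, and a word
      determines its index, so only finitely many components are non-zero.\<close>
    have sub: "{i. ?c i \<noteq> 0} \<subseteq> (\<lambda>m. THE i. i \<in> I \<and> m \<in> M i) ` Poly_Mapping.keys x"
    proof
      fix i assume "i \<in> {i. ?c i \<noteq> 0}"
      then have i: "i \<in> I" "restr (M i) x \<noteq> 0" by (auto split: if_splits)
      then obtain m where m: "m \<in> Poly_Mapping.keys x" "m \<in> M i"
        using keys_restr[of "M i" x] by (auto simp: poly_mapping_eq_iff lookup_restr fun_eq_iff in_keys_iff split: if_splits)
      have "(THE i. i \<in> I \<and> m \<in> M i) = i"
        using disj m i by (intro the_equality) auto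
      with m show "i \<in> (\<lambda>m. THE i. i \<in> I \<and> m \<in> M i) ` Poly_Mapping.keys x" by force
    qed
    then have fin: "finite {i. ?c i \<noteq> 0}"
      by (rule finite_subset) simp
    have "x = sum ?c {i. ?c i \<noteq> 0}"
    proof (rule poly_mapping_eqI)
      fix m
      show "Poly_Mapping.lookup x m = Poly_Mapping.lookup (sum ?c {i. ?c i \<noteq> 0}) m"
      proof (cases "m \<in> Poly_Mapping.keys x")
        case True
        then obtain j where j: "j \<in> I" "m \<in> M j"
          using x N by (auto simp: wspan_def)
        have "Poly_Mapping.lookup (restr (M j) x) m \<noteq> 0"
          using j True by (simp add: lookup_restr in_keys_iff)
        then have "restr (M j) x \<noteq> 0" by force
        then have "j \<in> {i. ?c i \<noteq> 0}" using j(1) by simp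
        moreover have "Poly_Mapping.lookup (?c i) m = (if i = j then Poly_Mapping.lookup x m else 0)" for i
        proof (cases "i \<in> I \<and> m \<in> M i")
          case True
          with j disj have "i = j" by blast
          with j show ?thesis by (simp add: lookup_restr)
        next
          case False
          with j show ?thesis by (auto simp: lookup_restr)
        qed
        ultimately show ?thesis
          using fin by (simp add: lookup_sum sum.delta)
      next
        case False
        then have "Poly_Mapping.lookup (?c i) m = 0" for i
          by (simp add: lookup_restr in_keys_iff)
        then show ?thesis using False by (simp add: lookup_sum in_keys_iff)
      qed
    qed
    moreover have restr: "restr (M i) x \<in> wspan (M i)" for i
      by (simp add: wspan_def keys_restr)
    moreover have "?c i \<in> wspan (lists G)" for i
      using restr[of i] MG by auto
    ultimately show "?ok x ?c"
      using fin by (simp add: finsum_word_algebra)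
  next
    let ?c = "\<lambda>i. if i \<in> I then restr (M i) x else 0"
    fix c assume "?ok x c"
    then have c: "\<And>i. i \<in> I \<Longrightarrow> c i \<in> wspan (M i)" "\<And>i. i \<notin> I \<Longrightarrow> c i = 0" "finite {i. c i \<noteq> 0}"
      and x_eq: "x = finsum R c {i. c i \<noteq> 0}" by blast+
    let ?F = "{i. c i \<noteq> 0}"
    have FI: "?F \<subseteq> I" using c(2) by auto
    have "\<And>i. i \<in> ?F \<Longrightarrow> c i \<in> wspan (lists G)"
      using c(1) FI MG by blast
    then have xs: "x = sum c ?F"
      using x_eq finsum_word_algebra[OF c(3)] by metis
    \<comment> \<open>Restricting a given decomposition to \<open>M i\<close> kills all summands
      except the one with index \<open>i\<close>.\<close>
    have "c i = restr (M i) x" if i: "i \<in> I" for i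
    proof -
      have "restr (M i) (c j) = (if j = i then c i else 0)" if "j \<in> ?F" for j
      proof (cases "j = i")
        case True
        then show ?thesis using c(1) i by (simp add: restr_id)
      next
        case False
        then have "M i \<inter> M j = {}" using disj[of i j] i that FI by blast
        moreover have "c j \<in> wspan (M j)" using c(1) FI that by auto
        ultimately show ?thesis using False by (simp add: restr_zero)
      qed
      then have "restr (M i) x = (\<Sum>j\<in>?F. if j = i then c i else 0)"
        unfolding xs lin_sum[OF lin_restr] by (rule sum.cong[OF refl])
      also have "\<dots> = c i"
        using c(3) by (simp add: sum.delta)
      finally show ?thesis ..
    qed
    then show "c = ?c"
      using c(2) by (intro ext) simp
  qed
  then show ?thesis
    unfolding direct_sum_def
    using N by (simp add: word_algebra_simps lin_subspace_wspan wspan_mono UN_upper UN_subset_iff)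
qed

end

text \<open>Replacing one element by finitely many smaller ones decreases a finite multiset in the
  multiset extension of \<open>lt\<close>, which is well founded along with \<open>lt\<close>. Sets
  suffice, since coinciding grades are merged.\<close>

lemma finite_grades_induct [consumes 2, case_names step]:
  assumes "wfp lt" "finite A"
    and step: "\<And>A. finite A \<Longrightarrow>
      (\<And>u B. u \<in> A \<Longrightarrow> finite B \<Longrightarrow> B \<subseteq> A - {u} \<union> {v. lt v u} \<Longrightarrow> P B) \<Longrightarrow> P A"
  shows "P A"
  using assms(2)
proof (induction "mset_set A" arbitrary: A rule: wfp_induct_rule[OF wfp_multp[OF assms(1)]])
  case (1 A)
  show ?case
  proof (rule step[OF \<open>finite A\<close>])
    fix u B assume u: "u \<in> A" and B: "finite B" "B \<subseteq> A - {u} \<union> {v. lt v u}"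
    \<comment> \<open>The elements of \<open>?I\<close> are common to both sets and cancel;
      \<open>u\<close> is among those removed and dominates every new one.\<close>
    let ?I = "B \<inter> (A - {u})"
    have B_eq: "mset_set B = mset_set ?I + mset_set (B - ?I)"
      using B(1) by (subst mset_set_Union[symmetric]) (auto intro: arg_cong[where f = mset_set])
    have A_eq: "mset_set A = mset_set ?I + mset_set (A - ?I)"
      using \<open>finite A\<close> by (subst mset_set_Union[symmetric]) (auto intro: arg_cong[where f = mset_set])
    have "u \<in># mset_set (A - ?I)"
      using u \<open>finite A\<close> by simp
    moreover have "lt v u" if "v \<in># mset_set (B - ?I)" for v
      using that B by auto
    ultimately have "multp lt (mset_set B) (mset_set A)"
      unfolding B_eq A_eq by (intro one_step_implies_multp) auto
    with 1(1) B(1) show "P B" by blast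
  qed
qed

section \<open>Derivations\<close>

text \<open>The sum over positions, unfolded from the left: the first letter contributes its Koszul
  sign to all later positions. Inductions on words use this form.\<close>

primrec derivation_word ::
  "('g \<Rightarrow> int) \<Rightarrow> ('g \<Rightarrow> ('g, 'k::field) falg) \<Rightarrow> 'g list \<Rightarrow> ('g, 'k) falg" where
  "derivation_word hdeg \<delta> [] = 0"
| "derivation_word hdeg \<delta> (g # m) =
     \<delta> g * monomial m + scale ((- 1) powi hdeg g) (monomial [g] * derivation_word hdeg \<delta> m)"

lemma derivation_word_eq:
  fixes \<delta> :: "'g \<Rightarrow> ('g, 'k::field) falg"
  shows "derivation_word hdeg \<delta> m = (\<Sum>i<length m. scale ((- 1) powi sum_list (map hdeg (take i m)))
     (monomial (take i m) * \<delta> (m ! i) * monomial (drop (Suc i) m)))"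
proof (induction m)
  case (Cons g m)
  have "scale ((- 1) powi (hdeg g + n)) (monomial (g # u) * p) =
      scale ((- 1) powi hdeg g) (monomial [g] * scale ((- 1) powi n) (monomial u * p))" for n u and p :: "('g, 'k) falg"
    by (simp add: power_int_add scale_mult_right monomial_mult mult.assoc[symmetric])
  then show ?case
    by (simp add: sum.lessThan_Suc_shift monomial_Nil Cons.IH sum_distrib_left falg.scale_sum_right
        mult.assoc del: sum.lessThan_Suc)
qed simp

lemma derivation_ext_eq: "derivation_ext hdeg \<delta> = lin_ext (derivation_word hdeg \<delta>)"
  by (simp add: derivation_ext_def derivation_word_eq[abs_def])

lemma lin_derivation_ext: "lin (derivation_ext hdeg \<delta>)"
  unfolding derivation_ext_eq by (rule lin_lin_ext)

lemma derivation_ext_monomial: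
  "derivation_ext hdeg \<delta> (monomial m) = derivation_word hdeg \<delta> m"
  by (simp add: derivation_ext_eq)

lemma derivation_word_append:
  fixes \<delta> :: "'g \<Rightarrow> ('g, 'k::field) falg"
  shows "derivation_word hdeg \<delta> (m @ n) = derivation_word hdeg \<delta> m * monomial n +
     scale ((- 1) powi sum_list (map hdeg m)) (monomial m * derivation_word hdeg \<delta> n)"
proof (induction m)
  case (Cons g m)
  have "monomial [g] * (monomial m * p) = monomial (g # m) * p" for p :: "('g, 'k) falg"
    by (simp add: monomial_mult flip: mult.assoc)
  then show ?case
    by (simp add: Cons.IH power_int_add scale_mult_left scale_mult_right distrib_left distrib_right
        falg.scale_right_distrib mult.assoc monomial_mult)
qed (simp add: monomial_Nil)

lemma derivation_ext_leibniz:
  assumes "p \<in> wspan {m. sum_list (map hdeg m) = n}"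
  shows "derivation_ext hdeg \<delta> (p * q) =
    derivation_ext hdeg \<delta> p * q + scale ((- 1) powi n) (p * derivation_ext hdeg \<delta> q)"
  by (rule bilin_eqI[where N = UNIV and F = "\<lambda>p q. derivation_ext hdeg \<delta> (p * q)"
        and H = "\<lambda>p q. derivation_ext hdeg \<delta> p * q + scale ((- 1) powi n) (p * derivation_ext hdeg \<delta> q)",
        OF _ _ _ _ _ assms])
     (rule lin_plus lin_const_scale lin_comp[OF lin_derivation_ext] lin_mult_left lin_mult_right
        lin_derivation_ext lin_id
      | simp add: monomial_mult derivation_ext_monomial derivation_word_append)+

lemma derivation_word_cong:
  "(\<And>g. g \<in> set m \<Longrightarrow> \<delta> g = \<delta>' g) \<Longrightarrow> derivation_word hdeg \<delta> m = derivation_word hdeg \<delta>' m"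
  by (induction m) auto

lemma derivation_ext_cong:
  assumes "p \<in> wspan M" "\<And>m g. m \<in> M \<Longrightarrow> g \<in> set m \<Longrightarrow> \<delta> g = \<delta>' g"
  shows "derivation_ext hdeg \<delta> p = derivation_ext hdeg \<delta>' p"
  by (rule lin_eqI[OF lin_derivation_ext lin_derivation_ext _ assms(1)])
     (auto simp: derivation_ext_monomial assms(2) intro!: derivation_word_cong)

text \<open>Differences of derivations are again derivations, so a perturbation is controlled by its
  values on generators.\<close>

lemma derivation_word_diff:
  "derivation_word hdeg \<delta> m - derivation_word hdeg \<delta>' m =
     derivation_word hdeg (\<lambda>g. \<delta> g - \<delta>' g) m"
proof (induction m)
  case (Cons g m)
  have "derivation_word hdeg \<delta> (g # m) - derivation_word hdeg \<delta>' (g # m) =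
     (\<delta> g - \<delta>' g) * monomial m + scale ((- 1) powi hdeg g)
       (monomial [g] * (derivation_word hdeg \<delta> m - derivation_word hdeg \<delta>' m))"
    by (simp add: left_diff_distrib right_diff_distrib falg.scale_right_diff_distrib)
  then show ?case by (simp add: Cons.IH)
qed simp

text \<open>Degree adds and grade concatenates along words, so the two conditions describe a double
  grading; a set of grades in place of a single one also covers filtration steps.\<close>

definition words :: "'g set \<Rightarrow> ('g \<Rightarrow> int) \<Rightarrow> ('g \<Rightarrow> 'x list) \<Rightarrow> int \<Rightarrow> 'x list set \<Rightarrow> 'g list set" where
  "words G hdeg wt n S = {m \<in> lists G. sum_list (map hdeg m) = n \<and> concat (map wt m) \<in> S}"

lemma wspan_times_monomial:
  "p \<in> wspan M \<Longrightarrow> (\<And>m. m \<in> M \<Longrightarrow> m @ n \<in> K) \<Longrightarrow> p * monomial n \<in> wspan K"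
  "p \<in> wspan M \<Longrightarrow> (\<And>m. m \<in> M \<Longrightarrow> n @ m \<in> K) \<Longrightarrow> monomial n * p \<in> wspan K"
  by (rule wspan_mult[of p M "monomial n" "{n}"] wspan_mult[of "monomial n" "{n}" p M]; simp)+

lemma concat_map_in_lists: "wt ` G \<subseteq> lists X \<Longrightarrow> m \<in> lists G \<Longrightarrow> concat (map wt m) \<in> lists X"
  by (induction m) (auto simp: image_subset_iff)

text \<open>Stated for an arbitrary family \<open>L\<close> stable under contexts, since it is
  applied to \<open>{u}\<close> to see that a derivation preserves grades, and to the set of grades
  below \<open>u\<close> to see that it lowers them.\<close>

lemma derivation_word_words:
  assumes wt: "wt ` G \<subseteq> lists X"
    and L: "\<And>u v a b. v \<in> L u \<Longrightarrow> a \<in> lists X \<Longrightarrow> b \<in> lists X \<Longrightarrow> a @ v @ b \<in> L (a @ u @ b)"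
    and "m \<in> lists G" "\<And>g. g \<in> set m \<Longrightarrow> \<delta> g \<in> wspan (words G hdeg wt (hdeg g - 1) (L (wt g)))"
  shows "derivation_word hdeg \<delta> m \<in>
    wspan (words G hdeg wt (sum_list (map hdeg m) - 1) (L (concat (map wt m))))"
  using assms(3,4)
proof (induction m rule: list.induct)
  case (Cons g m)
  then have g: "g \<in> G" "wt g \<in> lists X" and m: "m \<in> lists G" "concat (map wt m) \<in> lists X"
    using wt concat_map_in_lists[OF wt, of m] by (auto simp: image_subset_iff)
  let ?K = "wspan (words G hdeg wt (sum_list (map hdeg (g # m)) - 1) (L (concat (map wt (g # m)))))"
  have "\<delta> g * monomial m \<in> ?K"
    using Cons.prems(2)[of g] m L[of _ "wt g" "[]" "concat (map wt m)"]
    by (intro wspan_times_monomial(1)[of _ "words G hdeg wt (hdeg g - 1) (L (wt g))"])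
       (auto simp: words_def)
  moreover have "monomial [g] * derivation_word hdeg \<delta> m \<in> ?K"
    using Cons.IH[OF m(1)] Cons.prems(2) g L[of _ "concat (map wt m)" "wt g" "[]"]
    by (intro wspan_times_monomial(2)[of _ "words G hdeg wt (sum_list (map hdeg m) - 1) (L (concat (map wt m)))"])
       (auto simp: words_def)
  ultimately show ?case
    by (simp add: wspan_add wspan_scale)
qed simp

text \<open>The square of a derivation of odd degree is a derivation, hence vanishes on a word as
  soon as it vanishes on the letters.\<close>

lemma derivation_ext_square_zero:
  fixes \<delta> :: "'g \<Rightarrow> ('g, 'k::field) falg"
  assumes "\<And>g. g \<in> set m \<Longrightarrow> derivation_ext hdeg \<delta> (\<delta> g) = 0"
    and "\<And>g. g \<in> set m \<Longrightarrow> \<delta> g \<in> wspan {m. sum_list (map hdeg m) = hdeg g - 1}"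
  shows "derivation_ext hdeg \<delta> (derivation_ext hdeg \<delta> (monomial m)) = 0"
  using assms
proof (induction m)
  case (Cons g m)
  let ?D = "derivation_ext hdeg \<delta>"
  let ?s = "(- 1) powi hdeg g :: 'k"
  have "?D (monomial (g # m)) = \<delta> g * monomial m + scale ?s (monomial [g] * ?D (monomial m))"
    by (simp add: derivation_ext_monomial)
  moreover have "?D (\<delta> g * monomial m) = scale ((- 1) powi (hdeg g - 1)) (\<delta> g * ?D (monomial m))"
    using Cons.prems[of g] by (subst derivation_ext_leibniz[of _ _ "hdeg g - 1"]) auto
  moreover have "?D (monomial [g] * ?D (monomial m)) = \<delta> g * ?D (monomial m)"
    using Cons by (subst derivation_ext_leibniz[of _ _ "hdeg g"])
      (auto simp: derivation_ext_monomial monomial_Nil)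
  \<comment> \<open>Passing over \<open>\<delta> g\<close> instead of \<open>g\<close> flips the
    sign; this makes the two mixed terms cancel.\<close>
  moreover have "(- 1) powi (hdeg g - 1) = - ?s"
    by (simp add: power_int_diff)
  ultimately show ?case
    by (simp add: lin_add[OF lin_derivation_ext] lin_scale[OF lin_derivation_ext]
        flip: falg.scale_left_distrib)
qed (simp add: derivation_ext_monomial lin_zero[OF lin_derivation_ext])

section \<open>Elimination of leading grades\<close>

locale graded_words =
  fixes X :: "'x set" and G :: "'g set" and hdeg :: "'g \<Rightarrow> int" and wt :: "'g \<Rightarrow> 'x list"
    and lt :: "'x list \<Rightarrow> 'x list \<Rightarrow> bool"
  assumes wt_in: "wt ` G \<subseteq> lists X"
    and hdeg_nonneg: "g \<in> G \<Longrightarrow> 0 \<le> hdeg g"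
    and wfp_lt: "wfp lt"
    and lt_trans: "lt u v \<Longrightarrow> lt v w \<Longrightarrow> lt u w"
    and lt_context: "lt u v \<Longrightarrow> a \<in> lists X \<Longrightarrow> b \<in> lists X \<Longrightarrow> lt (a @ u @ b) (a @ v @ b)"
begin

abbreviation grade :: "'g list \<Rightarrow> 'x list" where
  "grade m \<equiv> concat (map wt m)"

abbreviation T :: "int \<Rightarrow> 'x list set \<Rightarrow> ('g, 'k::field) falg set" where
  "T n S \<equiv> wspan (words G hdeg wt n S)"

definition grades :: "('g, 'k::field) falg \<Rightarrow> 'x list set" where
  "grades p = grade ` Poly_Mapping.keys p"

definition down :: "'x list set \<Rightarrow> 'x list set" where
  "down S = {v. \<exists>u\<in>S. v = u \<or> lt v u}"

definition part :: "'x list \<Rightarrow> ('g, 'k::field) falg \<Rightarrow> ('g, 'k) falg" where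
  "part u = restr {m. grade m = u}"

text \<open>Imposed in one degree at a time, because during the construction the perturbed
  differential is under control only up to the degree reached so far.\<close>

definition filtered_at ::
  "(('g, 'k::field) falg \<Rightarrow> ('g, 'k) falg) \<Rightarrow> (('g, 'k) falg \<Rightarrow> ('g, 'k) falg) \<Rightarrow> int \<Rightarrow> bool" where
  "filtered_at d D n \<longleftrightarrow>
     (\<forall>u. \<forall>p\<in>T n {u}. d p \<in> T (n - 1) {u} \<and> D p - d p \<in> T (n - 1) {v. lt v u})"

lemma filtered_atD:
  assumes "filtered_at d D n" "p \<in> T n {u}"
  shows "d p \<in> T (n - 1) {u}" "D p - d p \<in> T (n - 1) {v. lt v u}"
  using assms by (auto simp: filtered_at_def)

lemma lt_irrefl: "\<not> lt u u"
  using wfp_lt by (metis wfp_imp_irreflp irreflpD)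

lemma T_mono: "S \<subseteq> S' \<Longrightarrow> T n S \<subseteq> T n S'"
  by (intro wspan_mono) (auto simp: words_def)

lemma T_monoD: "p \<in> T n S \<Longrightarrow> S \<subseteq> S' \<Longrightarrow> p \<in> T n S'"
  using T_mono by blast

lemma in_down: "v \<in> S \<Longrightarrow> v \<in> down S"
  by (auto simp: down_def)

lemma grades_subset: "p \<in> T n S \<Longrightarrow> grades p \<subseteq> S"
  by (auto simp: wspan_def words_def grades_def)

lemma finite_grades: "finite (grades p)"
  by (simp add: grades_def)

lemma part_in_T: "p \<in> T n UNIV \<Longrightarrow> part u p \<in> T n {u}"
  by (auto simp: wspan_def words_def part_def keys_restr)

lemma part_id: "p \<in> T n {u} \<Longrightarrow> part u p = p"
  unfolding part_def by (rule restr_id, erule wspan_monoD) (auto simp: words_def)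

lemma part_zero: "p \<in> T n S \<Longrightarrow> u \<notin> S \<Longrightarrow> part u p = 0"
  unfolding part_def by (erule restr_zero) (auto simp: words_def)

lemma lin_part: "lin (part u :: ('g, 'k::field) falg \<Rightarrow> ('g, 'k) falg)"
  unfolding part_def by (rule lin_restr)

lemma part_0 [simp]: "part u 0 = 0"
  by (rule lin_zero[OF lin_part])

lemma minus_part_in_T: "p \<in> T n UNIV \<Longrightarrow> p - part u p \<in> T n (grades p - {u})"
  by (auto simp: wspan_def words_def grades_def part_def in_keys_iff lookup_minus lookup_restr
      split: if_splits)

lemma filtered_at_T:
  assumes "lin D" "filtered_at d D n" "p \<in> T n S"
  shows "D p \<in> T (n - 1) (down S)"
proof (rule lin_wspan[OF assms(1) wspan_subspace _ assms(3)])
  fix m assume m: "m \<in> words G hdeg wt n S"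
  then have "monomial m \<in> T n {grade m}" "grade m \<in> S"
    by (auto simp: words_def)
  then have "d (monomial m) \<in> T (n - 1) (down S)"
    and "D (monomial m) - d (monomial m) \<in> T (n - 1) (down S)"
    using filtered_atD[OF assms(2), of "monomial m" "grade m"]
    by (auto intro: in_down T_monoD[of _ _ "{grade m}"] T_monoD[of _ _ "{v. lt v (grade m)}"] simp: down_def)
  from wspan_add[OF this] show "D (monomial m) \<in> T (n - 1) (down S)"
    by simp
qed

text \<open>Nothing else survives in grade \<open>u\<close>: the perturbation of the part in grade
  \<open>u\<close> drops strictly below \<open>u\<close>, and the other grades of \<open>z\<close>
  reach \<open>u\<close> only if \<open>u\<close> lies below one of them.\<close>

lemma part_maximal:
  assumes "lin D" "filtered_at d D n" "z \<in> T n UNIV"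
    and "\<And>v. v \<in> grades z \<Longrightarrow> \<not> lt u v"
  shows "part u (D z) = d (part u z)"
proof -
  let ?y = "part u z"
  have y: "?y \<in> T n {u}" by (rule part_in_T[OF assms(3)])
  then have dy: "d ?y \<in> T (n - 1) {u}" "D ?y - d ?y \<in> T (n - 1) {v. lt v u}"
    using assms(2) by (auto simp: filtered_at_def)
  have "D (z - ?y) \<in> T (n - 1) (down (grades z - {u}))"
    by (rule filtered_at_T[OF assms(1,2) minus_part_in_T[OF assms(3)]])
  moreover have "u \<notin> down (grades z - {u})"
    using assms(4) by (auto simp: down_def)
  ultimately have "part u (D (z - ?y)) = 0"
    by (rule part_zero)
  moreover have "part u (D ?y - d ?y) = 0"
    by (rule part_zero[OF dy(2)]) (simp add: lt_irrefl)
  moreover have "D z = d ?y + (D ?y - d ?y) + D (z - ?y)"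
    by (simp add: lin_diff[OF assms(1)])
  then have "part u (D z) = part u (d ?y) + part u (D ?y - d ?y) + part u (D (z - ?y))"
    by (simp only: lin_add[OF lin_part])
  ultimately show ?thesis
    using part_id[OF dy(1)] by simp
qed

text \<open>Subtracting \<open>D y\<close> removes the component in grade \<open>u\<close> and
  leaves an error below \<open>u\<close>, which is the decrease demanded by
  \<open>elimination\<close>.\<close>

lemma cancel_part:
  assumes "filtered_at d D (n + 1)" "z \<in> T n UNIV" "y \<in> T (n + 1) {u}" "d y = part u z"
  shows "z - D y \<in> T n UNIV" "grades (z - D y) \<subseteq> grades z - {u} \<union> {v. lt v u}"
proof -
  have dy: "D y - d y \<in> T n {v. lt v u}"
    using assms(1,3) by (auto simp: filtered_at_def)
  have "z - part u z - (D y - d y) \<in> T n (grades z - {u} \<union> {v. lt v u})"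
    by (rule wspan_diff[OF T_monoD[OF minus_part_in_T[OF assms(2)]] T_monoD[OF dy]]) auto
  moreover have "z - D y = z - part u z - (D y - d y)"
    by (simp add: assms(4))
  ultimately have *: "z - D y \<in> T n (grades z - {u} \<union> {v. lt v u})"
    by simp
  then show "grades (z - D y) \<subseteq> grades z - {u} \<union> {v. lt v u}"
    by (rule grades_subset)
  from * show "z - D y \<in> T n UNIV"
    by (rule T_monoD) simp
qed

text \<open>\<open>Q\<close> is the invariant that guarantees a next step. The corrections add up to
  the primitive, and all of them lie at or below grades of \<open>z\<close>; this bound is what
  later makes the perturbation filtered.\<close>

lemma elimination:
  assumes "lin D"
    and step: "\<And>z. Q z \<Longrightarrow> z \<noteq> 0 \<Longrightarrow> \<exists>u\<in>grades z. \<exists>y\<in>T n {u}. Q (z - D y) \<and>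
      grades (z - D y) \<subseteq> grades z - {u} \<union> {v. lt v u}"
    and "Q z"
  shows "\<exists>y\<in>T n (down (grades z)). D y = z"
proof -
  define A where "A = grades z"
  have "finite A" by (simp add: A_def finite_grades)
  with wfp_lt show ?thesis
    using A_def \<open>Q z\<close>
  proof (induction A arbitrary: z rule: finite_grades_induct)
    case (step A)
    show ?case
    proof (cases "z = 0")
      case True
      then show ?thesis using lin_zero[OF \<open>lin D\<close>] by (intro bexI[of _ 0]) auto
    next
      case False
      then obtain u y where u: "u \<in> grades z" and y: "y \<in> T n {u}" and Qzy: "Q (z - D y)"
        and sub: "grades (z - D y) \<subseteq> grades z - {u} \<union> {v. lt v u}"
        using assms(2)[OF \<open>Q z\<close>] by blast
      then obtain y' where y': "y' \<in> T n (down (grades (z - D y)))" "D y' = z - D y"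
        using step.IH[OF u[folded step.prems(1)] finite_grades sub[folded step.prems(1)] refl Qzy] by blast
      \<comment> \<open>New grades lie below \<open>u\<close>, itself a grade of \<open>z\<close>,
        so by transitivity the bound for the remainder implies the bound for
        \<open>z\<close>.\<close>
      have "down (grades (z - D y)) \<subseteq> down (grades z)"
      proof
        fix v assume "v \<in> down (grades (z - D y))"
        then obtain w where w: "w \<in> grades (z - D y)" "v = w \<or> lt v w" by (auto simp: down_def)
        then have "w \<in> grades z \<or> lt w u" using sub by blast
        with w(2) u show "v \<in> down (grades z)" unfolding down_def using lt_trans by blast
      qed
      then have "y + y' \<in> T n (down (grades z))"
        using u by (intro wspan_add T_monoD[OF y] T_monoD[OF y'(1)]) (auto intro: in_down)
      moreover have "D (y + y') = z"
        by (simp add: lin_add[OF \<open>lin D\<close>] y'(2))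
      ultimately show ?thesis by blast
    qed
  qed
qed

lemma exists_maximal_grade:
  assumes "z \<noteq> 0"
  obtains u where "u \<in> grades z" "\<And>v. v \<in> grades z \<Longrightarrow> \<not> lt u v"
proof -
  have "Poly_Mapping.keys z \<noteq> {}"
  proof
    assume "Poly_Mapping.keys z = {}"
    then have "z = 0" by (subst falg_expand) simp
    with assms show False by simp
  qed
  then have "grades z \<noteq> {}" by (simp add: grades_def)
  moreover have "asymp_on (grades z) lt" "transp_on (grades z) lt"
    using lt_trans lt_irrefl by (blast intro: asymp_onI transp_onI)+
  ultimately obtain u where u: "u \<in> grades z" "\<forall>v\<in>grades z. v \<noteq> u \<longrightarrow> \<not> lt u v"
    using Finite_Set.bex_max_element[OF finite_grades] by blast
  show ?thesis
  proof (rule that[OF u(1)])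
    fix v assume "v \<in> grades z"
    then show "\<not> lt u v" using u(2) lt_irrefl by (cases "v = u") auto
  qed
qed

text \<open>The primitive is required in the grade of the cycle, as the cancellation of a single
  grade demands.\<close>

definition exact_at :: "(('g, 'k::field) falg \<Rightarrow> ('g, 'k) falg) \<Rightarrow> int \<Rightarrow> bool" where
  "exact_at d n \<longleftrightarrow> (\<forall>u. \<forall>p\<in>T n {u}. d p = 0 \<longrightarrow> (\<exists>y\<in>T (n + 1) {u}. d y = p))"

text \<open>A part of maximal grade in a cycle for \<open>D\<close> is a cycle for \<open>d\<close>,
  hence of the form \<open>d y\<close>; the correction by \<open>D y\<close> is again a cycle
  because \<open>D\<close> squares to zero on degree \<open>n + 1\<close>.\<close>

lemma exact_at_perturbed:
  assumes "lin D" "filtered_at d D n" "filtered_at d D (n + 1)" "exact_at d n"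
    and DD: "\<And>y. y \<in> T (n + 1) UNIV \<Longrightarrow> D (D y) = 0"
    and "z \<in> T n UNIV" "D z = 0"
  shows "\<exists>y\<in>T (n + 1) (down (grades z)). D y = z"
proof (rule elimination[OF assms(1), where Q = "\<lambda>z. z \<in> T n UNIV \<and> D z = 0"])
  fix z assume z: "z \<in> T n UNIV \<and> D z = 0" "z \<noteq> 0"
  then obtain u where u: "u \<in> grades z" "\<And>v. v \<in> grades z \<Longrightarrow> \<not> lt u v"
    by (auto elim: exists_maximal_grade)
  then have "d (part u z) = 0"
    using part_maximal[OF assms(1,2), of z u] z by simp
  moreover have "part u z \<in> T n {u}"
    using z by (intro part_in_T) simp
  ultimately obtain y where y: "y \<in> T (n + 1) {u}" "d y = part u z"
    using assms(4) unfolding exact_at_def by blast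
  have "D (z - D y) = 0"
    using DD[OF T_monoD[OF y(1)]] z by (simp add: lin_diff[OF assms(1)])
  then show "\<exists>u\<in>grades z. \<exists>y\<in>T (n + 1) {u}. (z - D y \<in> T n UNIV \<and> D (z - D y) = 0) \<and>
      grades (z - D y) \<subseteq> grades z - {u} \<union> {v. lt v u}"
    using cancel_part[OF assms(3) conjunct1[OF z(1)] y] u(1) y(1) by blast
next
  show "z \<in> T n UNIV \<and> D z = 0"
    using assms(6,7) by (rule conjI)
qed

end

section \<open>Rewriting\<close>

locale rewriting =
  fixes X :: "'x set" and W :: "'x list set" and f :: "'x list \<Rightarrow> ('x, 'k::field) falg"
  assumes rs: "rewriting_system X W f"
    and wfp_less: "wfp (less_rs X W f)"
begin

abbreviation less :: "'x list \<Rightarrow> 'x list \<Rightarrow> bool" where "less \<equiv> less_rs X W f"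

abbreviation J :: "('x, 'k) falg set" where "J \<equiv> rel_ideal X (relations W f)"

definition relation :: "'x list \<Rightarrow> 'x list \<Rightarrow> 'x list \<Rightarrow> ('x, 'k) falg" where
  "relation a w b = monomial a * (monomial w - f w) * monomial b"

text \<open>The combinatorial form, a condition on the support alone; it is visibly stable under
  differences, on which uniqueness of normal forms rests.\<close>

definition irreducible :: "('x, 'k) falg \<Rightarrow> bool" where
  "irreducible g \<longleftrightarrow>
     (\<forall>a\<in>lists X. \<forall>w\<in>W. \<forall>b\<in>lists X. a @ w @ b \<notin> Poly_Mapping.keys g)"

lemma W_lists: "W \<subseteq> lists X" and f_in: "w \<in> W \<Longrightarrow> f w \<in> wspan (lists X)"
  using rs by (auto simp: rewriting_system_def carrier_free_algebra)

lemma less_irrefl: "\<not> less u u"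
  using wfp_less by (metis wfp_imp_irreflp irreflpD)

lemma less_lists:
  assumes "less u v" shows "u \<in> lists X" "v \<in> lists X"
proof -
  have "u \<in> lists X \<and> v \<in> lists X"
    using assms
  proof induction
    case (base w w')
    then show ?case using W_lists f_in[of w] by (auto simp: wspan_def)
  qed auto
  then show "u \<in> lists X" "v \<in> lists X" by auto
qed

lemma context_f:
  assumes "a \<in> lists X" "w \<in> W" "b \<in> lists X"
  shows "monomial a * f w * monomial b \<in> wspan {v. less v (a @ w @ b)}"
proof (rule wspan_times_monomial(1)[OF wspan_times_monomial(2)])
  show "f w \<in> wspan (Poly_Mapping.keys (f w))" by (simp add: wspan_def)
  show "a @ v \<in> (@) a ` Poly_Mapping.keys (f w)" if "v \<in> Poly_Mapping.keys (f w)" for v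
    using that by simp
  show "m @ b \<in> {v. less v (a @ w @ b)}" if "m \<in> (@) a ` Poly_Mapping.keys (f w)" for m
  proof -
    from that obtain v where "v \<in> Poly_Mapping.keys (f w)" "m = a @ v" by blast
    then show ?thesis
      using less_rs.in_context[OF less_rs.base[of w W v f X] assms(1,3)] assms(2) by simp
  qed
qed

lemma relation_eq: "relation a w b = monomial (a @ w @ b) - monomial a * f w * monomial b"
  by (simp add: relation_def left_diff_distrib right_diff_distrib monomial_mult)

text \<open>The rewritten word cannot reappear in its own replacement, since \<open>less\<close> is
  irreflexive.\<close>

lemma lookup_relation:
  assumes "a \<in> lists X" "w \<in> W" "b \<in> lists X"
  shows "Poly_Mapping.lookup (relation a w b) (a @ w @ b) = 1"
proof -
  have "a @ w @ b \<notin> Poly_Mapping.keys (monomial a * f w * monomial b)"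
    using context_f[OF assms] less_irrefl by (auto simp: wspan_def)
  then show ?thesis
    by (simp add: relation_eq lookup_minus lookup_monomial in_keys_iff)
qed

lemma relation_in:
  assumes "a \<in> lists X" "w \<in> W" "b \<in> lists X"
  shows "relation a w b \<in> wspan (insert (a @ w @ b) {v. less v (a @ w @ b)})"
  unfolding relation_eq by (rule wspan_diff) (auto intro: wspan_monoD[OF context_f[OF assms]])

lemma keys_reduce:
  assumes "a \<in> lists X" "w \<in> W" "b \<in> lists X"
  shows "Poly_Mapping.keys (g - scale (Poly_Mapping.lookup g (a @ w @ b)) (relation a w b))
    \<subseteq> Poly_Mapping.keys g - {a @ w @ b} \<union> {v. less v (a @ w @ b)}"
proof
  fix m assume "m \<in> Poly_Mapping.keys (g - scale (Poly_Mapping.lookup g (a @ w @ b)) (relation a w b))"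
  then have m: "Poly_Mapping.lookup g m \<noteq>
      Poly_Mapping.lookup g (a @ w @ b) * Poly_Mapping.lookup (relation a w b) m"
    by (simp add: in_keys_iff lookup_minus lookup_scale)
  then have "m \<noteq> a @ w @ b"
    by (auto simp: lookup_relation[OF assms])
  moreover have "m \<in> Poly_Mapping.keys g \<or> m \<in> Poly_Mapping.keys (relation a w b)"
    using m by (auto simp: in_keys_iff)
  ultimately show "m \<in> Poly_Mapping.keys g - {a @ w @ b} \<union> {v. less v (a @ w @ b)}"
    using relation_in[OF assms] by (auto simp: wspan_def)
qed

text \<open>A reduction subtracts a multiple of a relation, so it fixes \<open>g\<close> exactly
  when that multiple is zero; this is how irreducibility becomes a condition on the support.\<close>

lemma basic_reduction_eq:
  "basic_reduction f a w b g = g - scale (Poly_Mapping.lookup g (a @ w @ b)) (relation a w b)"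
proof (rule lin_eqI[where M = UNIV and F = "basic_reduction f a w b"
      and H = "\<lambda>g. g - scale (Poly_Mapping.lookup g (a @ w @ b)) (relation a w b)"])
  show "lin (basic_reduction f a w b)"
    unfolding basic_reduction_def by (rule lin_lin_ext)
  show "lin (\<lambda>g. g - scale (Poly_Mapping.lookup g (a @ w @ b)) (relation a w b))"
    by (rule linI) (simp_all add: lookup_add lookup_scale falg.scale_left_distrib
        falg.scale_right_diff_distrib)
  show "basic_reduction f a w b (monomial m) = monomial m -
      scale (Poly_Mapping.lookup (monomial m) (a @ w @ b)) (relation a w b)" for m
    by (simp add: basic_reduction_def lookup_monomial relation_eq)
qed simp

lemma irreducible_iff: "irreducible g \<longleftrightarrow> (\<forall>\<rho>\<in>basic_reductions X W f. \<rho> g = g)"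
proof
  assume "irreducible g"
  then have "basic_reduction f a w b g = g" if "a \<in> lists X" "w \<in> W" "b \<in> lists X" for a w b
    using that by (simp add: basic_reduction_eq irreducible_def in_keys_iff)
  then show "\<forall>\<rho>\<in>basic_reductions X W f. \<rho> g = g"
    unfolding basic_reductions_def by blast
next
  assume g: "\<forall>\<rho>\<in>basic_reductions X W f. \<rho> g = g"
  show "irreducible g"
    unfolding irreducible_def
  proof (intro ballI)
    fix a w b assume awb: "a \<in> lists X" "w \<in> W" "b \<in> lists X"
    then have "basic_reduction f a w b g = g"
      using g by (auto simp: basic_reductions_def)
    then have "Poly_Mapping.lookup (scale (Poly_Mapping.lookup g (a @ w @ b)) (relation a w b)) (a @ w @ b) = 0"
      by (auto simp: basic_reduction_eq)
    then show "a @ w @ b \<notin> Poly_Mapping.keys g"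
      by (simp add: lookup_scale lookup_relation[OF awb] in_keys_iff)
  qed
qed

lemma irreducible_diff: "irreducible g \<Longrightarrow> irreducible h \<Longrightarrow> irreducible (g - h)"
  by (auto simp: irreducible_def in_keys_iff lookup_minus)

lemma relations_in: "relations W f \<subseteq> carrier (free_algebra X)"
  using W_lists f_in by (auto simp: relations_def carrier_free_algebra intro!: wspan_diff)

lemma ideal_J: "ideal J (free_algebra X)"
  unfolding rel_ideal_def
  by (rule ring.genideal_ideal[OF ring_word_algebra[OF word_algebra_free_algebra] relations_in])

lemmas free_simps = word_algebra_simps[OF word_algebra_free_algebra]

lemma J_mult:
  assumes "p \<in> J" "q \<in> wspan (lists X)" shows "q * p \<in> J" "p * q \<in> J"
  using ideal.I_l_closed[OF ideal_J] ideal.I_r_closed[OF ideal_J] assms by (auto simp: free_simps)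

lemma single_Nil_in [simp]: "Poly_Mapping.single [] c \<in> wspan (lists X)"
  by (auto simp: wspan_def)

lemma J_in: "J \<subseteq> wspan (lists X)"
proof -
  interpret ideal J "free_algebra X" by (rule ideal_J)
  show ?thesis using a_subset by (simp add: free_simps)
qed

lemma subspace_J: "falg.subspace J"
proof -
  interpret additive_subgroup J "free_algebra X" by (rule ideal.axioms(1)[OF ideal_J])
  show ?thesis
  proof (rule falg.subspaceI)
    show "0 \<in> J"
      using zero_closed by (simp add: free_simps)
    show "p + q \<in> J" if "p \<in> J" "q \<in> J" for p q
      using a_closed[OF that] by (simp add: free_simps)
    show "scale c p \<in> J" if "p \<in> J" for c p
      unfolding scale_eq_mult by (rule J_mult[OF that]) simp
  qed
qed

lemma relation_in_J:
  assumes "a \<in> lists X" "w \<in> W" "b \<in> lists X" shows "relation a w b \<in> J"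
proof -
  have "monomial w - f w \<in> J"
    using ring.genideal_self[OF ring_word_algebra[OF word_algebra_free_algebra] relations_in] assms(2)
    by (auto simp: rel_ideal_def relations_def)
  with assms show ?thesis
    unfolding relation_def by (intro J_mult) auto
qed

text \<open>For proving that all elements of \<open>J\<close> have a property, here that of being a
  boundary, without writing them as sums of relations in context.\<close>

lemma J_minimal:
  assumes "falg.subspace K" "K \<subseteq> wspan (lists X)"
    and "\<And>p q. p \<in> K \<Longrightarrow> q \<in> wspan (lists X) \<Longrightarrow> p * q \<in> K \<and> q * p \<in> K"
    and "\<And>w. w \<in> W \<Longrightarrow> monomial w - f w \<in> K"
  shows "J \<subseteq> K"
proof -
  have "lin_subspace (free_algebra X) K"
    using assms(1,2) by (simp add: lin_subspace_iff[OF word_algebra_free_algebra])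
  then have "subgroup K (add_monoid (free_algebra X))"
    by (simp add: lin_subspace_def submodule_def)
  then have "ideal K (free_algebra X)"
    using assms(3) by (intro idealI[OF ring_word_algebra[OF word_algebra_free_algebra]])
      (auto simp: free_simps)
  moreover have "relations W f \<subseteq> K"
    using assms(4) by (auto simp: relations_def)
  ultimately show ?thesis
    unfolding rel_ideal_def
    by (rule ring.genideal_minimal[OF ring_word_algebra[OF word_algebra_free_algebra]])
qed

lemma coset_eq_iff:
  assumes "g \<in> wspan (lists X)" "h \<in> wspan (lists X)"
  shows "J +>\<^bsub>free_algebra X\<^esub> g = J +>\<^bsub>free_algebra X\<^esub> h \<longleftrightarrow> g - h \<in> J"
proof -
  interpret ring "free_algebra X" by (rule ring_word_algebra[OF word_algebra_free_algebra])
  have "\<ominus>\<^bsub>free_algebra X\<^esub> h = - h"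
    using assms by (intro minus_equality) (auto simp: free_simps wspan_neg)
  then have "g \<ominus>\<^bsub>free_algebra X\<^esub> h = g - h"
    by (simp add: a_minus_def free_simps)
  then show ?thesis
    using quotient_eq_iff_same_a_r_cos[OF ideal_J, of g h] assms by (simp add: free_simps)
qed

lemma normal_form_iff:
  assumes "g \<in> wspan (lists X)"
  shows "normal_form X W f g h \<longleftrightarrow> h \<in> wspan (lists X) \<and> irreducible h \<and> h - g \<in> J"
  using assms by (cases "h \<in> wspan (lists X)")
    (simp_all add: normal_form_def carrier_free_algebra irreducible_iff coset_eq_iff)

text \<open>As long as some word of the support contains a member of \<open>W\<close>, subtracting a
  multiple of the corresponding relation replaces that word by smaller ones and stays in the
  coset.\<close>

lemma exists_normal_form:
  assumes "g \<in> wspan (lists X)"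
  shows "\<exists>h\<in>wspan (lists X). irreducible h \<and> h - g \<in> J"
proof -
  define A where "A = Poly_Mapping.keys g"
  have "finite A" by (simp add: A_def)
  with wfp_less show ?thesis
    using A_def assms
  proof (induction A arbitrary: g rule: finite_grades_induct)
    case (step A)
    show ?case
    proof (cases "irreducible g")
      case True
      then show ?thesis using step.prems falg.subspace_0[OF subspace_J] by (intro bexI[of _ g]) auto
    next
      case False
      then obtain a w b where awb: "a \<in> lists X" "w \<in> W" "b \<in> lists X" and m: "a @ w @ b \<in> A"
        by (auto simp: irreducible_def step.prems)
      let ?r = "scale (Poly_Mapping.lookup g (a @ w @ b)) (relation a w b)"
      have r: "?r \<in> J"
        by (rule falg.subspace_scale[OF subspace_J relation_in_J[OF awb]])
      then have "g - ?r \<in> wspan (lists X)"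
        using step.prems(2) J_in by (intro wspan_diff) auto
      with step.IH[OF m finite_keys keys_reduce[OF awb, of g, folded step.prems(1)] refl]
      obtain h where h: "h \<in> wspan (lists X)" "irreducible h" "h - (g - ?r) \<in> J"
        by blast
      have "h - (g - ?r) - ?r \<in> J"
        by (rule falg.subspace_diff[OF subspace_J h(3) r])
      with h show ?thesis by auto
    qed
  qed
qed

text \<open>The difference of two normal forms is an irreducible element of the ideal; conversely,
  such an element and 0 are both normal forms of 0.\<close>

lemma convergent_rs_iff:
  assumes "terminating X W f"
  shows "convergent_rs X W f \<longleftrightarrow> (\<forall>g\<in>J. irreducible g \<longrightarrow> g = 0)"
proof
  assume conv: "convergent_rs X W f"
  show "\<forall>g\<in>J. irreducible g \<longrightarrow> g = 0"
  proof (intro ballI impI)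
    fix g assume g: "g \<in> J" "irreducible g"
    have "irreducible 0" by (simp add: irreducible_def)
    then have "normal_form X W f 0 0" "normal_form X W f 0 g"
      using g J_in falg.subspace_0[OF subspace_J] by (auto simp: normal_form_iff)
    moreover have "\<exists>!h. normal_form X W f 0 h"
      using conv by (auto simp: convergent_rs_def carrier_free_algebra)
    ultimately show "g = 0" by blast
  qed
next
  assume J0: "\<forall>g\<in>J. irreducible g \<longrightarrow> g = 0"
  have "\<exists>!h. normal_form X W f g h" if g: "g \<in> wspan (lists X)" for g
  proof (rule ex_ex1I)
    show "\<exists>h. normal_form X W f g h"
      using exists_normal_form[OF g] g by (auto simp: normal_form_iff)
    fix h h' assume "normal_form X W f g h" "normal_form X W f g h'"
    then have h: "irreducible h" "irreducible h'" "h - g \<in> J" "h' - g \<in> J"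
      using g by (auto simp: normal_form_iff)
    have "h - h' \<in> J"
      using falg.subspace_diff[OF subspace_J h(3,4)] by simp
    with J0 irreducible_diff[OF h(1,2)] show "h = h'" by auto
  qed
  with assms show "convergent_rs X W f"
    by (auto simp: convergent_rs_def carrier_free_algebra)
qed

end


section \<open>Words of degree 0 and 1 and their relation to rewriting\<close>

locale rewriting_words = rewriting X W f + graded_words X G hdeg wt "less_rs X W f"
  for X :: "'x set" and W :: "'x list set" and f :: "'x list \<Rightarrow> ('x, 'k::field) falg"
    and G :: "'g set" and hdeg :: "'g \<Rightarrow> int" and wt :: "'g \<Rightarrow> 'x list" +
  fixes \<iota> :: "'x \<Rightarrow> 'g" and \<epsilon> :: "'x list \<Rightarrow> 'g"
  assumes G0: "{g \<in> G. hdeg g = 0} = \<iota> ` X" and G1: "{g \<in> G. hdeg g = 1} = \<epsilon> ` W"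
    and wt_iota: "x \<in> X \<Longrightarrow> wt (\<iota> x) = [x]" and wt_eps: "w \<in> W \<Longrightarrow> wt (\<epsilon> w) = w"
begin

lemma iota: "x \<in> X \<Longrightarrow> \<iota> x \<in> G \<and> hdeg (\<iota> x) = 0"
  using G0 by blast

lemma eps: "w \<in> W \<Longrightarrow> \<epsilon> w \<in> G \<and> hdeg (\<epsilon> w) = 1"
  using G1 by blast

lemma degree_nonneg: "m \<in> lists G \<Longrightarrow> 0 \<le> sum_list (map hdeg m)"
  by (induction m rule: list.induct) (auto simp: hdeg_nonneg)

lemma grade_iota: "x \<in> lists X \<Longrightarrow> grade (map \<iota> x) = x"
  by (induction x rule: list.induct) (auto simp: wt_iota)

lemma degree_iota: "x \<in> lists X \<Longrightarrow> sum_list (map hdeg (map \<iota> x)) = 0"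
  by (induction x rule: list.induct) (auto simp: iota)

lemma iota_in: "x \<in> lists X \<Longrightarrow> map \<iota> x \<in> lists G"
  by (auto simp: iota)

lemma degree_0_words:
  assumes "m \<in> lists G" "sum_list (map hdeg m) = 0"
  shows "grade m \<in> lists X" "m = map \<iota> (grade m)"
proof -
  have "grade m \<in> lists X \<and> m = map \<iota> (grade m)"
    using assms
  proof (induction m rule: list.induct)
    case (Cons g m)
    then have "0 \<le> hdeg g" "0 \<le> sum_list (map hdeg m)"
      using hdeg_nonneg degree_nonneg[of m] by auto
    then have "hdeg g = 0" "sum_list (map hdeg m) = 0" using Cons.prems by auto
    moreover obtain x where "x \<in> X" "g = \<iota> x"
      using G0 Cons.prems \<open>hdeg g = 0\<close> by auto
    ultimately show ?case using Cons wt_iota by auto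
  qed simp
  then show "grade m \<in> lists X" "m = map \<iota> (grade m)" by auto
qed

text \<open>With all degrees non-negative, degree 1 leaves room for exactly one generator
  \<open>\<epsilon> w\<close>, placed between letters of degree 0. In particular every grade
  occurring in degree 1 contains a member of \<open>W\<close>.\<close>

lemma degree_1_words:
  assumes "m \<in> lists G" "sum_list (map hdeg m) = 1"
  obtains a w b where "a \<in> lists X" "w \<in> W" "b \<in> lists X" "m = map \<iota> a @ \<epsilon> w # map \<iota> b"
    "grade m = a @ w @ b"
proof -
  have "\<exists>a w b. a \<in> lists X \<and> w \<in> W \<and> b \<in> lists X \<and> m = map \<iota> a @ \<epsilon> w # map \<iota> b"
    using assms
  proof (induction m rule: list.induct)
    case (Cons g m)
    have nn: "0 \<le> hdeg g" "0 \<le> sum_list (map hdeg m)" and m: "m \<in> lists G" and g: "g \<in> G"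
      using hdeg_nonneg degree_nonneg[of m] Cons.prems by auto
    show ?case
    proof (cases "hdeg g = 0")
      case True
      then obtain x where x: "x \<in> X" "g = \<iota> x" using G0 g by auto
      obtain a w b where "a \<in> lists X \<and> w \<in> W \<and> b \<in> lists X \<and> m = map \<iota> a @ \<epsilon> w # map \<iota> b"
        using Cons m True by auto
      with x show ?thesis
        by (intro exI[of _ "x # a"] exI[of _ w] exI[of _ b]) auto
    next
      case False
      then have "hdeg g = 1" "sum_list (map hdeg m) = 0" using nn Cons.prems(2) by auto
      moreover obtain w where "w \<in> W" "g = \<epsilon> w" using G1 g \<open>hdeg g = 1\<close> by auto
      ultimately show ?thesis
        using degree_0_words[OF m] by (intro exI[of _ "[]"] exI[of _ w] exI[of _ "grade m"]) auto
    qed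
  qed simp
  then obtain a w b where "a \<in> lists X" "w \<in> W" "b \<in> lists X" "m = map \<iota> a @ \<epsilon> w # map \<iota> b"
    by blast
  then show ?thesis
    using that grade_iota by (auto simp: wt_eps)
qed

text \<open>The augmentation onto degree 0, read in the free algebra on \<open>X\<close>: words with
  a letter that is no \<open>\<iota> x\<close> go to 0. Followed by passage to cosets it is the
  morphism of the model constructed later.\<close>

definition proj :: "('g, 'k) falg \<Rightarrow> ('x, 'k) falg" where
  "proj = lin_ext (\<lambda>m. if set m \<subseteq> \<iota> ` X then monomial (grade m) else 0)"

lemma lin_proj: "lin proj"
  unfolding proj_def by (rule lin_lin_ext)

lemma proj_monomial: "proj (monomial m) = (if set m \<subseteq> \<iota> ` X then monomial (grade m) else 0)"
  by (simp add: proj_def)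

lemma proj_mult: "proj (p * q) = proj p * proj q"
  by (rule bilin_eqI[where M = UNIV and N = UNIV and F = "\<lambda>p q. proj (p * q)"
        and H = "\<lambda>p q. proj p * proj q"])
     (rule lin_comp[OF lin_proj] lin_mult_left lin_mult_right lin_proj lin_id
      | simp add: proj_monomial monomial_mult)+

lemma proj_in: "proj p \<in> wspan (lists X)"
proof (rule lin_wspan[OF lin_proj wspan_subspace])
  fix m :: "'g list"
  show "proj (monomial m) \<in> wspan (lists X)"
  proof (cases "set m \<subseteq> \<iota> ` X")
    case True
    then have "m \<in> map \<iota> ` lists X" unfolding lists_image[symmetric] by blast
    with True show ?thesis using grade_iota by (force simp: proj_monomial)
  qed (simp add: proj_monomial)
  show "p \<in> wspan UNIV" by simp
qed

lemma proj_gen_map: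
  assumes "p \<in> wspan (lists X)" shows "proj (gen_map \<iota> p) = p"
proof (rule lin_eqI[OF lin_comp[OF lin_proj lin_gen_map] lin_id _ assms])
  fix m assume m: "m \<in> lists X"
  then have "set (map \<iota> m) \<subseteq> \<iota> ` X" by auto
  with m show "proj (gen_map \<iota> (monomial m)) = monomial m"
    by (simp only: gen_map_monomial proj_monomial grade_iota if_True)
qed

lemma gen_map_proj:
  assumes "z \<in> T 0 UNIV" shows "gen_map \<iota> (proj z) = z"
proof (rule lin_eqI[OF lin_comp[OF lin_gen_map lin_proj] lin_id _ assms])
  fix m assume "m \<in> words G hdeg wt 0 UNIV"
  then have m: "grade m \<in> lists X" "map \<iota> (grade m) = m"
    using degree_0_words[of m] by (auto simp: words_def)
  then have "set m \<subseteq> \<iota> ` X" by (metis image_mono in_lists_conv_set list.set_map subsetI)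
  with m show "gen_map \<iota> (proj (monomial m)) = monomial m"
    by (simp only: gen_map_monomial proj_monomial if_True)
qed

lemma iota_words: "x \<in> lists X \<Longrightarrow> x \<in> S \<Longrightarrow> map \<iota> x \<in> words G hdeg wt 0 S"
  using grade_iota[of x] degree_iota[of x] iota_in[of x] by (simp add: words_def)

lemma gen_map_in_T: "p \<in> wspan (lists X) \<Longrightarrow> gen_map \<iota> p \<in> T 0 (Poly_Mapping.keys p)"
  by (rule gen_map_wspan[of _ "lists X \<inter> Poly_Mapping.keys p"]) (auto simp: wspan_def intro!: iota_words)

lemma grades_gen_map:
  fixes p :: "('x, 'k) falg"
  assumes "p \<in> wspan (lists X)" shows "grades (gen_map \<iota> p) = Poly_Mapping.keys p"
proof
  show "grades (gen_map \<iota> p) \<subseteq> Poly_Mapping.keys p"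
    by (rule grades_subset[OF gen_map_in_T[OF assms]])
  \<comment> \<open>Applying \<open>proj\<close> recovers \<open>p\<close>, so no word of
    \<open>p\<close> can be lost.\<close>
  have "proj (gen_map \<iota> p) \<in> wspan (grades (gen_map \<iota> p))"
    by (rule lin_wspan[OF lin_proj wspan_subspace, of "Poly_Mapping.keys (gen_map \<iota> p)"])
       (auto simp: proj_monomial grades_def wspan_def)
  then show "Poly_Mapping.keys p \<subseteq> grades (gen_map \<iota> p)"
    by (simp add: proj_gen_map[OF assms] wspan_def)
qed

text \<open>The values in degree 1 that the relations force: the generator of \<open>w\<close>,
  placed in a context, bounds the relation in that context.\<close>

definition resolves :: "(('g, 'k) falg \<Rightarrow> ('g, 'k) falg) \<Rightarrow> bool" where
  "resolves D \<longleftrightarrow> (\<forall>a\<in>lists X. \<forall>w\<in>W. \<forall>b\<in>lists X.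
     D (monomial (map \<iota> a @ \<epsilon> w # map \<iota> b)) = gen_map \<iota> (relation a w b))"

lemma eps_word:
  assumes "a \<in> lists X" "w \<in> W" "b \<in> lists X"
  shows "map \<iota> a @ \<epsilon> w # map \<iota> b \<in> words G hdeg wt 1 {a @ w @ b}"
  using assms degree_iota[of a] degree_iota[of b] grade_iota[of a] grade_iota[of b]
    iota_in[of a] iota_in[of b] eps[of w]
  by (simp add: words_def wt_eps)

text \<open>Convergence says that a non-zero element of \<open>J\<close> has a reducible word, and
  putting \<open>\<epsilon> w\<close> in place of \<open>w\<close> in it yields the correction that
  cancels this grade. Any reducible word will do, maximal or not.\<close>

lemma ideal_is_boundary:
  assumes conv: "\<And>g. g \<in> J \<Longrightarrow> irreducible g \<Longrightarrow> g = 0"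
    and "lin D" "resolves D" "p \<in> J"
  shows "\<exists>y\<in>T 1 (down (Poly_Mapping.keys p)). D y = gen_map \<iota> p"
proof -
  have "\<exists>y\<in>T 1 (down (grades (gen_map \<iota> p))). D y = gen_map \<iota> p"
  proof (rule elimination[OF \<open>lin D\<close>, where Q = "\<lambda>z. \<exists>p\<in>J. z = gen_map \<iota> p"])
    fix z assume "\<exists>p\<in>J. z = gen_map \<iota> p" "z \<noteq> 0"
    moreover have "gen_map \<iota> 0 = (0 :: ('g, 'k) falg)"
      by (rule lin_zero[OF lin_gen_map])
    ultimately obtain p where p: "p \<in> J" "z = gen_map \<iota> p" "p \<noteq> 0"
      by metis
    then obtain a w b where awb: "a \<in> lists X" "w \<in> W" "b \<in> lists X"
      and u: "a @ w @ b \<in> Poly_Mapping.keys p"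
      using conv[OF p(1)] unfolding irreducible_def by blast
    let ?c = "Poly_Mapping.lookup p (a @ w @ b)" and ?m = "map \<iota> a @ \<epsilon> w # map \<iota> b"
    let ?q = "p - scale ?c (relation a w b)"
    have q: "?q \<in> J"
      by (intro falg.subspace_diff[OF subspace_J] falg.subspace_scale[OF subspace_J] p(1)
          relation_in_J[OF awb])
    have eq: "z - D (scale ?c (monomial ?m)) = gen_map \<iota> ?q"
      using assms(3) awb p(2)
      by (simp add: resolves_def lin_scale[OF \<open>lin D\<close>] lin_scale[OF lin_gen_map]
          lin_diff[OF lin_gen_map])
    have "scale ?c (monomial ?m) \<in> T 1 {a @ w @ b}"
      by (intro wspan_scale) (simp add: eps_word[OF awb])
    moreover have "grades (gen_map \<iota> ?q) \<subseteq> grades z - {a @ w @ b} \<union> {v. less v (a @ w @ b)}"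
      using keys_reduce[OF awb, of p] p q J_in by (simp add: grades_gen_map subset_iff)
    moreover have "a @ w @ b \<in> grades z"
      using u p J_in by (simp add: grades_gen_map subset_iff)
    ultimately show "\<exists>u\<in>grades z. \<exists>y\<in>T 1 {u}. (\<exists>p\<in>J. z - D y = gen_map \<iota> p) \<and>
        grades (z - D y) \<subseteq> grades z - {u} \<union> {v. less v u}"
      using q eq by metis
  next
    show "\<exists>q\<in>J. gen_map \<iota> p = gen_map \<iota> q" using \<open>p \<in> J\<close> by blast
  qed
  then show ?thesis
    using grades_gen_map[OF subsetD[OF J_in \<open>p \<in> J\<close>]] by simp
qed

lemma boundary_in_ideal:
  assumes "lin D" "resolves D" "y \<in> T 1 UNIV"
  shows "\<exists>p\<in>J. D y = gen_map \<iota> p"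
proof -
  have "D y \<in> gen_map \<iota> ` J"
  proof (rule lin_wspan[OF assms(1) _ _ assms(3)])
    show "falg.subspace (gen_map \<iota> ` J)"
      using subspace_J lin_gen_map by (rule module_hom.subspace_image[rotated])
    fix m assume "m \<in> words G hdeg wt 1 UNIV"
    then obtain a w b where awb: "a \<in> lists X" "w \<in> W" "b \<in> lists X"
      and m: "m = map \<iota> a @ \<epsilon> w # map \<iota> b"
      unfolding words_def by (elim CollectE conjE degree_1_words)
    show "D (monomial m) \<in> gen_map \<iota> ` J"
      using assms(2) awb relation_in_J[OF awb] by (auto simp: resolves_def m)
  qed
  then show ?thesis by blast
qed

lemma irreducible_boundary_zero:
  assumes "lin D" "filtered_at d D 1" "filtered_at d D 2" "exact_at d 1"
    and DD: "\<And>y. y \<in> T 2 UNIV \<Longrightarrow> D (D y) = 0"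
    and h: "h \<in> T 1 UNIV" "D h = gen_map \<iota> g" and g: "g \<in> wspan (lists X)" "irreducible g"
  shows "g = 0"
proof -
  have "\<exists>y\<in>T 2 (down (grades h)). D y = h"
  proof (rule elimination[OF assms(1), where Q = "\<lambda>h. h \<in> T 1 UNIV \<and> D h = gen_map \<iota> g"])
    fix h assume h: "h \<in> T 1 UNIV \<and> D h = gen_map \<iota> g" "h \<noteq> 0"
    then obtain u where u: "u \<in> grades h" "\<And>v. v \<in> grades h \<Longrightarrow> \<not> less u v"
      by (auto elim: exists_maximal_grade)
    then obtain m where "m \<in> Poly_Mapping.keys h" "grade m = u" by (auto simp: grades_def)
    then have "m \<in> lists G" "sum_list (map hdeg m) = 1" "grade m = u"
      using h by (auto simp: wspan_def words_def)
    then obtain a w b where "a \<in> lists X" "w \<in> W" "b \<in> lists X" "u = a @ w @ b"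
      by (metis degree_1_words)
    then have "u \<notin> Poly_Mapping.keys g"
      using g(2) by (simp add: irreducible_def)
    then have "part u (D h) = 0"
      using part_zero[OF gen_map_in_T[OF g(1)]] h by simp
    then have "d (part u h) = 0"
      using part_maximal[OF assms(1,2) conjunct1[OF h(1)] u(2)] by simp
    moreover have "part u h \<in> T 1 {u}"
      using h by (intro part_in_T) simp
    ultimately obtain y where y: "y \<in> T 2 {u}" "d y = part u h"
      using assms(4) unfolding exact_at_def by auto
    have "D (h - D y) = gen_map \<iota> g"
      using DD[OF T_monoD[OF y(1)]] h by (simp add: lin_diff[OF assms(1)])
    then show "\<exists>u\<in>grades h. \<exists>y\<in>T 2 {u}. (h - D y \<in> T 1 UNIV \<and> D (h - D y) = gen_map \<iota> g) \<and>
        grades (h - D y) \<subseteq> grades h - {u} \<union> {v. less v u}"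
      using cancel_part[of d D 1 h y u] assms(3) h y u(1) by auto
  next
    show "h \<in> T 1 UNIV \<and> D h = gen_map \<iota> g" using h by (rule conjI)
  qed
  \<comment> \<open>The elimination has written \<open>h\<close> itself as \<open>D y\<close>, so
    the image of \<open>g\<close> is \<open>D (D y)\<close>.\<close>
  then obtain y where "y \<in> T 2 UNIV" "D y = h"
    by (meson T_monoD subset_UNIV)
  then have "gen_map \<iota> g = 0" using DD h(2) by auto
  then show "g = 0"
    using proj_gen_map[OF g(1)] by (simp add: lin_zero[OF lin_proj])
qed

end

section \<open>Construction of the perturbation\<close>

context rewriting_words
begin

lemma degree_letter: "m \<in> lists G \<Longrightarrow> g \<in> set m \<Longrightarrow> hdeg g \<le> sum_list (map hdeg m)"
proof (induction m rule: list.induct)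
  case (Cons h m)
  then show ?case using hdeg_nonneg[of h] degree_nonneg[of m] by auto
qed simp

lemma T_negative:
  assumes "n < 0" shows "T n S = ({0} :: ('g, 'k) falg set)"
proof -
  have "words G hdeg wt n S = {}"
    using degree_nonneg assms unfolding words_def by force
  then show ?thesis by (simp add: wspan_empty)
qed

text \<open>The state of the construction at stage \<open>N\<close>. Apart from the clause on
  \<open>W\<close>, which is kept at every stage, nothing is asked of generators of degree above
  \<open>N\<close>.\<close>

definition perturbs_to ::
  "('g \<Rightarrow> ('g, 'k) falg) \<Rightarrow> int \<Rightarrow> ('g \<Rightarrow> ('g, 'k) falg) \<Rightarrow> bool" where
  "perturbs_to \<delta>0 N \<delta> \<longleftrightarrow>
     (\<forall>g\<in>G. hdeg g \<le> N \<longrightarrow> \<delta> g \<in> T (hdeg g - 1) UNIV \<and>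
        \<delta> g - \<delta>0 g \<in> T (hdeg g - 1) {v. less v (wt g)} \<and> derivation_ext hdeg \<delta> (\<delta> g) = 0) \<and>
     (\<forall>w\<in>W. \<delta> (\<epsilon> w) = gen_map \<iota> (monomial w - f w))"

text \<open>A word of degree \<open>n\<close> has no letter of higher degree, so later choices leave
  the derivation unchanged in the degrees already treated.\<close>

lemma derivation_T_cong:
  assumes "p \<in> T n UNIV" "\<And>g. g \<in> G \<Longrightarrow> hdeg g \<le> n \<Longrightarrow> \<delta> g = \<delta>' g"
  shows "derivation_ext hdeg \<delta> p = derivation_ext hdeg \<delta>' p"
proof (rule derivation_ext_cong[OF assms(1)])
  fix m g assume "m \<in> words G hdeg wt n UNIV" "g \<in> set m"
  then show "\<delta> g = \<delta>' g"
    using degree_letter[of m g] by (intro assms(2)) (auto simp: words_def)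
qed

lemma perturbs_toD:
  assumes "perturbs_to \<delta>0 N \<delta>" "g \<in> G" "hdeg g \<le> N"
  shows "\<delta> g \<in> T (hdeg g - 1) UNIV" "\<delta> g - \<delta>0 g \<in> T (hdeg g - 1) {v. less v (wt g)}"
    "derivation_ext hdeg \<delta> (\<delta> g) = 0"
  using assms by (auto simp: perturbs_to_def)

lemma perturbs_to_mono: "perturbs_to \<delta>0 N \<delta> \<Longrightarrow> M \<le> N \<Longrightarrow> perturbs_to \<delta>0 M \<delta>"
  by (auto simp: perturbs_to_def)

lemma words_singleton: "m \<in> words G hdeg wt n {u} \<longleftrightarrow> m \<in> lists G \<and> sum_list (map hdeg m) = n \<and> grade m = u"
  by (auto simp: words_def)

lemma perturbs_to_filtered:
  assumes \<delta>0: "\<And>g. g \<in> G \<Longrightarrow> \<delta>0 g \<in> T (hdeg g - 1) {wt g}"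
    and \<delta>: "perturbs_to \<delta>0 N \<delta>" and "n \<le> N"
  shows "filtered_at (derivation_ext hdeg \<delta>0) (derivation_ext hdeg \<delta>) n"
  unfolding filtered_at_def
proof (intro allI ballI conjI)
  fix u and p :: "('g, 'k) falg" assume p: "p \<in> T n {u}"
  show "derivation_ext hdeg \<delta>0 p \<in> T (n - 1) {u}"
  proof (rule lin_wspan[OF lin_derivation_ext wspan_subspace _ p])
    fix m assume "m \<in> words G hdeg wt n {u}"
    then have m: "m \<in> lists G" "sum_list (map hdeg m) = n" "grade m = u"
      by (simp_all add: words_singleton)
    have "\<And>g. g \<in> set m \<Longrightarrow> \<delta>0 g \<in> T (hdeg g - 1) {wt g}"
      using m(1) \<delta>0 by auto
    then show "derivation_ext hdeg \<delta>0 (monomial m) \<in> T (n - 1) {u}"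
      using derivation_word_words[OF wt_in, of "\<lambda>u. {u}" m \<delta>0 hdeg] m
      by (simp add: derivation_ext_monomial)
  qed
  show "derivation_ext hdeg \<delta> p - derivation_ext hdeg \<delta>0 p \<in> T (n - 1) {v. less v u}"
  proof (rule lin_wspan[OF lin_minus[OF lin_derivation_ext lin_derivation_ext] wspan_subspace _ p])
    fix m assume "m \<in> words G hdeg wt n {u}"
    then have m: "m \<in> lists G" "sum_list (map hdeg m) = n" "grade m = u"
      by (simp_all add: words_singleton)
    have "\<delta> g - \<delta>0 g \<in> T (hdeg g - 1) {v. less v (wt g)}" if "g \<in> set m" for g
      using degree_letter[OF m(1) that] that m \<delta> \<open>n \<le> N\<close> by (auto simp: perturbs_to_def)
    then show "derivation_ext hdeg \<delta> (monomial m) - derivation_ext hdeg \<delta>0 (monomial m) \<in> T (n - 1) {v. less v u}"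
      using derivation_word_words[OF wt_in, of "\<lambda>u. {v. less v u}" m "\<lambda>g. \<delta> g - \<delta>0 g" hdeg] m lt_context
      by (simp add: derivation_ext_monomial derivation_word_diff)
  qed
qed

lemma perturbs_to_square_zero:
  assumes \<delta>: "perturbs_to \<delta>0 N \<delta>" and "n \<le> N" and p: "p \<in> T n UNIV"
  shows "derivation_ext hdeg \<delta> (derivation_ext hdeg \<delta> p) = 0"
proof -
  have "derivation_ext hdeg \<delta> (derivation_ext hdeg \<delta> p) \<in> {0}"
  proof (rule lin_wspan[OF lin_comp[OF lin_derivation_ext lin_derivation_ext] falg.subspace_single_0 _ p])
    fix m assume "m \<in> words G hdeg wt n UNIV"
    then have m: "m \<in> lists G" "sum_list (map hdeg m) = n"
      by (simp_all add: words_def)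
    have "derivation_ext hdeg \<delta> (\<delta> g) = 0 \<and> \<delta> g \<in> T (hdeg g - 1) UNIV" if "g \<in> set m" for g
      using degree_letter[OF m(1) that] that m \<delta> \<open>n \<le> N\<close> by (auto simp: perturbs_to_def)
    moreover have "T (hdeg g - 1) UNIV \<subseteq> (wspan {m. sum_list (map hdeg m) = hdeg g - 1} :: ('g, 'k) falg set)" for g
      by (rule wspan_mono) (auto simp: words_def)
    ultimately show "derivation_ext hdeg \<delta> (derivation_ext hdeg \<delta> (monomial m)) \<in> {0}"
      unfolding singleton_iff by (intro derivation_ext_square_zero) blast+
  qed
  then show ?thesis by simp
qed

lemma perturbs_to_resolves:
  assumes \<delta>: "perturbs_to \<delta>0 N \<delta>" and "0 \<le> N"
  shows "resolves (derivation_ext hdeg \<delta>)"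
  unfolding resolves_def
proof (intro ballI)
  fix a w b assume awb: "a \<in> lists X" "w \<in> W" "b \<in> lists X"
  \<comment> \<open>There is nothing in degree -1, so letters from the alphabet are killed; only the
    middle letter contributes, with trivial sign.\<close>
  have z: "\<delta> (\<iota> x) = 0" if "x \<in> X" for x
    using perturbs_toD(1)[OF \<delta>, of "\<iota> x"] iota[OF that] \<open>0 \<le> N\<close> T_negative[of "- 1" UNIV] by simp
  have "derivation_word hdeg \<delta> (map \<iota> x) = 0" if "x \<in> lists X" for x
    using that by (induction x rule: list.induct) (auto simp: z)
  then show "derivation_ext hdeg \<delta> (monomial (map \<iota> a @ \<epsilon> w # map \<iota> b)) = gen_map \<iota> (relation a w b)"
    using \<delta> awb degree_iota[of a]
    by (simp add: derivation_ext_monomial derivation_word_append relation_def gen_map_mult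
        perturbs_to_def mult.assoc del: map_map)
qed

context
  fixes \<delta>0 :: "'g \<Rightarrow> ('g, 'k) falg"
  assumes \<delta>0: "\<And>g. g \<in> G \<Longrightarrow> \<delta>0 g \<in> T (hdeg g - 1) {wt g}"
    and \<delta>0_eps: "\<And>w. w \<in> W \<Longrightarrow> \<delta>0 (\<epsilon> w) = monomial (map \<iota> w)"
    and d_\<delta>0: "\<And>g. g \<in> G \<Longrightarrow> derivation_ext hdeg \<delta>0 (\<delta>0 g) = 0"
    and exact: "\<And>n. 1 \<le> n \<Longrightarrow> exact_at (derivation_ext hdeg \<delta>0) n"
    and conv: "\<And>g. g \<in> J \<Longrightarrow> irreducible g \<Longrightarrow> g = 0"
begin

lemma perturbs_to_step:
  assumes \<delta>: "perturbs_to \<delta>0 N \<delta>" and N: "1 \<le> N" and g: "g \<in> G" "hdeg g = N + 1"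
  shows "\<exists>q. q \<in> T N UNIV \<and> q - \<delta>0 g \<in> T N {v. less v (wt g)} \<and> derivation_ext hdeg \<delta> q = 0"
proof -
  let ?D = "derivation_ext hdeg \<delta>" and ?x = "\<delta>0 g"
  let ?L = "{v. less v (wt g)}"
  have x: "?x \<in> T N {wt g}" using \<delta>0[OF g(1)] g(2) by simp
  then have x': "?x \<in> T N UNIV" by (rule T_monoD) simp
  note filt = perturbs_to_filtered[OF \<delta>0 \<delta>]
  \<comment> \<open>Since \<open>\<delta>0 g\<close> is a cycle for the unperturbed differential,
    all of \<open>?D ?x\<close> comes from the perturbation and lies strictly below
    \<open>wt g\<close>.\<close>
  have Dx: "?D ?x \<in> T (N - 1) ?L"
    using filtered_atD(2)[OF filt[of N] x] d_\<delta>0[OF g(1)] by simp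
  then have Dx': "?D ?x \<in> T (N - 1) UNIV" by (rule T_monoD) simp
  have "down (grades (?D ?x)) \<subseteq> ?L"
    using grades_subset[OF Dx] by (auto simp: down_def intro: lt_trans)
  \<comment> \<open>A primitive exists trivially, namely \<open>?x\<close>; the point is one in
    grades strictly below \<open>wt g\<close>, so that subtracting it from \<open>?x\<close> keeps
    the leading term.\<close>
  moreover have "\<exists>y\<in>T N (down (grades (?D ?x))). ?D y = ?D ?x"
  proof (cases "N = 1")
    \<comment> \<open>Here \<open>?D ?x\<close> has degree 0, where a cycle need not bound; as a
      boundary from degree 1 it lies in the ideal, and convergence supplies a primitive with
      controlled grades.\<close>
    case True
    have res: "resolves ?D" using perturbs_to_resolves[OF \<delta>] N by simp
    then obtain p where p: "p \<in> J" "?D ?x = gen_map \<iota> p"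
      using boundary_in_ideal[OF lin_derivation_ext res] x' True by auto
    then show ?thesis
      using ideal_is_boundary[OF conv lin_derivation_ext res p(1)] True
        grades_gen_map[OF subsetD[OF J_in p(1)]] by simp
  next
    case False
    have "?D (?D ?x) = 0"
      by (rule perturbs_to_square_zero[OF \<delta> order_refl x'])
    moreover have "\<exists>y\<in>T (N - 1 + 1) (down (grades (?D ?x))). ?D y = ?D ?x"
      by (rule exact_at_perturbed[OF lin_derivation_ext filt filt exact])
         (use N False Dx' calculation perturbs_to_square_zero[OF \<delta>, of N] in auto)
    ultimately show ?thesis by simp
  qed
  ultimately obtain y where y: "y \<in> T N ?L" "?D y = ?D ?x"
    using T_mono by blast
  have "?x - y \<in> T N UNIV"
    by (rule wspan_diff[OF x' T_monoD[OF y(1)]]) simp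
  moreover have "?x - y - ?x \<in> T N ?L"
    using wspan_neg[OF y(1)] by simp
  moreover have "?D (?x - y) = 0"
    by (simp add: lin_diff[OF lin_derivation_ext] y(2))
  ultimately show ?thesis by blast
qed

lemma perturbs_to_one: "\<exists>\<delta>. perturbs_to \<delta>0 1 \<delta>"
proof -
  \<comment> \<open>The grade of \<open>\<epsilon> w\<close> is \<open>w\<close>, so
    \<open>wt g\<close> recovers the word and no inverse of \<open>\<epsilon>\<close> has to be
    chosen.\<close>
  define \<delta> where "\<delta> g = (if hdeg g = 1 then gen_map \<iota> (monomial (wt g) - f (wt g)) else 0)" for g
  have "\<delta> g \<in> T (hdeg g - 1) UNIV \<and> \<delta> g - \<delta>0 g \<in> T (hdeg g - 1) {v. less v (wt g)} \<and>
      derivation_ext hdeg \<delta> (\<delta> g) = 0" if g: "g \<in> G" "hdeg g \<le> 1" for g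
  proof (cases "hdeg g = 1")
    case True
    then obtain w where w: "w \<in> W" "g = \<epsilon> w" using G1 g by auto
    have fw: "f w \<in> wspan (lists X)" "monomial w - f w \<in> wspan (lists X)"
      using f_in[OF w(1)] subsetD[OF W_lists w(1)] by (simp_all add: wspan_diff)
    have "gen_map \<iota> (monomial w - f w) \<in> T 0 UNIV"
      by (rule T_monoD[OF gen_map_in_T[OF fw(2)]]) simp
    moreover have "Poly_Mapping.keys (f w) \<subseteq> {v. less v w}"
      using less_rs.base[OF w(1)] by auto
    then have "gen_map \<iota> (f w) \<in> T 0 {v. less v w}"
      by (rule T_monoD[OF gen_map_in_T[OF fw(1)]])
    \<comment> \<open>Words of degree 0 involve only letters on which \<open>\<delta>\<close> is 0,
      so \<open>\<delta>\<close> may be replaced there by the zero assignment.\<close>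
    moreover have "derivation_ext hdeg \<delta> (gen_map \<iota> (monomial w - f w)) = derivation_ext hdeg (\<lambda>_. 0) (gen_map \<iota> (monomial w - f w))"
      by (rule derivation_T_cong[OF calculation(1)]) (simp add: \<delta>_def)
    moreover have "derivation_word hdeg (\<lambda>_. 0 :: ('g, 'k) falg) m = 0" for m
      by (induction m) auto
    then have "derivation_ext hdeg (\<lambda>_. 0) p = 0" for p :: "('g, 'k) falg"
      by (simp add: derivation_ext_eq lin_ext_def)
    ultimately show ?thesis
      using w \<delta>0_eps[OF w(1)] eps[OF w(1)]
      by (simp add: \<delta>_def wt_eps wspan_neg lin_diff[OF lin_gen_map])
  next
    case False
    then have "hdeg g = 0" using hdeg_nonneg[of g] g by auto
    then show ?thesis
      using \<delta>0[OF g(1)] T_negative[of "- 1" "{wt g}"] by (simp add: \<delta>_def lin_zero[OF lin_derivation_ext])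
  qed
  then have "perturbs_to \<delta>0 1 \<delta>"
    using eps wt_eps by (simp add: perturbs_to_def \<delta>_def)
  then show ?thesis by blast
qed

lemma perturbs_to_extend:
  assumes \<delta>: "perturbs_to \<delta>0 N \<delta>" and N: "1 \<le> N"
  shows "\<exists>\<delta>'. perturbs_to \<delta>0 (N + 1) \<delta>' \<and> (\<forall>g. hdeg g \<le> N \<longrightarrow> \<delta>' g = \<delta> g)"
proof -
  let ?P = "\<lambda>g q. q \<in> T N UNIV \<and> q - \<delta>0 g \<in> T N {v. less v (wt g)} \<and> derivation_ext hdeg \<delta> q = 0"
  define \<delta>' where "\<delta>' g = (if g \<in> G \<and> hdeg g = N + 1 then SOME q. ?P g q else \<delta> g)" for g
  have new: "?P g (\<delta>' g)" if "g \<in> G" "hdeg g = N + 1" for g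
    using someI_ex[OF perturbs_to_step[OF \<delta> N that]] that by (simp add: \<delta>'_def)
  have old: "\<delta>' g = \<delta> g" if "hdeg g \<le> N" for g
    using that by (simp add: \<delta>'_def)
  \<comment> \<open>The new values have degree \<open>N\<close>, so testing whether they are cycles
    involves old generators only.\<close>
  have cong: "derivation_ext hdeg \<delta>' p = derivation_ext hdeg \<delta> p" if "p \<in> T n UNIV" "n \<le> N" for p n
    by (rule derivation_T_cong[OF that(1)]) (use old that(2) in auto)
  have "perturbs_to \<delta>0 (N + 1) \<delta>'"
    unfolding perturbs_to_def
  proof (intro conjI ballI impI)
    fix g assume g: "g \<in> G" "hdeg g \<le> N + 1"
    have "\<delta>' g \<in> T (hdeg g - 1) UNIV \<and> \<delta>' g - \<delta>0 g \<in> T (hdeg g - 1) {v. less v (wt g)} \<and>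
        derivation_ext hdeg \<delta> (\<delta>' g) = 0"
    proof (cases "hdeg g = N + 1")
      case True
      then show ?thesis using new[OF g(1)] by simp
    next
      case False
      then show ?thesis using \<delta> g old[of g] by (simp add: perturbs_to_def)
    qed
    then show "\<delta>' g \<in> T (hdeg g - 1) UNIV" "\<delta>' g - \<delta>0 g \<in> T (hdeg g - 1) {v. less v (wt g)}"
      "derivation_ext hdeg \<delta>' (\<delta>' g) = 0"
      using cong[of "\<delta>' g" "hdeg g - 1"] g by auto
  next
    fix w assume "w \<in> W"
    then show "\<delta>' (\<epsilon> w) = gen_map \<iota> (monomial w - f w)"
      using \<delta> old[of "\<epsilon> w"] eps N by (simp add: perturbs_to_def)
  qed
  with old show ?thesis by blast
qed

text \<open>Every generator keeps its value from some stage on, and each condition on it involves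
  only generators of no higher degree, so the conditions pass to the limit. Stages are indexed by
  \<open>int n + 1\<close> since the construction starts in degree 1.\<close>

lemma exists_perturbation: "\<exists>\<delta>. \<forall>N. perturbs_to \<delta>0 N \<delta>"
proof -
  have "\<exists>\<delta>s. \<forall>n. perturbs_to \<delta>0 (int n + 1) (\<delta>s n) \<and>
      (\<forall>g. hdeg g \<le> int n + 1 \<longrightarrow> \<delta>s (Suc n) g = \<delta>s n g)"
    using perturbs_to_one perturbs_to_extend[of "int n + 1" for n]
    by (intro dependent_nat_choice) (auto simp: algebra_simps)
  then obtain \<delta>s where \<delta>s: "\<And>n. perturbs_to \<delta>0 (int n + 1) (\<delta>s n)"
    and step: "\<And>n g. hdeg g \<le> int n + 1 \<Longrightarrow> \<delta>s (Suc n) g = \<delta>s n g"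
    by blast
  \<comment> \<open>Stage \<open>nat (hdeg g)\<close> already covers the degree of \<open>g\<close>,
    and later stages do not change its value.\<close>
  define \<delta> where "\<delta> g = \<delta>s (nat (hdeg g)) g" for g
  have eq: "\<delta>s n g = \<delta> g" if "hdeg g \<le> int n" for g n
  proof -
    have "nat (hdeg g) \<le> n" using that by simp
    then show ?thesis
    proof (induction rule: dec_induct)
      case (step k)
      then show ?case using \<open>\<And>n g. hdeg g \<le> int n + 1 \<Longrightarrow> \<delta>s (Suc n) g = \<delta>s n g\<close>[of g k] by simp
    qed (simp add: \<delta>_def)
  qed
  have "perturbs_to \<delta>0 (int n) \<delta>" for n
    unfolding perturbs_to_def
  proof (intro conjI ballI impI)
    fix g assume g: "g \<in> G" "hdeg g \<le> int n"
    then have *: "\<delta> g \<in> T (hdeg g - 1) UNIV \<and> \<delta> g - \<delta>0 g \<in> T (hdeg g - 1) {v. less v (wt g)} \<and>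
        derivation_ext hdeg (\<delta>s n) (\<delta> g) = 0"
      using perturbs_toD[OF \<delta>s g(1), of n] eq[of g n] by simp
    then show "\<delta> g \<in> T (hdeg g - 1) UNIV" "\<delta> g - \<delta>0 g \<in> T (hdeg g - 1) {v. less v (wt g)}" by auto
    have "derivation_ext hdeg (\<delta>s n) (\<delta> g) = derivation_ext hdeg \<delta> (\<delta> g)"
      by (rule derivation_T_cong[of _ "hdeg g - 1"]) (use * eq g in auto)
    with * show "derivation_ext hdeg \<delta> (\<delta> g) = 0" by simp
  next
    fix w assume "w \<in> W"
    then show "\<delta> (\<epsilon> w) = gen_map \<iota> (monomial w - f w)"
      using \<delta>s[of 1] eq[of "\<epsilon> w" 1] eps by (simp add: perturbs_to_def)
  qed
  then have "perturbs_to \<delta>0 N \<delta>" for N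
    by (rule perturbs_to_mono[of _ "int (nat N)"]) simp
  then show ?thesis by blast
qed

end

end

section \<open>Quasi-free dg algebras\<close>

lemma hcomp_tensor_dga:
  "hcomp (tensor_dga G hdeg d) n = wspan {m \<in> lists G. sum_list (map hdeg m) = n}"
  by (auto simp: tensor_dga_def free_algebra_def wspan_def)

lemma tensor_grade_eq: "tensor_grade G wt u = wspan {m \<in> lists G. concat (map wt m) = u}"
  by (auto simp: tensor_grade_def free_algebra_def wspan_def)

lemma bd_tensor_dga: "bd (tensor_dga G hdeg d) = d"
  by (simp add: tensor_dga_def)

lemmas tensor_dga_simps = word_algebra_simps[OF word_algebra_tensor_dga] bd_tensor_dga hcomp_tensor_dga

lemma linear_between_tensor_dga:
  "linear_between (tensor_dga G hdeg d) (tensor_dga H hdeg' d') D \<longleftrightarrow>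
     D ` wspan (lists G) \<subseteq> wspan (lists H) \<and>
     (\<forall>p\<in>wspan (lists G). \<forall>q\<in>wspan (lists G). D (p + q) = D p + D q) \<and>
     (\<forall>c. \<forall>p\<in>wspan (lists G). D (scale c p) = scale c (D p))"
  by (simp add: linear_between_def tensor_dga_simps)

lemma direct_sum_hcomp:
  "direct_sum (tensor_dga G hdeg d) UNIV (\<lambda>n. wspan {m \<in> M. sum_list (map hdeg m) = n}) (wspan M)"
  if "M \<subseteq> lists G"
  by (rule direct_sum_wspan[OF word_algebra_tensor_dga]) (use that in auto)

lemma dg_algebra_tensor_dga:
  fixes D :: "('g, 'k::field) falg \<Rightarrow> ('g, 'k) falg"
  assumes D: "lin D"
    and degree: "\<And>n p. p \<in> wspan {m \<in> lists G. sum_list (map hdeg m) = n} \<Longrightarrow>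
      D p \<in> wspan {m \<in> lists G. sum_list (map hdeg m) = n - 1}"
    and square: "\<And>p. p \<in> wspan (lists G) \<Longrightarrow> D (D p) = 0"
    and leibniz: "\<And>n p q. p \<in> wspan {m \<in> lists G. sum_list (map hdeg m) = n} \<Longrightarrow>
      D (p * q) = D p * q + scale ((- 1) powi n) (p * D q)"
  shows "dg_algebra (tensor_dga G hdeg D)"
proof (rule dg_algebra.intro)
  let ?A = "tensor_dga G hdeg D"
  show "module (scalar_ring :: 'k ring) ?A" "ring ?A"
    by (rule module_word_algebra[OF word_algebra_tensor_dga] ring_word_algebra[OF word_algebra_tensor_dga])+
  have carrier: "D p \<in> wspan (lists G)" if "p \<in> wspan (lists G)" for p
    by (rule lin_wspan[OF D wspan_subspace _ that]) (rule wspan_monoD[OF degree], auto)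
  show "dg_algebra_axioms ?A"
  proof
    show "direct_sum ?A UNIV (hcomp ?A) (carrier ?A)"
      using direct_sum_hcomp[of "lists G" G hdeg D] by (simp add: tensor_dga_simps hcomp_tensor_dga[abs_def])
    show "linear_between ?A ?A (bd ?A)"
      using D carrier by (auto simp: linear_between_tensor_dga bd_tensor_dga lin_add lin_scale)
    fix x y m n assume "x \<in> hcomp ?A m" "y \<in> hcomp ?A n"
    then show "x \<otimes>\<^bsub>?A\<^esub> y \<in> hcomp ?A (m + n)"
      unfolding tensor_dga_simps by (rule wspan_mult) auto
  qed (use D degree square leibniz in \<open>auto simp: tensor_dga_simps scale_mult_left scale_mult_right
        monomial_Nil[symmetric]\<close>)
qed

context
  fixes G :: "'g set" and hdeg :: "'g \<Rightarrow> int" and d :: "('g, 'k::field) falg \<Rightarrow> ('g, 'k) falg"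
  assumes dg: "dg_algebra (tensor_dga G hdeg d)"
begin

lemma dg_tensor_linear:
  assumes "p \<in> wspan (lists G)"
  shows "d p \<in> wspan (lists G)" "q \<in> wspan (lists G) \<Longrightarrow> d (p + q) = d p + d q"
    "d (scale c p) = scale c (d p)"
  using dg_algebra.bd_linear[OF dg] assms by (auto simp: linear_between_tensor_dga bd_tensor_dga)

lemma dg_tensor_degree:
  "p \<in> wspan {m \<in> lists G. sum_list (map hdeg m) = n} \<Longrightarrow>
   d p \<in> wspan {m \<in> lists G. sum_list (map hdeg m) = n - 1}"
  using dg_algebra.bd_hcomp[OF dg, of p n] by (simp add: tensor_dga_simps)

lemma dg_tensor_monomial:
  assumes "m \<in> lists G"
  shows "d (monomial m) = derivation_word hdeg (\<lambda>g. d (monomial [g])) m"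
  using assms
proof (induction m rule: list.induct)
  case Nil
  \<comment> \<open>The Leibniz rule gives \<open>d 1 = d 1 + d 1\<close>, hence
    \<open>d 1 = 0\<close>.\<close>
  have "d (1 * 1) = d 1 * 1 + scale ((- 1) powi 0) (1 * d 1)"
    using dg_algebra.leibniz[OF dg, of 1 0 1]
    by (simp add: tensor_dga_simps monomial_Nil[symmetric])
  then show ?case by (simp add: monomial_Nil)
next
  case (Cons g m)
  have "d (monomial [g] * monomial m) =
      d (monomial [g]) * monomial m + scale ((- 1) powi hdeg g) (monomial [g] * d (monomial m))"
    using dg_algebra.leibniz[OF dg, of "monomial [g]" "hdeg g" "monomial m"] Cons.prems
    by (simp add: tensor_dga_simps)
  then show ?case using Cons by (simp add: monomial_mult)
qed

text \<open>The differential is known to be linear on the carrier only, so lemmas about linear maps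
  of the whole type do not apply to it and the sum over words is treated by induction. The
  right-hand side is its total linear replacement.\<close>

lemma dg_tensor_derivation:
  assumes "p \<in> wspan (lists G)"
  shows "d p = derivation_ext hdeg (\<lambda>g. d (monomial [g])) p"
proof -
  have "finite F \<Longrightarrow> F \<subseteq> lists G \<Longrightarrow> d (\<Sum>m\<in>F. scale (c m) (monomial m)) =
      derivation_ext hdeg (\<lambda>g. d (monomial [g])) (\<Sum>m\<in>F. scale (c m) (monomial m))" for F c
  proof (induction F rule: finite_induct)
    case empty
    show ?case using dg_tensor_linear(3)[of 0 0] by (simp add: lin_zero[OF lin_derivation_ext])
  next
    case (insert m F)
    have "(\<Sum>m\<in>F. scale (c m) (monomial m)) \<in> wspan (lists G)"
      using insert.prems by (intro wspan_sum wspan_scale) auto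
    then show ?case
      using insert by (simp add: dg_tensor_linear wspan_scale lin_add[OF lin_derivation_ext]
          lin_scale[OF lin_derivation_ext] derivation_ext_monomial dg_tensor_monomial del: in_lists_conv_set)
  qed
  from this[OF finite_keys, of p "Poly_Mapping.lookup p"] assms show ?thesis
    unfolding falg_expand[of p, symmetric] by (simp add: wspan_def)
qed

lemma dg_tensor_square: "p \<in> wspan (lists G) \<Longrightarrow> d (d p) = 0"
  using dg_algebra.bd_bd[OF dg, of p] by (simp add: tensor_dga_simps)

end

lemma triangulated_of_nonneg:
  assumes nonneg: "\<And>g. g \<in> G \<Longrightarrow> 0 \<le> hdeg g"
    and D: "\<And>n p. p \<in> wspan {m \<in> lists G. sum_list (map hdeg m) = n} \<Longrightarrow>
      D p \<in> wspan {m \<in> lists G. sum_list (map hdeg m) = n - 1}"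
  shows "triangulated G hdeg (D :: ('g, 'k::field) falg \<Rightarrow> ('g, 'k) falg)"
proof -
  let ?A = "tensor_dga G hdeg D"
  \<comment> \<open>Layer \<open>j\<close> holds the generators of degree \<open>j - 1\<close>:
    layers are counted from 1, degrees from 0.\<close>
  define N where "N j = (\<lambda>g. [g]) ` {g \<in> G. hdeg g = int j - 1}" for j
  define V where "V j = (wspan (N j) :: ('g, 'k) falg set)" for j
  have NG: "N j \<subseteq> lists G" for j by (auto simp: N_def)
  have "(\<lambda>g. [g]) ` G = (\<Union>j\<in>{1..}. N j)"
  proof
    show "(\<lambda>g. [g]) ` G \<subseteq> (\<Union>j\<in>{1..}. N j)"
    proof
      fix m assume "m \<in> (\<lambda>g. [g]) ` G"
      then obtain g where g: "g \<in> G" "m = [g]" by blast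
      then have "m \<in> N (Suc (nat (hdeg g)))" using nonneg[of g] by (auto simp: N_def)
      then show "m \<in> (\<Union>j\<in>{1..}. N j)" by force
    qed
  qed (auto simp: N_def)
  moreover have "gen_space G = (wspan ((\<lambda>g. [g]) ` G) :: ('g, 'k) falg set)"
    by (simp add: gen_space_def wspan_def)
  moreover have "direct_sum ?A {1..} (\<lambda>j. wspan (N j)) (wspan ((\<lambda>g. [g]) ` G))"
    by (rule direct_sum_wspan[OF word_algebra_tensor_dga]) (auto simp: calculation(1), auto simp: N_def)
  ultimately have "direct_sum ?A {1..} V (gen_space G)"
    by (simp add: V_def[abs_def])
  moreover have "graded_subspace ?A (V j)" for j
  proof -
    have "V j \<inter> hcomp ?A n = wspan {m \<in> N j. sum_list (map hdeg m) = n}" for n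
      unfolding V_def hcomp_tensor_dga wspan_Int[symmetric]
      by (rule arg_cong[where f = wspan]) (use NG in auto)
    then show ?thesis
      using direct_sum_hcomp[OF NG, where d = D] by (simp add: graded_subspace_def V_def)
  qed
  moreover have "D v \<in> unital_subalgebra ?A hull (\<Union>k\<in>{1..j}. V k)" if v: "v \<in> V (Suc j)" for j v
    unfolding hull_def
  proof (rule InterI, clarify)
    fix H assume H: "unital_subalgebra ?A H" "(\<Union>k\<in>{1..j}. V k) \<subseteq> H"
    then have "subring H ?A" and sub: "falg.subspace H"
      by (auto simp: unital_subalgebra_def lin_subspace_iff[OF word_algebra_tensor_dga])
    then have one: "1 \<in> H" and mult: "\<And>p q. p \<in> H \<Longrightarrow> q \<in> H \<Longrightarrow> p * q \<in> H"
      using subringE(3,6)[of H ?A] by (simp_all add: tensor_dga_simps)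
    have gen: "monomial [g] \<in> H" if g: "g \<in> G" "hdeg g < int j" for g
    proof -
      have "[g] \<in> N (Suc (nat (hdeg g)))" "Suc (nat (hdeg g)) \<in> {1..j}"
        using g nonneg[of g] by (auto simp: N_def)
      then show ?thesis using H(2) by (force simp: V_def)
    qed
    have mon: "monomial m \<in> H" if "m \<in> lists {g \<in> G. hdeg g < int j}" for m
      using that
    proof (induction m rule: list.induct)
      case (Cons g m)
      then have "monomial [g] * monomial m \<in> H" using gen mult by auto
      then show ?case by (simp add: monomial_mult)
    qed (simp add: one monomial_Nil)
    have le: "0 \<le> sum_list (map hdeg m) \<and> (\<forall>g\<in>set m. hdeg g \<le> sum_list (map hdeg m))" if "m \<in> lists G" for m
      using that
    proof (induction m rule: list.induct)
      case (Cons g m)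
      then show ?case using nonneg[of g] by fastforce
    qed simp
    \<comment> \<open>An element of layer \<open>j + 1\<close> has degree \<open>j\<close>; its
      boundary has degree \<open>j - 1\<close> and involves only generators of degree below
      \<open>j\<close>, that is, of layers up to \<open>j\<close>.\<close>
    have "v \<in> wspan {m \<in> lists G. sum_list (map hdeg m) = int j}"
      using v unfolding V_def by (rule wspan_monoD) (auto simp: N_def)
    then have "D v \<in> wspan {m \<in> lists G. sum_list (map hdeg m) = int j - 1}" by (rule D)
    moreover have "m \<in> lists {g \<in> G. hdeg g < int j}"
      if "m \<in> {m \<in> lists G. sum_list (map hdeg m) = int j - 1}" for m
      using that le[of m] by fastforce
    ultimately show "D v \<in> H"
      using wspan_in_subspace[OF sub mon] by (meson wspan_monoD subsetI)
  qed
  ultimately show ?thesis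
    unfolding triangulated_def by blast
qed

section \<open>Homology of models of a presented algebra\<close>

context
  fixes X :: "'x set" and S :: "('x, 'k::field) falg set"
  assumes S: "S \<subseteq> wspan (lists X)"
begin

lemma ideal_rel_ideal: "ideal (rel_ideal X S) (free_algebra X)"
  unfolding rel_ideal_def
  by (rule ring.genideal_ideal[OF ring_word_algebra[OF word_algebra_free_algebra]])
     (simp add: carrier_free_algebra S)

lemma presented_dga_l_zero:
  assumes "c \<in> carrier (presented_dga X S)"
  shows "\<zero>\<^bsub>presented_dga X S\<^esub> \<oplus>\<^bsub>presented_dga X S\<^esub> c = c"
proof -
  interpret Q: ring "free_algebra X Quot rel_ideal X S"
    by (rule ideal.quotient_is_ring[OF ideal_rel_ideal])
  show ?thesis
    using Q.l_zero[of c] assms by (simp add: presented_dga_def quotient_dga_def)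
qed

lemma presented_dga_zero_closed: "\<zero>\<^bsub>presented_dga X S\<^esub> \<in> carrier (presented_dga X S)"
proof -
  interpret Q: ring "free_algebra X Quot rel_ideal X S"
    by (rule ideal.quotient_is_ring[OF ideal_rel_ideal])
  show ?thesis
    using Q.zero_closed by (simp add: presented_dga_def quotient_dga_def)
qed

lemma hcomp_presented_dga: "hcomp (presented_dga X S) n =
    (if n = 0 then carrier (presented_dga X S) else {\<zero>\<^bsub>presented_dga X S\<^esub>})"
  by (simp add: presented_dga_def quotient_dga_def)

lemma bd_presented_dga: "bd (presented_dga X S) c = \<zero>\<^bsub>presented_dga X S\<^esub>"
  by (simp add: presented_dga_def quotient_dga_def)

lemma hcomp_presented_subset: "hcomp (presented_dga X S) n \<subseteq> carrier (presented_dga X S)"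
  using presented_dga_zero_closed by (simp add: hcomp_presented_dga)

lemma boundaries_presented_dga: "boundaries (presented_dga X S) n = {\<zero>\<^bsub>presented_dga X S\<^esub>}"
proof -
  have "hcomp (presented_dga X S) (n + 1) \<noteq> {}"
    using presented_dga_zero_closed by (auto simp: hcomp_presented_dga)
  then show ?thesis
    by (auto simp: boundaries_def bd_presented_dga)
qed

lemma homology_presented_dga:
  "homology (presented_dga X S) n = (\<lambda>c. {c}) ` hcomp (presented_dga X S) n"
proof -
  have "boundaries (presented_dga X S) n +>\<^bsub>presented_dga X S\<^esub> c = {c}"
    if "c \<in> hcomp (presented_dga X S) n" for c
    using presented_dga_l_zero[OF subsetD[OF hcomp_presented_subset that]]
    by (simp add: boundaries_presented_dga a_r_coset_def')
  moreover have "cycles (presented_dga X S) n = hcomp (presented_dga X S) n"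
    by (simp add: cycles_def bd_presented_dga)
  ultimately show ?thesis
    by (simp add: homology_def)
qed

text \<open>Outside degree 0 the target has a single homology class, hence so has the source by
  counting, and the class of a cycle is that of 0.\<close>

lemma quasi_iso_presented_exact:
  assumes dg: "dg_algebra (tensor_dga G hdeg d)"
    and qi: "quasi_iso (tensor_dga G hdeg d) (presented_dga X S) \<phi>"
    and "n \<noteq> 0" and z: "z \<in> hcomp (tensor_dga G hdeg d) n" "d z = 0"
  shows "\<exists>y\<in>hcomp (tensor_dga G hdeg d) (n + 1). d y = z"
proof -
  let ?A = "tensor_dga G hdeg d"
  have "card (homology (presented_dga X S) n) = 1"
    using \<open>n \<noteq> 0\<close> by (simp add: homology_presented_dga hcomp_presented_dga)
  moreover have "card (homology ?A n) = card (homology (presented_dga X S) n)"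
    using qi unfolding quasi_iso_def by (blast intro: bij_betw_same_card)
  ultimately obtain C where C: "homology ?A n = {C}"
    by (metis card_1_singletonE)
  have d0: "d 0 = 0"
    using dg_tensor_linear(3)[OF dg, of 0 0] by simp
  have "z \<in> cycles ?A n" "0 \<in> cycles ?A n"
    using z d0 by (auto simp: cycles_def tensor_dga_simps)
  then have "boundaries ?A n +>\<^bsub>?A\<^esub> z \<in> homology ?A n" "boundaries ?A n +>\<^bsub>?A\<^esub> 0 \<in> homology ?A n"
    unfolding homology_def by blast+
  then have "boundaries ?A n +>\<^bsub>?A\<^esub> z = boundaries ?A n +>\<^bsub>?A\<^esub> 0"
    unfolding C by simp
  moreover have "0 \<in> boundaries ?A n"
    unfolding boundaries_def by (rule image_eqI[of _ _ 0]) (simp_all add: tensor_dga_simps d0)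
  then have "0 + z \<in> boundaries ?A n +>\<^bsub>?A\<^esub> z"
    unfolding a_r_coset_def' tensor_dga_simps by blast
  ultimately have "z \<in> boundaries ?A n"
    by (simp add: a_r_coset_def' tensor_dga_simps)
  then show ?thesis
    unfolding boundaries_def bd_tensor_dga by blast
qed

end

section \<open>Comparison with the Shafarevich complex in low degrees\<close>

lemma derivation_ext_natural:
  fixes \<delta> :: "'l \<Rightarrow> ('l, 'k::field) falg" and \<delta>' :: "'g \<Rightarrow> ('g, 'k) falg"
  assumes h: "\<And>l. l \<in> L \<Longrightarrow> hdeg' (h l) = hdeg l \<and> \<delta>' (h l) = gen_map h (\<delta> l)"
    and p: "p \<in> wspan (lists L)"
  shows "gen_map h (derivation_ext hdeg \<delta> p) = derivation_ext hdeg' \<delta>' (gen_map h p)"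
proof (rule lin_eqI[OF lin_comp[OF lin_gen_map lin_derivation_ext]
      lin_comp[OF lin_derivation_ext lin_gen_map] _ p])
  fix m assume "m \<in> lists L"
  then have "gen_map h (derivation_word hdeg \<delta> m) = derivation_word hdeg' \<delta>' (map h m)"
    by (induction m rule: list.induct)
       (simp_all add: lin_zero[OF lin_gen_map] lin_add[OF lin_gen_map] lin_scale[OF lin_gen_map] gen_map_mult h)
  then show "gen_map h (derivation_ext hdeg \<delta> (monomial m)) = derivation_ext hdeg' \<delta>' (gen_map h (monomial m))"
    by (simp add: derivation_ext_monomial)
qed

lemma keys_gen_map: "Poly_Mapping.keys (gen_map h p) \<subseteq> map h ` Poly_Mapping.keys p"
  using gen_map_wspan[of p "Poly_Mapping.keys p" h "map h ` Poly_Mapping.keys p"]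
  by (simp add: wspan_def)

lemma hcomp_sha: "hcomp (sha X S) n =
    wspan {m \<in> lists (Inl ` X \<union> Inr ` S). sum_list (map (case_sum (\<lambda>_. 0) (\<lambda>_. 1)) m) = n}"
  by (simp add: sha_def hcomp_tensor_dga)

lemma bd_sha: "bd (sha X S) = derivation_ext (case_sum (\<lambda>_. 0) (\<lambda>_. 1)) (case_sum (\<lambda>_. 0) (\<lambda>s. gen_map Inl s))"
  by (simp add: sha_def bd_tensor_dga)

context
  fixes X :: "'x set" and S :: "('x, 'k::field) falg set" and G :: "'g set"
    and hdeg :: "'g \<Rightarrow> int" and \<iota> e d \<phi>
  assumes ae: "acyclic_extension X S G hdeg \<iota> e d \<phi>"
begin

lemma acyclic_extension_model:
  shows "dg_algebra (tensor_dga G hdeg d)" "quasi_iso (tensor_dga G hdeg d) (presented_dga X S) \<phi>"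
  using ae by (auto simp: acyclic_extension_def is_model_def)

lemma acyclic_extension_nonneg:
  assumes "g \<in> G" shows "0 \<le> hdeg g"
proof (rule ccontr)
  assume "\<not> 0 \<le> hdeg g"
  then have "hcomp (tensor_dga G hdeg d) (hdeg g) = {0}"
    using ae by (simp add: acyclic_extension_def tensor_dga_simps)
  moreover have "monomial [g] \<in> hcomp (tensor_dga G hdeg d) (hdeg g)"
    using assms by (simp add: hcomp_tensor_dga)
  ultimately show False by simp
qed

lemma acyclic_extension_gen_map:
  assumes "n \<in> {0, 1}"
  shows "gen_map (case_sum \<iota> e) ` hcomp (sha X S) n = hcomp (tensor_dga G hdeg d) n"
  using ae assms by (auto simp: acyclic_extension_def bij_betw_def)

text \<open>The comparison with the Shafarevich complex is given on elements. Generators are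
  recovered from it because a preimage of the one-letter word \<open>[g]\<close> must contain a
  one-letter word mapped to it.\<close>

lemma acyclic_extension_generators:
  shows "{g \<in> G. hdeg g = 0} = \<iota> ` X" "{g \<in> G. hdeg g = 1} = e ` S"
proof -
  let ?h = "case_sum \<iota> e" and ?deg = "case_sum (\<lambda>_. 0) (\<lambda>_. 1) :: 'x + ('x, 'k) falg \<Rightarrow> int"
  have sub: "\<exists>l\<in>Inl ` X \<union> Inr ` S. ?deg l = hdeg g \<and> ?h l = g"
    if g: "g \<in> G" "hdeg g \<in> {0, 1}" for g
  proof -
    have "monomial [g] \<in> hcomp (tensor_dga G hdeg d) (hdeg g)"
      using g by (simp add: hcomp_tensor_dga)
    then obtain p where p: "p \<in> hcomp (sha X S) (hdeg g)" "gen_map ?h p = monomial [g]"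
      using acyclic_extension_gen_map[OF g(2)] by (metis imageE)
    then have "[g] \<in> map ?h ` Poly_Mapping.keys p"
      using keys_gen_map[of ?h p] by simp
    then obtain m where m: "m \<in> Poly_Mapping.keys p" "map ?h m = [g]" by auto
    then obtain l where l: "m = [l]" "?h l = g" by auto
    with m p(1) have "[l] \<in> {m \<in> lists (Inl ` X \<union> Inr ` S). sum_list (map ?deg m) = hdeg g}"
      unfolding hcomp_sha wspan_def by blast
    with l(2) show ?thesis by (intro bexI[of _ l]) auto
  qed
  have sup: "?h l \<in> G \<and> hdeg (?h l) = ?deg l" if l: "l \<in> Inl ` X \<union> Inr ` S" for l
  proof -
    have "monomial [l] \<in> hcomp (sha X S) (?deg l)" "?deg l \<in> {0, 1}"
      using l by (auto simp: hcomp_sha)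
    then have "gen_map ?h (monomial [l]) \<in> hcomp (tensor_dga G hdeg d) (?deg l)"
      using acyclic_extension_gen_map by blast
    then show ?thesis by (simp add: hcomp_tensor_dga)
  qed
  show "{g \<in> G. hdeg g = 0} = \<iota> ` X" "{g \<in> G. hdeg g = 1} = e ` S"
  proof safe
    fix g assume "g \<in> G" "hdeg g = 0"
    with sub[of g] obtain l where "l \<in> Inl ` X \<union> Inr ` S" "?deg l = 0" "?h l = g" by auto
    then show "g \<in> \<iota> ` X" by auto
  next
    fix g assume "g \<in> G" "hdeg g = 1"
    with sub[of g] obtain l where "l \<in> Inl ` X \<union> Inr ` S" "?deg l = 1" "?h l = g" by auto
    then show "g \<in> e ` S" by auto
  next
    fix x assume "x \<in> X"
    then show "\<iota> x \<in> G" "hdeg (\<iota> x) = 0" using sup[of "Inl x"] by auto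
  next
    fix s assume "s \<in> S"
    then show "e s \<in> G" "hdeg (e s) = 1" using sup[of "Inr s"] by auto
  qed
qed

lemma acyclic_extension_bd:
  assumes "s \<in> S" shows "d (monomial [e s]) = gen_map \<iota> s"
proof -
  let ?p = "monomial [Inr s] :: ('x + ('x, 'k) falg, 'k) falg"
  have "?p \<in> hcomp (sha X S) 1"
    using assms by (simp add: hcomp_sha)
  then have "gen_map (case_sum \<iota> e) (bd (sha X S) ?p) = d (gen_map (case_sum \<iota> e) ?p)"
    using ae by (simp add: acyclic_extension_def bd_tensor_dga)
  then have "d (monomial [e s]) = gen_map (case_sum \<iota> e) (gen_map Inl s)"
    by (simp add: bd_sha derivation_ext_monomial monomial_Nil)
  moreover have "case_sum \<iota> e \<circ> Inl = \<iota>" by auto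
  ultimately show ?thesis by (simp add: gen_map_comp)
qed

end

text \<open>As degrees are non-negative, letters of a word of degree \<open>n\<close> have degree at
  most \<open>n\<close>, so it is enough that \<open>h\<close> reaches the generators up to that
  degree.\<close>

lemma bij_betw_map_degree:
  assumes hL: "\<And>l. l \<in> L \<Longrightarrow> h l \<in> G \<and> hdeg (h l) = (hdeg' l :: int)" and inj: "inj_on h L"
    and nonneg: "\<And>g. g \<in> G \<Longrightarrow> 0 \<le> hdeg g"
    and surj: "\<And>g. g \<in> G \<Longrightarrow> hdeg g \<le> n \<Longrightarrow> g \<in> h ` L"
  shows "bij_betw (map h) {m \<in> lists L. sum_list (map hdeg' m) = n} {m \<in> lists G. sum_list (map hdeg m) = n}"
proof (rule bij_betw_imageI)
  have "inj_on (map h) (lists L)"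
    by (rule inj_on_mapI, rule inj_on_subset[OF inj]) auto
  then show "inj_on (map h) {m \<in> lists L. sum_list (map hdeg' m) = n}"
    by (rule inj_on_subset) auto
  have le: "0 \<le> sum_list (map hdeg m) \<and> (\<forall>g\<in>set m. hdeg g \<le> sum_list (map hdeg m))" if "m \<in> lists G" for m
    using that
  proof (induction m rule: list.induct)
    case (Cons g m)
    then show ?case using nonneg[of g] by fastforce
  qed simp
  have deg: "map h m \<in> lists G \<and> sum_list (map hdeg (map h m)) = sum_list (map hdeg' m)" if "m \<in> lists L" for m
    using that by (induction m rule: list.induct) (simp_all add: hL)
  show "map h ` {m \<in> lists L. sum_list (map hdeg' m) = n} = {m \<in> lists G. sum_list (map hdeg m) = n}"
  proof (intro subset_antisym subsetI)
    fix u assume "u \<in> map h ` {m \<in> lists L. sum_list (map hdeg' m) = n}"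
    then obtain m where "m \<in> lists L" "sum_list (map hdeg' m) = n" "u = map h m" by blast
    with deg[of m] show "u \<in> {m \<in> lists G. sum_list (map hdeg m) = n}" by blast
  next
    fix u assume "u \<in> {m \<in> lists G. sum_list (map hdeg m) = n}"
    then have u: "u \<in> lists G" "sum_list (map hdeg u) = n" by auto
    have "g \<in> h ` L" if "g \<in> set u" for g
      using that u(1) le[OF u(1)] u(2) by (intro surj) auto
    then have "u \<in> map h ` lists L" unfolding lists_image[symmetric] by blast
    then obtain m where m: "m \<in> lists L" "u = map h m" by blast
    then have "sum_list (map hdeg' m) = n" using deg u(2) by metis
    with m show "u \<in> map h ` {m \<in> lists L. sum_list (map hdeg' m) = n}" by blast
  qed
qed

lemma acyclic_extensionI:
  fixes \<delta> :: "'g \<Rightarrow> ('g, 'k::field) falg"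
  assumes model: "is_model G hdeg (derivation_ext hdeg \<delta>) (presented_dga X S) \<phi>"
    and nonneg: "\<And>g. g \<in> G \<Longrightarrow> 0 \<le> hdeg g"
    and G0: "{g \<in> G. hdeg g = 0} = \<iota> ` X" "inj_on \<iota> X" and G1: "{g \<in> G. hdeg g = 1} = e ` S" "inj_on e S"
    and \<delta>: "\<And>x. x \<in> X \<Longrightarrow> \<delta> (\<iota> x) = 0" "\<And>s. s \<in> S \<Longrightarrow> \<delta> (e s) = gen_map \<iota> s"
  shows "acyclic_extension X S G hdeg \<iota> e (derivation_ext hdeg \<delta>) \<phi>"
proof -
  let ?D = "derivation_ext hdeg \<delta>"
  let ?h = "case_sum \<iota> e" and ?deg = "case_sum (\<lambda>_. 0) (\<lambda>_. 1) :: 'x + ('x, 'k) falg \<Rightarrow> int"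
  let ?L = "Inl ` X \<union> Inr ` S"
  have hL: "?h l \<in> G \<and> hdeg (?h l) = ?deg l" if "l \<in> ?L" for l
    using that G0(1) G1(1) by auto
  have inj: "inj_on ?h ?L"
  proof (rule inj_onI)
    fix l l' assume l: "l \<in> ?L" "l' \<in> ?L" "?h l = ?h l'"
    \<comment> \<open>Degrees separate the two kinds of generators, so injectivity on each kind
      suffices.\<close>
    then have "?deg l = ?deg l'" using hL by metis
    with l G0(2) G1(2) show "l = l'" by (auto dest: inj_onD)
  qed
  have bij: "bij_betw (map ?h) {m \<in> lists ?L. sum_list (map ?deg m) = n} {m \<in> lists G. sum_list (map hdeg m) = n}"
    if n: "n \<in> {0, 1}" for n
  proof (rule bij_betw_map_degree[OF hL inj nonneg])
    fix g assume g: "g \<in> G" "hdeg g \<le> n"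
    then have "hdeg g = 0 \<or> hdeg g = 1" using nonneg[OF g(1)] n by auto
    with g(1) have "g \<in> \<iota> ` X \<or> g \<in> e ` S" using G0(1) G1(1) by blast
    then show "g \<in> ?h ` ?L" by (simp add: image_Un image_image)
  qed
  have bd: "gen_map ?h (bd (sha X S) p) = ?D (gen_map ?h p)" if "p \<in> hcomp (sha X S) n" for p n
    unfolding bd_sha
  proof (rule derivation_ext_natural[where L = ?L])
    show "p \<in> wspan (lists ?L)"
      using that unfolding hcomp_sha by (rule wspan_monoD) auto
    have "?h \<circ> Inl = \<iota>" by auto
    then show "hdeg (?h l) = ?deg l \<and> \<delta> (?h l) = gen_map ?h (case_sum (\<lambda>_. 0) (\<lambda>s. gen_map Inl s) l)"
      if "l \<in> ?L" for l
      using that hL[OF that] \<delta> by (auto simp: gen_map_comp lin_zero[OF lin_gen_map])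
  qed
  have neg: "hcomp (tensor_dga G hdeg ?D) n = {0}" if "n < 0" for n
  proof -
    have "0 \<le> sum_list (map hdeg m)" if "m \<in> lists G" for m
      using that by (induction m rule: list.induct) (simp_all add: nonneg)
    then have none: "{m \<in> lists G. sum_list (map hdeg m) = n} = {}" using that by force
    show ?thesis unfolding hcomp_tensor_dga none by (rule wspan_empty)
  qed
  have "bij_betw (gen_map ?h) (hcomp (sha X S) n) (hcomp (tensor_dga G hdeg ?D) n)" if "n \<in> {0, 1}" for n
    unfolding hcomp_sha hcomp_tensor_dga by (rule wspan_bij_betw[OF bij[OF that]])
  then show ?thesis
    unfolding acyclic_extension_def using model neg bd by (simp add: bd_tensor_dga tensor_dga_simps(4))
qed

section \<open>The presented algebra and its cosets\<close>

context rewriting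
begin

abbreviation B :: "('k, ('x, 'k) falg set) dga" where "B \<equiv> presented_dga X (relations W f)"

abbreviation coset :: "('x, 'k) falg \<Rightarrow> ('x, 'k) falg set" where
  "coset p \<equiv> J +>\<^bsub>free_algebra X\<^esub> p"

text \<open>If two words gave the same relation, each would occur in the replacement of the other, a
  cycle in \<open>less\<close>. This allows a generator to be indexed by a relation in place of its
  word.\<close>

lemma inj_relation: "inj_on (\<lambda>w. monomial w - f w) W"
proof (rule inj_onI, rule ccontr)
  fix w w' assume w: "w \<in> W" "w' \<in> W" "monomial w - f w = monomial w' - f w'" "w \<noteq> w'"
  have key: "u \<in> Poly_Mapping.keys (f v)" if "u \<in> W" "v \<in> W" "u \<noteq> v"
    "monomial u - f u = monomial v - f v" for u v
  proof -
    have "u \<notin> Poly_Mapping.keys (f u)"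
      using less_rs.base[OF \<open>u \<in> W\<close>, of u f X] less_irrefl by blast
    then have "Poly_Mapping.lookup (monomial u - f u) u = 1"
      by (simp add: lookup_minus lookup_monomial in_keys_iff)
    then have "Poly_Mapping.lookup (monomial v - f v) u = 1"
      using that(4) by simp
    then show ?thesis
      using that(3) by (auto simp: lookup_minus lookup_monomial in_keys_iff)
  qed
  have "less w w'" "less w' w"
    using key[of w w'] key[of w' w] w less_rs.base by metis+
  then show False
    using less_rs.trans less_irrefl by metis
qed

lemma relations_subset: "relations W f \<subseteq> wspan (lists X)"
  using relations_in by (simp add: carrier_free_algebra)

lemma coset_in_B: "p \<in> wspan (lists X) \<Longrightarrow> coset p \<in> carrier B"
  by (auto simp: presented_dga_def quotient_dga_def FactRing_def A_RCOSETS_def' free_simps)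

lemma carrier_B: "carrier B = coset ` wspan (lists X)"
  by (auto simp: presented_dga_def quotient_dga_def FactRing_def A_RCOSETS_def' free_simps)

lemma zero_B: "zero B = J"
  by (simp add: presented_dga_def quotient_dga_def FactRing_def)

lemma coset_0: "coset 0 = J"
  using J_in by (auto simp: a_r_coset_def' free_simps)

lemma coset_eq_J: "p \<in> wspan (lists X) \<Longrightarrow> coset p = J \<longleftrightarrow> p \<in> J"
  using coset_eq_iff[of p 0] by (simp add: coset_0)

lemma coset_hom: "coset \<in> ring_hom (free_algebra X) B"
  using ideal.rcos_ring_hom[OF ideal_J]
  by (simp add: ring_hom_def presented_dga_def quotient_dga_def)

lemma coset_add:
  "p \<in> wspan (lists X) \<Longrightarrow> q \<in> wspan (lists X) \<Longrightarrow> coset (p + q) = coset p \<oplus>\<^bsub>B\<^esub> coset q"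
  using ring_hom_add[OF coset_hom, of p q] by (simp add: free_simps)

lemma coset_mult:
  "p \<in> wspan (lists X) \<Longrightarrow> q \<in> wspan (lists X) \<Longrightarrow> coset (p * q) = coset p \<otimes>\<^bsub>B\<^esub> coset q"
  using ring_hom_mult[OF coset_hom, of p q] by (simp add: free_simps)

lemma coset_one: "coset 1 = one B"
  using ring_hom_one[OF coset_hom] by (simp add: free_simps)

text \<open>Scalar multiplication on the quotient is a union over a coset, all of whose members
  contribute the same coset because \<open>J\<close> is closed under scalars.\<close>

lemma coset_scale:
  assumes "p \<in> wspan (lists X)" shows "coset (scale c p) = c \<odot>\<^bsub>B\<^esub> coset p"
proof -
  have "coset (scale c q) = coset (scale c p)" if q: "q \<in> coset p" for q
  proof -
    obtain j where j: "j \<in> J" "q = j + p"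
      using q by (auto simp: a_r_coset_def' free_simps)
    then have "q \<in> wspan (lists X)" "q - p \<in> J"
      using J_in assms by (auto intro: wspan_add)
    then have "scale c q - scale c p \<in> J"
      using falg.subspace_scale[OF subspace_J, of "q - p" c] by (simp add: falg.scale_right_diff_distrib)
    then show ?thesis
      using \<open>q \<in> wspan (lists X)\<close> assms by (simp add: coset_eq_iff wspan_scale)
  qed
  moreover have "0 + p \<in> coset p"
    using falg.subspace_0[OF subspace_J] unfolding a_r_coset_def' free_simps by blast
  ultimately have "(\<Union>q\<in>coset p. coset (scale c q)) = coset (scale c p)"
    by blast
  then show ?thesis
    by (simp add: presented_dga_def quotient_dga_def free_simps)
qed

end

section \<open>From exactness to a model of the presented algebra\<close>

context rewriting_words
begin

lemma T_UNIV: "T n UNIV = wspan {m \<in> lists G. sum_list (map hdeg m) = n}"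
  by (simp add: words_def)

lemma hcomp_T: "hcomp (tensor_dga G hdeg D) n = T n UNIV"
  by (simp add: hcomp_tensor_dga T_UNIV)

lemma T_subset: "T n S \<subseteq> wspan (lists G)"
  by (rule wspan_mono) (auto simp: words_def)

lemma proj_T:
  assumes "p \<in> T n S" "n \<noteq> 0" shows "proj p = 0"
proof -
  have "proj p \<in> {0}"
  proof (rule lin_wspan[OF lin_proj falg.subspace_single_0 _ assms(1)])
    fix m assume m: "m \<in> words G hdeg wt n S"
    have "\<not> set m \<subseteq> \<iota> ` X"
    proof
      assume "set m \<subseteq> \<iota> ` X"
      then have "m \<in> map \<iota> ` lists X" unfolding lists_image[symmetric] by blast
      then have "sum_list (map hdeg m) = 0" using degree_iota by blast
      with m assms(2) show False by (simp add: words_def)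
    qed
    then show "proj (monomial m) \<in> {0}" by (simp add: proj_monomial)
  qed
  then show ?thesis by simp
qed

text \<open>The two exactness assumptions say that homology sits in degree 0 and is the quotient by
  \<open>J\<close>; the augmentation followed by passage to cosets realises this
  identification.\<close>

lemma model_of_exact:
  assumes dg: "dg_algebra (tensor_dga G hdeg D)" and D: "lin D" and res: "resolves D"
    and exact: "\<And>n z. 1 \<le> n \<Longrightarrow> z \<in> T n UNIV \<Longrightarrow> D z = 0 \<Longrightarrow> \<exists>y\<in>T (n + 1) UNIV. D y = z"
    and exact0: "\<And>p. p \<in> J \<Longrightarrow> \<exists>y\<in>T 1 UNIV. D y = gen_map \<iota> p"
  shows "is_model G hdeg D B (\<lambda>p. coset (proj p))"
proof -
  let ?A = "tensor_dga G hdeg D" and ?\<phi> = "\<lambda>p. coset (proj p)"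
  have degree: "D p \<in> T (n - 1) UNIV" if "p \<in> T n UNIV" for n p
    using dg_tensor_degree[OF dg, of p n] that by (simp add: T_UNIV)
  have boundary: "proj (D y) \<in> J" if "y \<in> T n UNIV" for n y
  proof (cases "n = 1")
    case True
    then obtain p where "p \<in> J" "D y = gen_map \<iota> p"
      using boundary_in_ideal[OF D res] \<open>y \<in> T n UNIV\<close> by blast
    then show ?thesis using proj_gen_map[OF subsetD[OF J_in]] by simp
  next
    case False
    then show ?thesis
      using proj_T[OF degree[OF that]] falg.subspace_0[OF subspace_J] by simp
  qed
  have chain: "proj (D p) \<in> J" if "p \<in> wspan (lists G)" for p
  proof (rule lin_wspan[OF lin_comp[OF lin_proj D] subspace_J _ that])
    fix m assume "m \<in> lists G"
    then show "proj (D (monomial m)) \<in> J"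
      by (intro boundary[of _ "sum_list (map hdeg m)"]) (simp add: T_UNIV)
  qed
  \<comment> \<open>Injectivity on homology for all degrees at once: outside degree 0 the condition
    on \<open>proj z\<close> holds automatically.\<close>
  have kernel: "\<exists>y\<in>T (n + 1) UNIV. D y = z" if z: "z \<in> T n UNIV" "D z = 0" "proj z \<in> J" for n z
  proof -
    consider "n < 0" | "n = 0" | "1 \<le> n" by linarith
    then show ?thesis
    proof cases
      case 1
      then show ?thesis using z(1) T_negative[of n UNIV] lin_zero[OF D] by (intro bexI[of _ 0]) auto
    next
      case 2
      then show ?thesis using exact0[OF z(3)] gen_map_proj[of z] z(1) by simp
    next
      case 3
      then show ?thesis using exact z by blast
    qed
  qed
  have surj: "?\<phi> ` wspan (lists G) = carrier B"
  proof
    show "?\<phi> ` wspan (lists G) \<subseteq> carrier B"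
      using proj_in coset_in_B by blast
    show "carrier B \<subseteq> ?\<phi> ` wspan (lists G)"
    proof
      fix c assume "c \<in> carrier B"
      then obtain p where p: "p \<in> wspan (lists X)" "c = coset p"
        unfolding carrier_B by blast
      then have "c = ?\<phi> (gen_map \<iota> p)" "gen_map \<iota> p \<in> wspan (lists G)"
        using proj_gen_map subsetD[OF T_subset gen_map_in_T] by auto
      then show "c \<in> ?\<phi> ` wspan (lists G)" by blast
    qed
  qed
  have hom: "dga_hom ?A B ?\<phi>"
    unfolding dga_hom_def
  proof (intro conjI allI ballI)
    show "?\<phi> \<in> ring_hom ?A B"
    proof (rule ring_hom_memI)
      show "?\<phi> \<one>\<^bsub>?A\<^esub> = one B"
        by (simp add: tensor_dga_simps proj_monomial coset_one flip: monomial_Nil)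
           (simp add: monomial_Nil coset_one)
    qed (use proj_in coset_in_B in \<open>simp_all add: tensor_dga_simps proj_mult lin_add[OF lin_proj]
          coset_add coset_mult\<close>)
    show "linear_between ?A B ?\<phi>"
      using proj_in coset_in_B
      by (auto simp: linear_between_def tensor_dga_simps lin_add[OF lin_proj] lin_scale[OF lin_proj]
          coset_add coset_scale)
    show "?\<phi> ` hcomp ?A n \<subseteq> hcomp B n" for n
      using proj_in coset_in_B proj_T[of _ n UNIV]
      by (auto simp: hcomp_T hcomp_presented_dga[OF relations_subset] zero_B coset_0)
    show "?\<phi> (bd ?A p) = bd B (?\<phi> p)" if "p \<in> carrier ?A" for p
      using that chain[of p]
      by (simp add: tensor_dga_simps bd_presented_dga[OF relations_subset] zero_B coset_eq_J[OF proj_in])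
  qed
  have "bij_betw (\<lambda>C. boundaries B n <+>\<^bsub>B\<^esub> ?\<phi> ` C) (homology ?A n) (homology B n)" for n
  proof -
    let ?b = "boundaries ?A n"
    have b: "?b = D ` T (n + 1) UNIV"
      by (simp add: boundaries_def bd_tensor_dga hcomp_T)
    have cyc: "cycles ?A n = {z \<in> T n UNIV. D z = 0}"
      by (simp add: cycles_def tensor_dga_simps T_UNIV)
    have cos: "?b +>\<^bsub>?A\<^esub> z = (\<lambda>y. y + z) ` ?b" for z
      by (auto simp: a_r_coset_def' tensor_dga_simps)
    \<comment> \<open>The only boundary of \<open>B\<close> is 0, and adding a boundary of
      \<open>?A\<close> does not change the image under \<open>?\<phi>\<close>, so the class of
      \<open>z\<close> goes to the singleton of the image of \<open>z\<close>; such singletons are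
      the classes of \<open>B\<close>.\<close>
    have val: "boundaries B n <+>\<^bsub>B\<^esub> ?\<phi> ` (?b +>\<^bsub>?A\<^esub> z) = {?\<phi> z}" for z
    proof -
      have "?\<phi> (D y + z) = ?\<phi> z" if "y \<in> T (n + 1) UNIV" for y
        using boundary[OF that] coset_eq_iff[OF proj_in proj_in, of "D y + z" z]
        by (simp add: lin_add[OF lin_proj])
      moreover have "T (n + 1) UNIV \<noteq> ({} :: ('g, 'k) falg set)"
        using wspan_0 by blast
      ultimately have "?\<phi> ` (?b +>\<^bsub>?A\<^esub> z) = {?\<phi> z}"
        unfolding cos unfolding b image_image by auto
      then show ?thesis
        using presented_dga_l_zero[OF relations_subset coset_in_B[OF proj_in]]
        by (simp add: boundaries_presented_dga[OF relations_subset] set_add_def set_mult_def)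
    qed
    show ?thesis
    proof (rule bij_betw_imageI)
      show "inj_on (\<lambda>C. boundaries B n <+>\<^bsub>B\<^esub> ?\<phi> ` C) (homology ?A n)"
      proof (rule inj_onI)
        fix C C' assume "C \<in> homology ?A n" "C' \<in> homology ?A n"
        then obtain z z' where z: "z \<in> cycles ?A n" "C = ?b +>\<^bsub>?A\<^esub> z"
          and z': "z' \<in> cycles ?A n" "C' = ?b +>\<^bsub>?A\<^esub> z'"
          unfolding homology_def by blast
        assume "boundaries B n <+>\<^bsub>B\<^esub> ?\<phi> ` C = boundaries B n <+>\<^bsub>B\<^esub> ?\<phi> ` C'"
        then have "proj (z - z') \<in> J"
          by (simp add: z(2) z'(2) val coset_eq_iff[OF proj_in proj_in] lin_diff[OF lin_proj])
        moreover have "z - z' \<in> T n UNIV" "D (z - z') = 0"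
          using z(1) z'(1) by (auto simp: cyc lin_diff[OF D] intro: wspan_diff)
        ultimately obtain y where y: "y \<in> T (n + 1) UNIV" "D y = z - z'"
          using kernel by blast
        have "(\<lambda>y. y + z) ` ?b = (\<lambda>y. y + z') ` ?b"
        proof (intro subset_antisym subsetI)
          fix q assume "q \<in> (\<lambda>y. y + z) ` ?b"
          then obtain t where "t \<in> T (n + 1) UNIV" "q = D t + z" unfolding b by blast
          then have "q = D (t + y) + z'" "t + y \<in> T (n + 1) UNIV"
            using y by (auto simp: lin_add[OF D] intro: wspan_add)
          then show "q \<in> (\<lambda>y. y + z') ` ?b" unfolding b by blast
        next
          fix q assume "q \<in> (\<lambda>y. y + z') ` ?b"
          then obtain t where "t \<in> T (n + 1) UNIV" "q = D t + z'" unfolding b by blast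
          then have "q = D (t - y) + z" "t - y \<in> T (n + 1) UNIV"
            using y by (auto simp: lin_diff[OF D] intro: wspan_diff)
          then show "q \<in> (\<lambda>y. y + z) ` ?b" unfolding b by blast
        qed
        then show "C = C'" by (simp add: z(2) z'(2) cos)
      qed
      have "?\<phi> ` cycles ?A n = hcomp B n"
      proof (cases "n = 0")
        case True
        \<comment> \<open>There is no degree -1, so every element of degree 0 is a cycle.\<close>
        have "D z = 0" if "z \<in> T 0 UNIV" for z
          using degree[OF that] T_negative[of "- 1" UNIV] by simp
        then have cyc0: "cycles ?A n = T 0 UNIV" unfolding cyc unfolding True by blast
        show ?thesis
        proof
          show "?\<phi> ` cycles ?A n \<subseteq> hcomp B n"
            using coset_in_B[OF proj_in] by (auto simp: True hcomp_presented_dga[OF relations_subset])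
          show "hcomp B n \<subseteq> ?\<phi> ` cycles ?A n"
          proof
            fix c assume "c \<in> hcomp B n"
            then obtain p where p: "p \<in> wspan (lists X)" "c = coset p"
              by (auto simp: True hcomp_presented_dga[OF relations_subset] carrier_B)
            then have "c = ?\<phi> (gen_map \<iota> p)" "gen_map \<iota> p \<in> T 0 UNIV"
              using proj_gen_map T_monoD[OF gen_map_in_T, of p UNIV] by auto
            then show "c \<in> ?\<phi> ` cycles ?A n" unfolding cyc0 by blast
          qed
        qed
      next
        case False
        have "?\<phi> z = J" if "z \<in> cycles ?A n" for z
          using that proj_T[of z n UNIV] False by (simp add: cyc coset_0)
        moreover have "0 \<in> cycles ?A n" by (simp add: cyc lin_zero[OF D])
        ultimately show ?thesis
          using False by (auto simp: hcomp_presented_dga[OF relations_subset] zero_B)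
      qed
      then show "(\<lambda>C. boundaries B n <+>\<^bsub>B\<^esub> ?\<phi> ` C) ` homology ?A n = homology B n"
        unfolding homology_presented_dga[OF relations_subset]
        by (simp add: homology_def image_image val flip: \<open>?\<phi> ` cycles ?A n = hcomp B n\<close>)
    qed
  qed
  moreover have "triangulated G hdeg D"
    by (rule triangulated_of_nonneg[OF hdeg_nonneg dg_tensor_degree[OF dg]])
  ultimately show ?thesis
    using dg hom surj by (simp add: is_model_def quasi_iso_def tensor_dga_simps)
qed

end

section \<open>Interaction of linear maps with the word grading\<close>

context graded_words
begin

lemma part_commute:
  assumes "lin d" "\<And>u p. p \<in> T n {u} \<Longrightarrow> d p \<in> T (n - 1) {u}" "p \<in> T n UNIV"
  shows "d (part u p) = part u (d p)"
proof (rule lin_eqI[OF lin_comp[OF assms(1) lin_part] lin_comp[OF lin_part assms(1)] _ assms(3)])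
  fix m assume "m \<in> words G hdeg wt n UNIV"
  then have m: "d (monomial m) \<in> T (n - 1) {grade m}"
    by (intro assms(2)) (simp add: words_def)
  show "d (part u (monomial m)) = part u (d (monomial m))"
  proof (cases "grade m = u")
    case True
    then show ?thesis using part_id[of "d (monomial m)"] m by (simp add: part_def restr_monomial)
  next
    case False
    then show ?thesis
      using part_zero[OF m, of u] by (simp add: part_def restr_monomial lin_zero[OF assms(1)])
  qed
qed

text \<open>The hull of the smaller grades is itself spanned by words, which brings filteredness
  into the form used by the lemmas on derivations.\<close>

lemma filtered_endo_iff:
  assumes lt_lists: "\<forall>u v. lt v u \<longrightarrow> v \<in> lists X"
  shows "filtered_endo X lt (tensor_dga G hdeg d) (tensor_grade G wt) D \<longleftrightarrow>
    linear_between (tensor_dga G hdeg d) (tensor_dga G hdeg d) D \<and>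
    (\<forall>u\<in>lists X. \<forall>p\<in>wspan {m \<in> lists G. grade m = u}. D p \<in> wspan {m \<in> lists G. lt (grade m) u})"
proof -
  let ?A = "tensor_dga G hdeg d"
  have "lin_subspace ?A hull (\<Union>v\<in>{v \<in> lists X. lt v u}. tensor_grade G wt v) =
      wspan {m \<in> lists G. lt (grade m) u}" for u
  proof (rule hull_unique)
    show "(\<Union>v\<in>{v \<in> lists X. lt v u}. tensor_grade G wt v) \<subseteq> wspan {m \<in> lists G. lt (grade m) u}"
      by (auto simp: tensor_grade_eq wspan_def)
    show "lin_subspace ?A (wspan {m \<in> lists G. lt (grade m) u})"
      by (rule lin_subspace_wspan[OF word_algebra_tensor_dga]) auto
    fix H assume H: "(\<Union>v\<in>{v \<in> lists X. lt v u}. tensor_grade G wt v) \<subseteq> H" "lin_subspace ?A H"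
    have sub: "falg.subspace H"
      using H(2) by (simp add: lin_subspace_iff[OF word_algebra_tensor_dga])
    have "monomial m \<in> H" if "m \<in> {m \<in> lists G. lt (grade m) u}" for m
    proof -
      have m: "m \<in> lists G" "lt (grade m) u" using that by blast+
      then have "monomial m \<in> tensor_grade G wt (grade m)" by (simp add: tensor_grade_eq)
      moreover have "grade m \<in> {v \<in> lists X. lt v u}" using lt_lists m(2) by blast
      ultimately show ?thesis using H(1) by blast
    qed
    then show "wspan {m \<in> lists G. lt (grade m) u} \<subseteq> H"
      using wspan_in_subspace[OF sub] by blast
  qed
  then show ?thesis
    by (simp add: filtered_endo_def tensor_grade_eq)
qed

end

section \<open>Convergence and filtered perturbations of the differential\<close>

theorem theorem4p1:
  fixes X :: "'x set" and W :: "'x list set"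
    and f :: "'x list \<Rightarrow> ('x, 'k::field) falg"
    and G :: "'g set" and hdeg :: "'g \<Rightarrow> int" and wt :: "'g \<Rightarrow> 'x list"
    and \<iota> :: "'x \<Rightarrow> 'g" and e :: "('x, 'k) falg \<Rightarrow> 'g"
    and d :: "('g, 'k) falg \<Rightarrow> ('g, 'k) falg"
    and \<phi> :: "('g, 'k) falg \<Rightarrow> ('x, 'k) falg set"
  assumes "finite X"
    and "rewriting_system X W f"
    and "terminating X W f" and "wfp (less_rs X W f)"
    and "word_homogeneous_extension X W G hdeg wt \<iota> e d \<phi>"
    and "finite_type G hdeg"
  shows "convergent_rs X W f \<longleftrightarrow>
    (\<exists>d' e' \<phi>'. (\<forall>w\<in>W. e' (monomial w - f w) = e (monomial w)) \<and>
       acyclic_extension X (relations W f) G hdeg \<iota> e' (\<lambda>p. d p + d' p) \<phi>' \<and>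
       filtered_endo X (less_rs X W f) (tensor_dga G hdeg d) (tensor_grade G wt) d')"
proof -
  \<comment> \<open>Indexed by words, the same generator stands for \<open>w\<close> before and for
    \<open>w - f w\<close> after the perturbation.\<close>
  define \<epsilon> where "\<epsilon> w = e (monomial w)" for w
  have ae: "acyclic_extension X (monomial ` W) G hdeg \<iota> e d \<phi>"
    and wt: "wt ` G \<subseteq> lists X" "\<And>x. x \<in> X \<Longrightarrow> wt (\<iota> x) = [x]" "\<And>w. w \<in> W \<Longrightarrow> wt (\<epsilon> w) = w"
    and wh: "word_homogeneous X (tensor_dga G hdeg d) (tensor_grade G wt)"
    using assms(5) by (auto simp: word_homogeneous_extension_def \<epsilon>_def)
  note gens = acyclic_extension_generators[OF ae]
  interpret rewriting X W f
    by (rule rewriting.intro[OF assms(2,4)])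
  interpret rewriting_words X W f G hdeg wt \<iota> \<epsilon>
  proof unfold_locales
    show "wt ` G \<subseteq> lists X" by (rule wt(1))
    show "0 \<le> hdeg g" if "g \<in> G" for g by (rule acyclic_extension_nonneg[OF ae that])
    show "wfp less" by (rule wfp_less)
    show "less u w" if "less u v" "less v w" for u v w using that by (rule less_rs.trans)
    show "less (a @ u @ b) (a @ v @ b)" if "less u v" "a \<in> lists X" "b \<in> lists X" for u v a b
      using that by (rule less_rs.in_context)
    show "{g \<in> G. hdeg g = 0} = \<iota> ` X" by (rule gens(1))
    show "{g \<in> G. hdeg g = 1} = \<epsilon> ` W" using gens(2) by (simp add: image_image \<epsilon>_def)
    show "wt (\<iota> x) = [x]" if "x \<in> X" for x by (rule wt(2)[OF that])
    show "wt (\<epsilon> w) = w" if "w \<in> W" for w by (rule wt(3)[OF that])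
  qed
  \<comment> \<open>\<open>?d\<close> agrees with \<open>d\<close> on the carrier but is linear on
    the whole type, as the lemmas on elimination require.\<close>
  define \<delta>0 where "\<delta>0 g = d (monomial [g])" for g
  let ?d = "derivation_ext hdeg \<delta>0"
  note dg = acyclic_extension_model(1)[OF ae]
  have d_eq: "d p = ?d p" if "p \<in> wspan (lists G)" for p
    using dg_tensor_derivation[OF dg that] by (simp add: \<delta>0_def[abs_def])
  have d_T: "d p \<in> T (n - 1) {u}" if p: "p \<in> T n {u}" for p n u
  proof (cases "u \<in> lists X")
    case True
    have "p \<in> tensor_grade G wt u" "p \<in> T n UNIV"
      using p unfolding tensor_grade_eq by (auto simp: words_def elim: wspan_monoD)
    then have "d p \<in> tensor_grade G wt u" "d p \<in> T (n - 1) UNIV"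
      using wh True dg_tensor_degree[OF dg, of p n]
      by (auto simp: word_homogeneous_def bd_tensor_dga T_UNIV)
    then have "d p \<in> wspan ({m \<in> lists G. grade m = u} \<inter> words G hdeg wt (n - 1) UNIV)"
      unfolding wspan_Int tensor_grade_eq by blast
    then show ?thesis by (rule wspan_monoD) (auto simp: words_def)
  next
    \<comment> \<open>No word over the generators has such a grade, so only \<open>p = 0\<close> is
      left.\<close>
    case False
    then have "words G hdeg wt n {u} = {}"
      using concat_map_in_lists[OF wt(1)] by (auto simp: words_def)
    then show ?thesis
      using p d_eq[of 0] by (simp add: wspan_empty lin_zero[OF lin_derivation_ext])
  qed
  have d_T': "?d p \<in> T (n - 1) {u}" if "p \<in> T n {u}" for p n u
    using d_T[OF that] d_eq[OF subsetD[OF T_subset that]] by simp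
  have \<delta>0_T: "\<delta>0 g \<in> T (hdeg g - 1) {wt g}" if "g \<in> G" for g
    unfolding \<delta>0_def by (rule d_T) (use that in \<open>simp add: words_def\<close>)
  have \<delta>0_eps: "\<delta>0 (\<epsilon> w) = monomial (map \<iota> w)" if "w \<in> W" for w
    using acyclic_extension_bd[OF ae, of "monomial w"] that by (simp add: \<delta>0_def \<epsilon>_def)
  have d_\<delta>0: "?d (\<delta>0 g) = 0" if "g \<in> G" for g
    using dg_tensor_square[OF dg, of "monomial [g]"] that d_eq[OF subsetD[OF T_subset \<delta>0_T[OF that]]]
    by (simp add: \<delta>0_def)
  have monomial_relations: "monomial ` W \<subseteq> wspan (lists X)"
    using W_lists by auto
  have exact: "exact_at ?d n" if "1 \<le> n" for n
    unfolding exact_at_def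
  proof (intro allI ballI impI)
    have n0: "n \<noteq> 0" using that by simp
    fix u p assume p: "p \<in> T n {u}" "?d p = 0"
    then have pU: "p \<in> T n UNIV" by (auto elim: T_monoD)
    then have "d p = 0" using p(2) d_eq[OF subsetD[OF T_subset pU]] by simp
    then obtain y where y: "y \<in> T (n + 1) UNIV" "d y = p"
      using quasi_iso_presented_exact[OF monomial_relations acyclic_extension_model[OF ae] n0, of p] pU
      by (auto simp: hcomp_T)
    \<comment> \<open>The primitive supplied by acyclicity has the right degree but possibly mixed
      grades; its part in grade \<open>u\<close> is again a primitive.\<close>
    have "?d (part u y) = part u (?d y)"
      by (rule part_commute[OF lin_derivation_ext d_T' y(1)])
    also have "\<dots> = p"
      using y d_eq[OF subsetD[OF T_subset y(1)]] part_id[OF p(1)] by simp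
    finally show "\<exists>y\<in>T (n + 1) {u}. ?d y = p"
      using part_in_T[OF y(1)] by blast
  qed
  note conv_iff = convergent_rs_iff[OF assms(3)]
  have "\<forall>u v. less v u \<longrightarrow> v \<in> lists X" using less_lists(1) by blast
  note endo_iff = filtered_endo_iff[OF this]
  show ?thesis
  proof
    assume "convergent_rs X W f"
    then have conv: "\<And>g. g \<in> J \<Longrightarrow> irreducible g \<Longrightarrow> g = 0"
      unfolding conv_iff by blast
    obtain \<delta> where \<delta>: "\<And>N. perturbs_to \<delta>0 N \<delta>"
      using exists_perturbation[OF \<delta>0_T \<delta>0_eps d_\<delta>0 exact conv] by blast
    let ?D = "derivation_ext hdeg \<delta>"
    let ?r = "\<lambda>w. monomial w - f w"
    \<comment> \<open>Distinct members of \<open>W\<close> have distinct relations, so a relation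
      determines its word and thereby its generator.\<close>
    define e' where "e' r = \<epsilon> (the_inv_into W ?r r)" for r
    have e': "e' (?r w) = \<epsilon> w" if "w \<in> W" for w
      by (simp add: e'_def the_inv_into_f_f[OF inj_relation that])
    have filt: "filtered_at ?d ?D n" for n
      by (rule perturbs_to_filtered[OF \<delta>0_T \<delta> order_refl])
    have res: "resolves ?D"
      by (rule perturbs_to_resolves[OF \<delta>, of 0]) simp
    have DT: "?D p \<in> T (n - 1) UNIV" if "p \<in> T n UNIV" for n p
      using filtered_at_T[OF lin_derivation_ext filt that] by (rule T_monoD) simp
    have DD: "?D (?D p) = 0" if "p \<in> wspan (lists G)" for p
    proof -
      have "?D (?D p) \<in> {0}"
      proof (rule lin_wspan[OF lin_comp[OF lin_derivation_ext lin_derivation_ext] falg.subspace_single_0 _ that])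
        fix m assume "m \<in> lists G"
        then have "monomial m \<in> T (sum_list (map hdeg m)) UNIV" by (simp add: words_def)
        then show "?D (?D (monomial m)) \<in> {0}"
          using perturbs_to_square_zero[OF \<delta> order_refl] by simp
      qed
      then show ?thesis by simp
    qed
    have dgD: "dg_algebra (tensor_dga G hdeg ?D)"
    proof (rule dg_algebra_tensor_dga[OF lin_derivation_ext])
      show "?D p \<in> wspan {m \<in> lists G. sum_list (map hdeg m) = n - 1}"
        if "p \<in> wspan {m \<in> lists G. sum_list (map hdeg m) = n}" for n p
        using DT[of p n] that by (simp add: T_UNIV)
      show "?D (p * q) = ?D p * q + scale ((- 1) powi n) (p * ?D q)"
        if "p \<in> wspan {m \<in> lists G. sum_list (map hdeg m) = n}" for n p q
        by (rule derivation_ext_leibniz, rule wspan_monoD[OF that]) auto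
    qed (rule DD)
    have "is_model G hdeg ?D B (\<lambda>p. coset (proj p))"
    proof (rule model_of_exact[OF dgD lin_derivation_ext res])
      show "\<exists>y\<in>T (n + 1) UNIV. ?D y = z" if "1 \<le> n" "z \<in> T n UNIV" "?D z = 0" for n z
      proof -
        have "\<exists>y\<in>T (n + 1) (down (grades z)). ?D y = z"
          by (rule exact_at_perturbed[OF lin_derivation_ext filt filt exact[OF that(1)] _ that(2,3)])
             (rule DD, erule subsetD[OF T_subset])
        then show ?thesis using T_mono[of _ UNIV] by blast
      qed
      show "\<exists>y\<in>T 1 UNIV. ?D y = gen_map \<iota> p" if "p \<in> J" for p
        using ideal_is_boundary[OF conv lin_derivation_ext res that] T_mono[of _ UNIV] by blast
    qed
    then have "acyclic_extension X (relations W f) G hdeg \<iota> e' ?D (\<lambda>p. coset (proj p))"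
    proof (rule acyclic_extensionI[OF _ hdeg_nonneg G0])
      \<comment> \<open>The grading tells generators apart: \<open>\<iota> x\<close> has grade
        \<open>[x]\<close>, and, used below, \<open>\<epsilon> w\<close> has grade
        \<open>w\<close>.\<close>
      show "inj_on \<iota> X"
        by (rule inj_onI) (metis wt_iota list.inject)
      show "{g \<in> G. hdeg g = 1} = e' ` relations W f"
        using e' by (simp add: G1 relations_def image_image)
      show "inj_on e' (relations W f)"
      proof (rule inj_onI)
        fix r s assume "r \<in> relations W f" "s \<in> relations W f" "e' r = e' s"
        then obtain v w where "v \<in> W" "w \<in> W" "r = ?r v" "s = ?r w" "\<epsilon> v = \<epsilon> w"
          using e' by (auto simp: relations_def)
        then show "r = s" by (metis wt_eps)
      qed
      show "\<delta> (\<iota> x) = 0" if "x \<in> X" for x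
        using perturbs_toD(1)[OF \<delta>, of "\<iota> x" 0] iota[OF that] T_negative[of "- 1" UNIV] by simp
      show "\<delta> (e' s) = gen_map \<iota> s" if "s \<in> relations W f" for s
        using that \<delta>[of 0] e' by (auto simp: relations_def perturbs_to_def)
    qed
    moreover have "filtered_endo X less (tensor_dga G hdeg d) (tensor_grade G wt) (\<lambda>p. ?D p - d p)"
      unfolding endo_iff linear_between_tensor_dga
    proof (intro conjI ballI allI)
      show "(\<lambda>p. ?D p - d p) ` wspan (lists G) \<subseteq> wspan (lists G)"
        using dg_tensor_linear(1)[OF dg] dg_tensor_linear(1)[OF dgD] by (auto intro: wspan_diff)
      fix u and p :: "('g, 'k) falg" assume p: "p \<in> wspan {m \<in> lists G. grade m = u}"
      then have "p \<in> wspan (lists G)" by (rule wspan_monoD) auto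
      then have "?D p - d p = ?D p - ?d p" by (simp add: d_eq)
      also have "\<dots> \<in> wspan {m \<in> lists G. less (grade m) u}"
      proof (rule lin_wspan[OF lin_minus[OF lin_derivation_ext lin_derivation_ext] wspan_subspace _ p])
        \<comment> \<open>A grade does not fix a degree, so \<open>filtered_at\<close> is applied to
          each word in its own degree.\<close>
        fix m assume m: "m \<in> {m \<in> lists G. grade m = u}"
        then have "monomial m \<in> T (sum_list (map hdeg m)) {u}" by (simp add: words_def)
        from filtered_atD(2)[OF filt this]
        show "?D (monomial m) - ?d (monomial m) \<in> wspan {m \<in> lists G. less (grade m) u}"
          by (rule wspan_monoD) (auto simp: words_def)
      qed
      finally show "?D p - d p \<in> wspan {m \<in> lists G. less (grade m) u}" .
    qed (simp_all add: dg_tensor_linear[OF dg] lin_add[OF lin_derivation_ext]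
        lin_scale[OF lin_derivation_ext] falg.scale_right_diff_distrib)
    moreover have "\<forall>w\<in>W. e' (?r w) = e (monomial w)"
      using e' by (simp add: \<epsilon>_def)
    ultimately show "\<exists>d' e' \<phi>'. (\<forall>w\<in>W. e' (monomial w - f w) = e (monomial w)) \<and>
       acyclic_extension X (relations W f) G hdeg \<iota> e' (\<lambda>p. d p + d' p) \<phi>' \<and>
       filtered_endo X (less_rs X W f) (tensor_dga G hdeg d) (tensor_grade G wt) d'"
      by (intro exI[of _ "\<lambda>p. ?D p - d p"] exI[of _ e'] exI[of _ "\<lambda>p. coset (proj p)"]) simp
  next
    assume "\<exists>d' e' \<phi>'. (\<forall>w\<in>W. e' (monomial w - f w) = e (monomial w)) \<and>
       acyclic_extension X (relations W f) G hdeg \<iota> e' (\<lambda>p. d p + d' p) \<phi>' \<and>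
       filtered_endo X (less_rs X W f) (tensor_dga G hdeg d) (tensor_grade G wt) d'"
    then obtain d' e' \<phi>' where e': "\<And>w. w \<in> W \<Longrightarrow> e' (monomial w - f w) = \<epsilon> w"
      and ae': "acyclic_extension X (relations W f) G hdeg \<iota> e' (\<lambda>p. d p + d' p) \<phi>'"
      and filt': "filtered_endo X less (tensor_dga G hdeg d) (tensor_grade G wt) d'"
      unfolding \<epsilon>_def by blast
    define \<delta> where "\<delta> g = d (monomial [g]) + d' (monomial [g])" for g
    let ?D = "derivation_ext hdeg \<delta>"
    note dg' = acyclic_extension_model(1)[OF ae']
    have D_eq: "d p + d' p = ?D p" if "p \<in> wspan (lists G)" for p
      using dg_tensor_derivation[OF dg' that] by (simp add: \<delta>_def[abs_def])
    have \<delta>_T: "\<delta> g \<in> T (hdeg g - 1) UNIV" if "g \<in> G" for g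
      using dg_tensor_degree[OF dg', of "monomial [g]" "hdeg g"] that by (simp add: \<delta>_def T_UNIV)
    \<comment> \<open>A given extension with filtered perturbation satisfies the same predicate as a
      constructed one, so the facts about \<open>perturbs_to\<close> serve both directions.\<close>
    have "perturbs_to \<delta>0 N \<delta>" for N
      unfolding perturbs_to_def
    proof (intro conjI ballI impI)
      fix g assume g: "g \<in> G"
      show "\<delta> g \<in> T (hdeg g - 1) UNIV" by (rule \<delta>_T[OF g])
      have "\<delta>0 g \<in> T (hdeg g - 1) UNIV" by (rule T_monoD[OF \<delta>0_T[OF g]]) simp
      then have "\<delta> g - \<delta>0 g \<in> T (hdeg g - 1) UNIV"
        using \<delta>_T[OF g] by (intro wspan_diff)
      moreover have "wt g \<in> lists X" using wt(1) g by blast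
      then have "d' (monomial [g]) \<in> wspan {m \<in> lists G. less (grade m) (wt g)}"
        using filt' g unfolding endo_iff by simp
      then have "\<delta> g - \<delta>0 g \<in> wspan {m \<in> lists G. less (grade m) (wt g)}"
        by (simp add: \<delta>_def \<delta>0_def)
      \<comment> \<open>Filteredness bounds the grades and the differentials fix the degree; the
        intersection of the two spans is again a span of words.\<close>
      ultimately have "\<delta> g - \<delta>0 g \<in> wspan (words G hdeg wt (hdeg g - 1) UNIV \<inter> {m \<in> lists G. less (grade m) (wt g)})"
        unfolding wspan_Int by blast
      then show "\<delta> g - \<delta>0 g \<in> T (hdeg g - 1) {v. less v (wt g)}"
        by (rule wspan_monoD) (auto simp: words_def)
      show "?D (\<delta> g) = 0"
        using dg_tensor_square[OF dg', of "monomial [g]"] g D_eq[OF subsetD[OF T_subset \<delta>_T[OF g]]]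
        by (simp add: \<delta>_def)
    next
      fix w assume "w \<in> W"
      then show "\<delta> (\<epsilon> w) = gen_map \<iota> (monomial w - f w)"
        using acyclic_extension_bd[OF ae', of "monomial w - f w"] e'[of w]
        by (simp add: relations_def \<delta>_def)
    qed
    note \<delta> = this
    have filt: "filtered_at ?d ?D n" for n
      by (rule perturbs_to_filtered[OF \<delta>0_T \<delta> order_refl])
    have DD: "?D (?D y) = 0" if "y \<in> T n UNIV" for n y
      by (rule perturbs_to_square_zero[OF \<delta> order_refl that])
    \<comment> \<open>The elements that bound from degree 1 form an ideal containing the relations,
      hence containing \<open>J\<close>.\<close>
    let ?K = "{p \<in> wspan (lists X). \<exists>y\<in>T 1 UNIV. ?D y = gen_map \<iota> p}"
    have "J \<subseteq> ?K"
    proof (rule J_minimal)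
      show "falg.subspace ?K"
      proof (rule falg.subspaceI)
        show "0 \<in> ?K"
          by (auto simp: lin_zero[OF lin_gen_map] lin_zero[OF lin_derivation_ext] intro!: bexI[of _ 0])
        fix p assume p: "p \<in> ?K"
        then obtain y where y: "y \<in> T 1 UNIV" "?D y = gen_map \<iota> p" by blast
        show "scale c p \<in> ?K" for c
          using p y by (auto simp: lin_scale[OF lin_gen_map] lin_scale[OF lin_derivation_ext] wspan_scale
              intro!: bexI[of _ "scale c y"])
        fix q assume q: "q \<in> ?K"
        then obtain z where "z \<in> T 1 UNIV" "?D z = gen_map \<iota> q" by blast
        then show "p + q \<in> ?K"
          using p q y by (auto simp: lin_add[OF lin_gen_map] lin_add[OF lin_derivation_ext] wspan_add
              intro!: bexI[of _ "y + z"])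
      qed
      show "?K \<subseteq> wspan (lists X)" by blast
      show "p * q \<in> ?K \<and> q * p \<in> ?K" if p: "p \<in> ?K" and q: "q \<in> wspan (lists X)" for p q
      proof -
        obtain y where y: "y \<in> T 1 UNIV" "?D y = gen_map \<iota> p" using p by blast
        let ?q = "gen_map \<iota> q :: ('g, 'k) falg"
        have q': "?q \<in> T 0 UNIV" by (rule T_monoD[OF gen_map_in_T[OF q]]) simp
        \<comment> \<open>Since \<open>?D\<close> kills degree 0, only the term with
          \<open>?D y\<close> survives in either Leibniz expansion, without sign.\<close>
        have "?D ?q = 0"
          using filtered_at_T[OF lin_derivation_ext filt q'] T_negative[of "0 - 1"] by simp
        moreover have "y \<in> wspan {m. sum_list (map hdeg m) = 1}" "?q \<in> wspan {m. sum_list (map hdeg m) = 0}"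
          using y(1) q' by (auto elim!: wspan_monoD simp: words_def)
        ultimately have "?D (y * ?q) = gen_map \<iota> (p * q)" "?D (?q * y) = gen_map \<iota> (q * p)"
          using derivation_ext_leibniz[of y hdeg 1 \<delta> ?q] derivation_ext_leibniz[of ?q hdeg 0 \<delta> y] y(2)
          by (simp_all add: gen_map_mult)
        moreover have "y * ?q \<in> T 1 UNIV" "?q * y \<in> T 1 UNIV"
          by (rule wspan_mult[OF y(1) q'] wspan_mult[OF q' y(1)]; simp add: words_def)+
        moreover have "p * q \<in> wspan (lists X)" "q * p \<in> wspan (lists X)"
          using p q by (simp_all add: wspan_mult[of _ "lists X" _ "lists X"])
        ultimately show ?thesis by blast
      qed
      fix w assume w: "w \<in> W"
      have "monomial [\<epsilon> w] \<in> T 1 UNIV" using eps[OF w] by (simp add: words_def)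
      moreover have "?D (monomial [\<epsilon> w]) = gen_map \<iota> (monomial w - f w)"
        using \<delta>[of 0] w by (simp add: perturbs_to_def derivation_ext_monomial monomial_Nil)
      moreover have "monomial w - f w \<in> wspan (lists X)"
        using relations_subset w by (auto simp: relations_def)
      ultimately show "monomial w - f w \<in> ?K" by blast
    qed
    then have "g = 0" if "g \<in> J" "irreducible g" for g
    proof -
      obtain h where "h \<in> T 1 UNIV" "?D h = gen_map \<iota> g"
        using \<open>J \<subseteq> ?K\<close> \<open>g \<in> J\<close> by blast
      then show ?thesis
        using irreducible_boundary_zero[of ?D ?d h g] that J_in filt exact[of 1] DD[of _ 2]
          lin_derivation_ext by blast
    qed
    then show "convergent_rs X W f"
      unfolding conv_iff by blast
  qed
qed

end
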